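(* Let $\mu = (\mu_1,\mu_2,\ldots,\mu_l)$ be a partition of $n$ with exactly $l$ parts. Suppose $p=0$. The Specht module $S^\mu$ has a submodule isomorphic to the trivial $\mathcal H$-module $S^{(n)}$ if and only if $\mu=(n)$ or $\mu=(\mu_1,(e-1)^{l-2},\mu_l)$ where $e \mid \mu_1+1$. Suppose $p>0$. The Specht module $S^\mu$ has a submodule isomorphic to the trivial $\mathcal H$-module $S^{(n)}$ if and only if, for $1 \leq i <l$, $\mu_i \equiv -1 \bmod ep^{z_i}$ where $z_i = \ell_p((\mu_{i+1})^\ast)$.
   Context: $F$ is a field of characteristic $p\ge 0$, $q\in F$ is invertible, $n\ge1$, and $e$ is the least integer $>1$ with $1+q+\dots+q^{e-1}=0$ in $F$; $e$ is assumed to exist (to be finite). For a non-negative integer $b$ write $b=b^\ast e+b'$ with $0\le b'<e$; for $p>0$, $\ell_p(b)$ is the least non-negative integer with $b<p^{\ell_p(b)}$. The notation $(e-1)^{l-2}$ means $l-2$ consecutive parts equal to $e-1$. The symmetric group $\mathfrak S_n$ acts on $\{1,\dots,n\}$ from the right (products are read left to right); $s_i=(i,i+1)$ and $\ell(w)$ is the length of $w$ in the generators $s_i$. $\mathcal H=\mathcal H_{F,q}(\mathfrak S_n)$ is the associative $F$-algebra with basis $\{T_w\mid w\in\mathfrak S_n\}$ and multiplication determined by $T_wT_{s_i}=T_{ws_i}$ if $\ell(ws_i)=\ell(w)+1$ and $T_wT_{s_i}=qT_{ws_i}+(q-1)T_w$ if $\ell(ws_i)=\ell(w)-1$. For a composition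 $\lambda$ of $n$, the diagram of $\lambda$ is $\{(i,j)\mid i\geq 1,\ 1\le j\le\lambda_i\}$; a $\lambda$-tableau is a filling of it by $1,\dots,n$, on which $\mathfrak S_n$ acts from the right by permuting entries. $\mathfrak t^\lambda$ is the $\lambda$-tableau with $1,\dots,n$ entered in order along the rows, $\mathfrak t_\lambda$ the one with $1,\dots,n$ entered in order down the columns; $w_\lambda$ is defined by $\mathfrak t^\lambda w_\lambda=\mathfrak t_\lambda$. $\mathfrak S_\lambda$ is the row stabilizer of $\mathfrak t^\lambda$, $x_\lambda=\sum_{w\in\mathfrak S_\lambda}T_w$, $y_\lambda=\sum_{w\in\mathfrak S_\lambda}(-q)^{-\ell(w)}T_w$. For a partition $\lambda$ with conjugate $\lambda'$, the Specht module is the right $\mathcal H$-module $S^\lambda=x_\lambda T_{w_\lambda}y_{\lambda'}\mathcal H$; in particular $S^{(n)}$ is the trivial module.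
   Formalization: For p=0 the shape (μ_1,(e-1)^{l-2},μ_l) is read with l≥2 and μ_l≤e-1; this matters only for l=2, where without the bound the claim fails, e.g. over Q with q=-1, e=2, μ=(3,2). *)

theory Defs
  imports
    "HOL-Combinatorics.Permutations"
    "HOL-Number_Theory.Cong"
    "HOL-Computational_Algebra.Computational_Algebra"
begin

section \<open>The symmetric group, acting from the right\<close>

text \<open>
  A permutation \<open>w\<close> of \<open>{1..n}\<close> is the function sending \<open>i\<close> to \<open>i w\<close>. Products are read from
  left to right, so the product \<open>u v\<close> is the function \<open>v \<circ> u\<close>.
\<close>

type_synonym permutation = "nat \<Rightarrow> nat"

definition sym_grp :: "nat \<Rightarrow> permutation set" where
  "sym_grp n = {w. w permutes {1..n}}"

definition simple_refl :: "nat \<Rightarrow> permutation" where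
  "simple_refl i = transpose i (i + 1)"

definition right_mult_simple :: "permutation \<Rightarrow> nat \<Rightarrow> permutation" where
  "right_mult_simple w i = simple_refl i \<circ> w"

definition is_word :: "nat \<Rightarrow> permutation \<Rightarrow> nat list \<Rightarrow> bool" where
  "is_word n w js \<longleftrightarrow> set js \<subseteq> {1..<n} \<and> foldl right_mult_simple id js = w"

definition perm_length :: "nat \<Rightarrow> permutation \<Rightarrow> nat" where
  "perm_length n w = (LEAST k. \<exists>js. is_word n w js \<and> length js = k)"

definition reduced_word :: "nat \<Rightarrow> permutation \<Rightarrow> nat list" where
  "reduced_word n w = (SOME js. is_word n w js \<and> length js = perm_length n w)"


section \<open>The Hecke algebra\<close>

text \<open>
  The element \<open>\<Sum>w. f w T\<^sub>w\<close> is represented by its coefficient function \<open>f\<close>, which vanishes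
  outside the symmetric group.
\<close>

type_synonym 'a hecke = "permutation \<Rightarrow> 'a"

definition hecke_carrier :: "nat \<Rightarrow> ('a::field) hecke set" where
  "hecke_carrier n = {f. \<forall>w. w \<notin> sym_grp n \<longrightarrow> f w = 0}"

definition hecke_T :: "permutation \<Rightarrow> ('a::field) hecke" where
  "hecke_T w = (\<lambda>v. if v = w then 1 else 0)"

definition T_mult_simple :: "nat \<Rightarrow> 'a::field \<Rightarrow> permutation \<Rightarrow> nat \<Rightarrow> 'a hecke" where
  "T_mult_simple n q w i =
     (let ws = right_mult_simple w i in
      if perm_length n ws = perm_length n w + 1 then hecke_T ws
      else (\<lambda>v. q * hecke_T ws v + (q - 1) * hecke_T w v))"

definition hecke_mult_simple :: "nat \<Rightarrow> 'a::field \<Rightarrow> 'a hecke \<Rightarrow> nat \<Rightarrow> 'a hecke" where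
  "hecke_mult_simple n q f i = (\<lambda>v. \<Sum>w\<in>sym_grp n. f w * T_mult_simple n q w i v)"

text \<open>
  The multiplication rules give \<open>T\<^sub>w = T\<^bsub>s(j1)\<^esub> \<cdots> T\<^bsub>s(jk)\<^esub>\<close> for every reduced word
  \<open>[j1, \<dots>, jk]\<close> of \<open>w\<close>. Associativity then forces the formula below for the product, which
  does not depend on the reduced words chosen.
\<close>

definition hecke_mult :: "nat \<Rightarrow> 'a::field \<Rightarrow> 'a hecke \<Rightarrow> 'a hecke \<Rightarrow> 'a hecke" where
  "hecke_mult n q f g =
     (\<lambda>v. \<Sum>w\<in>sym_grp n. g w * foldl (hecke_mult_simple n q) f (reduced_word n w) v)"

definition is_right_submodule :: "nat \<Rightarrow> 'a::field \<Rightarrow> 'a hecke set \<Rightarrow> bool" where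
  "is_right_submodule n q N \<longleftrightarrow>
     N \<subseteq> hecke_carrier n \<and>
     (\<lambda>_. 0) \<in> N \<and>
     (\<forall>f\<in>N. \<forall>g\<in>N. (\<lambda>w. f w + g w) \<in> N) \<and>
     (\<forall>c. \<forall>f\<in>N. (\<lambda>w. c * f w) \<in> N) \<and>
     (\<forall>f\<in>N. \<forall>h\<in>hecke_carrier n. hecke_mult n q f h \<in> N)"

definition is_right_module_iso ::
  "nat \<Rightarrow> 'a::field \<Rightarrow> 'a hecke set \<Rightarrow> 'a hecke set \<Rightarrow> ('a hecke \<Rightarrow> 'a hecke) \<Rightarrow> bool" where
  "is_right_module_iso n q M N \<phi> \<longleftrightarrow>
     bij_betw \<phi> M N \<and>
     (\<forall>f\<in>M. \<forall>g\<in>M. \<phi> (\<lambda>w. f w + g w) = (\<lambda>w. \<phi> f w + \<phi> g w)) \<and>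
     (\<forall>c. \<forall>f\<in>M. \<phi> (\<lambda>w. c * f w) = (\<lambda>w. c * \<phi> f w)) \<and>
     (\<forall>f\<in>M. \<forall>h\<in>hecke_carrier n. \<phi> (hecke_mult n q f h) = hecke_mult n q (\<phi> f) h)"

definition has_submodule_isomorphic_to ::
  "nat \<Rightarrow> 'a::field \<Rightarrow> 'a hecke set \<Rightarrow> 'a hecke set \<Rightarrow> bool" where
  "has_submodule_isomorphic_to n q M L \<longleftrightarrow>
     (\<exists>N \<phi>. N \<subseteq> M \<and> is_right_submodule n q N \<and> is_right_module_iso n q L N \<phi>)"


section \<open>Compositions, partitions and tableaux\<close>

text \<open>Compositions are lists; \<open>part \<nu> i\<close> is the \<open>i\<close>-th part, counted from 1.\<close>

definition part :: "nat list \<Rightarrow> nat \<Rightarrow> nat" where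
  "part \<nu> i = \<nu> ! (i - 1)"

definition is_partition :: "nat \<Rightarrow> nat list \<Rightarrow> bool" where
  "is_partition n \<nu> \<longleftrightarrow> sorted_wrt (\<ge>) \<nu> \<and> 0 \<notin> set \<nu> \<and> sum_list \<nu> = n"

definition conjugate :: "nat list \<Rightarrow> nat list" where
  "conjugate \<nu> = map (\<lambda>j. card {i \<in> {1..length \<nu>}. j \<le> part \<nu> i}) [1..<Suc (hd \<nu>)]"

definition diagram :: "nat list \<Rightarrow> (nat \<times> nat) set" where
  "diagram \<nu> = {(i, j). 1 \<le> i \<and> i \<le> length \<nu> \<and> 1 \<le> j \<and> j \<le> part \<nu> i}"

text \<open>
  The entry at a node is the number of nodes up to and including it, in the order of reading
  along the rows, respectively down the columns.
\<close>

definition row_tableau :: "nat list \<Rightarrow> nat \<times> nat \<Rightarrow> nat" where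
  "row_tableau \<nu> = (\<lambda>(i, j). card {(i', j') \<in> diagram \<nu>. i' < i \<or> i' = i \<and> j' \<le> j})"

definition col_tableau :: "nat list \<Rightarrow> nat \<times> nat \<Rightarrow> nat" where
  "col_tableau \<nu> = (\<lambda>(i, j). card {(i', j') \<in> diagram \<nu>. j' < j \<or> j' = j \<and> i' \<le> i})"

definition w_tab :: "nat list \<Rightarrow> permutation" where
  "w_tab \<nu> = (THE w. w \<in> sym_grp (sum_list \<nu>) \<and>
                (\<forall>x\<in>diagram \<nu>. w (row_tableau \<nu> x) = col_tableau \<nu> x))"

definition row_stabilizer :: "nat list \<Rightarrow> permutation set" where
  "row_stabilizer \<nu> =
     {w \<in> sym_grp (sum_list \<nu>).
        \<forall>(i, j)\<in>diagram \<nu>. \<exists>j'. (i, j') \<in> diagram \<nu> \<and>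
          w (row_tableau \<nu> (i, j)) = row_tableau \<nu> (i, j')}"


section \<open>Specht modules\<close>

definition hecke_x :: "nat list \<Rightarrow> ('a::field) hecke" where
  "hecke_x \<nu> = (\<lambda>v. \<Sum>w\<in>row_stabilizer \<nu>. hecke_T w v)"

definition hecke_y :: "'a::field \<Rightarrow> nat list \<Rightarrow> 'a hecke" where
  "hecke_y q \<nu> =
     (\<lambda>v. \<Sum>w\<in>row_stabilizer \<nu>.
        (- q) powi (- int (perm_length (sum_list \<nu>) w)) * hecke_T w v)"

definition specht :: "'a::field \<Rightarrow> nat list \<Rightarrow> 'a hecke set" where
  "specht q \<nu> =
     (let n = sum_list \<nu>;
          z = hecke_mult n q (hecke_mult n q (hecke_x \<nu>) (hecke_T (w_tab \<nu>)))
                (hecke_y q (conjugate \<nu>))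
      in hecke_mult n q z ` hecke_carrier n)"


section \<open>Arithmetic conditions\<close>

definition is_quantum_char :: "'a::field \<Rightarrow> nat \<Rightarrow> bool" where
  "is_quantum_char q e \<longleftrightarrow>
     1 < e \<and> (\<Sum>i<e. q ^ i) = 0 \<and> (\<forall>k. 1 < k \<and> k < e \<longrightarrow> (\<Sum>i<k. q ^ i) \<noteq> 0)"

text \<open>The quotient \<open>b\<^sup>*\<close> of \<open>b\<close> by \<open>e\<close> is written \<open>b div e\<close>.\<close>

definition ell :: "nat \<Rightarrow> nat \<Rightarrow> nat" where
  "ell p b = (LEAST k. b < p ^ k)"

text \<open>
  The condition for characteristic 0. The shape \<open>(\<mu>\<^sub>1, (e-1)\<^sup>l\<^sup>-\<^sup>2, \<mu>\<^sub>l)\<close> presupposes \<open>l \<ge> 2\<close>, and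
  is read as one in which the last part is at most \<open>e - 1\<close>. For \<open>l \<ge> 3\<close> this bound holds
  automatically. For \<open>l = 2\<close> it has to be required: for \<open>q = -1\<close> in characteristic 0 (so
  \<open>e = 2\<close>), the Specht module of \<open>(3, 2)\<close> has no trivial submodule although \<open>2\<close> divides \<open>3 + 1\<close>.
\<close>

definition char_zero_shape :: "nat \<Rightarrow> nat list \<Rightarrow> bool" where
  "char_zero_shape e \<mu> \<longleftrightarrow>
     (let l = length \<mu> in
      2 \<le> l \<and>
      \<mu> = [part \<mu> 1] @ replicate (l - 2) (e - 1) @ [part \<mu> l] \<and>
      part \<mu> l \<le> e - 1 \<and>
      e dvd part \<mu> 1 + 1)"

end

theory Submission
  imports Defs
begin

text \<open>
  The right ideal \<open>x\<^sub>\<mu> H\<close> is a space of functions on words. A permutation \<open>v\<close> determines the word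
  that has in position \<open>m\<close> the row of \<open>m v\<^sup>-\<^sup>1\<close> in the tableau \<open>t\<^sup>\<mu>\<close>, and the elements of
  \<open>x\<^sub>\<mu> H\<close> are the elements whose coefficients depend on this word only. In these terms \<open>T\<^sub>i\<close> acts
  on positions \<open>i\<close> and \<open>i + 1\<close> by the operator \<open>act\<close>. An element on which every \<open>T\<^sub>i\<close> acts as
  \<open>q\<close> has constant coefficients. Therefore \<open>S\<^sup>\<mu>\<close> has a trivial submodule if and only if the constant
  function 1 belongs to it (\<open>trivial_submodule_iff\<close>).

  To decide this, \<open>S\<^sup>\<mu>\<close> is described by linear equations, following the kernel intersection theorem
  of James and of Dipper and James: it is the common kernel of the maps \<open>\<psi>\<close> that change \<open>t \<ge> 1\<close>
  letters \<open>r + 1\<close> into \<open>r\<close> (\<open>specht_eq_kernel\<close>). The maps \<open>\<psi>\<close> commute with the action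
  (\<open>psi_act\<close>) and kill the generator of \<open>S\<^sup>\<mu>\<close> by a sign-reversing involution
  (\<open>antisymmetrizer_in_kernel\<close>), so \<open>S\<^sup>\<mu>\<close> lies in the common kernel. For the converse, words are
  ordered by dominance. On the one hand, a maximal word in the support of an element of the kernel
  is a ballot word: sorting a prefix that violates the ballot condition preserves maximality, and for a
  sorted prefix a Garnir relation expresses the coefficient of the word by coefficients of larger
  words (\<open>maximal_word_ballot\<close>). On the other hand, each ballot word is the largest word in the
  support of some element of \<open>S\<^sup>\<mu>\<close>: this holds for the generator and the column word, and every
  ballot word is reached from the column word by sorting descents (\<open>top_words_exist\<close>). Subtracting
  leading words thus reduces every element of the kernel to 0 modulo \<open>S\<^sup>\<mu>\<close>.

  The value of \<open>\<psi>\<close> on the constant function is the coefficient of \<open>x\<^sup>t\<close> in the product of the factors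
  \<open>1 + q\<^sup>i x\<close> with \<open>i < \<mu>\<^sub>r + t\<close>, which is a power of \<open>q\<close> times a Gaussian binomial coefficient. With
  \<open>a = \<mu>\<^sub>r\<close> and \<open>b = \<mu>\<^bsub>r+1\<^esub>\<close>, Pascal's rule turns the vanishing of these values for
  \<open>1 \<le> t \<le> b\<close> into a condition on one polynomial: the product of the \<open>1 + q\<^sup>i x\<close> over
  \<open>i \<le> a\<close> is 1 modulo \<open>x\<^bsup>b+1\<^esup>\<close>. Its linear coefficient forces \<open>e\<close> to divide
  \<open>a + 1\<close>. If \<open>a + 1 = e m\<close>, then the product is \<open>(1 + c x\<^sup>e)\<^sup>m\<close> with \<open>c \<noteq> 0\<close>. In
  characteristic 0 its first nonconstant term has degree \<open>e\<close>. In characteristic \<open>p\<close>, with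
  \<open>m = p\<^sup>k m'\<close> and \<open>m'\<close> prime to \<open>p\<close>, the product is \<open>(1 + d y)\<^bsup>m'\<^esup>\<close> with
  \<open>y = x ^ (e p\<^sup>k)\<close> and \<open>d \<noteq> 0\<close>, and its first nonconstant term has degree \<open>e p\<^sup>k\<close>. So the
  condition is \<open>b < e\<close>, respectively \<open>b < e p\<^sup>k\<close>. For all pairs of adjacent parts together these are
  the conditions of the theorem; in characteristic 0 they determine the shape of \<open>\<mu>\<close>
  (\<open>char_zero_condition\<close>).
\<close>

section \<open>Vanishing of Gaussian binomial coefficients\<close>

text \<open>
  By the q-binomial theorem the coefficient of \<open>x\<^sup>t\<close> is \<open>q\<^bsup>t(t-1)/2\<^esup>\<close>
  times the Gaussian binomial coefficient of \<open>N\<close> over \<open>t\<close>.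
\<close>

definition q_linear_prod :: "'a::field \<Rightarrow> nat \<Rightarrow> 'a poly" where
  "q_linear_prod q N = (\<Prod>i<N. [:1, q ^ i:])"

lemma q_linear_prod_0 [simp]: "q_linear_prod q 0 = 1"
  by (simp add: q_linear_prod_def)

lemma q_linear_prod_Suc: "q_linear_prod q (Suc N) = q_linear_prod q N * [:1, q ^ N:]"
  by (simp add: q_linear_prod_def)

lemma coeff_q_linear_prod_0 [simp]: "coeff (q_linear_prod q N) 0 = 1"
  by (induction N) (auto simp: q_linear_prod_Suc coeff_mult)

lemma coeff_mult_linear_Suc:
  fixes P :: "'a::field poly"
  shows "coeff (P * [:1, c:]) (Suc t) = coeff P (Suc t) + c * coeff P t"
  by (simp add: mult_pCons_right)

lemma coeff_q_linear_prod_Suc: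
  "coeff (q_linear_prod q (Suc N)) (Suc t) =
     coeff (q_linear_prod q N) (Suc t) + q ^ N * coeff (q_linear_prod q N) t"
  by (simp add: q_linear_prod_Suc coeff_mult_linear_Suc del: mult_pCons_right)

text \<open>
  Pascal's rule spreads zeros in both directions. Zeros in degrees 1 to \<open>b\<close> of the product with
  \<open>a + 1\<close> factors persist in the degrees \<open>t > d\<close> after \<open>d\<close> further factors.
  Conversely, the diagonal zeros are carried back from \<open>a + t\<close> to \<open>a + 1\<close> factors by induction
  on \<open>t\<close>.
\<close>

lemma q_binomials_vanish_iff:
  fixes q :: "'a::field"
  shows "(\<forall>t. 1 \<le> t \<and> t \<le> b \<longrightarrow> coeff (q_linear_prod q (a + t)) t = 0) \<longleftrightarrow>
         (\<forall>t. 1 \<le> t \<and> t \<le> b \<longrightarrow> coeff (q_linear_prod q (a + 1)) t = 0)"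
    (is "?L \<longleftrightarrow> ?R")
proof
  assume R: ?R
  have *: "coeff (q_linear_prod q (Suc (a + d))) t = 0" if "Suc d \<le> t" "t \<le> b" for d t
    using that
  proof (induction d arbitrary: t)
    case 0
    then show ?case using R by simp
  next
    case (Suc d)
    then obtain t' where t': "t = Suc t'" by (cases t) auto
    have "coeff (q_linear_prod q (Suc (a + d))) (Suc t') = 0" "coeff (q_linear_prod q (Suc (a + d))) t' = 0"
      using Suc.IH[of t'] Suc.IH[of "Suc t'"] Suc.prems t' by auto
    then show ?case using coeff_q_linear_prod_Suc[of q "Suc (a + d)" t'] t' by simp
  qed
  show ?L
  proof (intro allI impI)
    fix t assume t: "1 \<le> t \<and> t \<le> b"
    then show "coeff (q_linear_prod q (a + t)) t = 0"
      using *[of "t - 1" t] by (cases t) auto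
  qed
next
  assume L: ?L
  have *: "coeff (q_linear_prod q (a + N)) t = 0" if "1 \<le> N" "N \<le> t" "t \<le> b" for N t
    using that
  proof (induction t arbitrary: N)
    case 0
    then show ?case by simp
  next
    case (Suc t)
    from Suc.prems(2,1) show ?case
    proof (induction rule: inc_induct)
      case base
      then show ?case using L[rule_format, of "Suc t"] Suc.prems by (simp del: add_Suc_right)
    next
      case (step N)
      have "coeff (q_linear_prod q (a + N)) t = 0"
        using Suc.IH[of N] step Suc.prems by simp
      moreover have "coeff (q_linear_prod q (a + Suc N)) (Suc t) = 0" using step by simp
      ultimately show ?case using coeff_q_linear_prod_Suc[of q "a + N" t] by simp
    qed
  qed
  show ?R using *[of 1] by auto
qed

lemma q_number_add:
  fixes q :: "'a::field"
  shows "(\<Sum>i<a + b. q ^ i) = (\<Sum>i<a. q ^ i) + q ^ a * (\<Sum>i<b. q ^ i)"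
  by (induction b) (auto simp: algebra_simps power_add)

lemma quantum_char_power:
  fixes q :: "'a::field"
  assumes "is_quantum_char q e"
  shows "q ^ e = 1"
proof -
  have "(q - 1) * (\<Sum>i<e. q ^ i) = q ^ e - 1" by (simp add: power_diff_1_eq)
  then show ?thesis using assms by (simp add: is_quantum_char_def)
qed

text \<open>
  The sum over \<open>i < k\<close> depends on \<open>k mod e\<close> only, because full blocks of length
  \<open>e\<close> sum to 0 and \<open>q\<^sup>e = 1\<close>.
\<close>

lemma q_number_eq_0_iff:
  fixes q :: "'a::field"
  assumes "is_quantum_char q e"
  shows "(\<Sum>i<k. q ^ i) = 0 \<longleftrightarrow> e dvd k"
proof -
  have e: "e > 1" "(\<Sum>i<e. q ^ i) = 0" and min: "\<And>k. 1 < k \<Longrightarrow> k < e \<Longrightarrow> (\<Sum>i<k. q ^ i) \<noteq> 0"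
    using assms by (auto simp: is_quantum_char_def)
  have qe: "q ^ e = 1" by (rule quantum_char_power[OF assms])
  have mult: "(\<Sum>i<e * m. q ^ i) = 0" for m
    by (induction m) (auto simp: q_number_add e)
  have "(\<Sum>i<k. q ^ i) = (\<Sum>i<e * (k div e) + k mod e. q ^ i)" by simp
  also have "\<dots> = q ^ (e * (k div e)) * (\<Sum>i<k mod e. q ^ i)"
    unfolding q_number_add by (simp add: mult)
  also have "\<dots> = (\<Sum>i<k mod e. q ^ i)" by (simp add: power_mult qe)
  finally have *: "(\<Sum>i<k. q ^ i) = (\<Sum>i<k mod e. q ^ i)" .
  consider "k mod e = 0" | "k mod e = 1" | "k mod e > 1" by linarith
  then show ?thesis
  proof cases
    case 3
    then have "(\<Sum>i<k mod e. q ^ i) \<noteq> 0" using min[of "k mod e"] e by simp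
    then show ?thesis using * 3 by (auto simp: dvd_eq_mod_eq_0)
  qed (use * in \<open>auto simp: dvd_eq_mod_eq_0\<close>)
qed

lemma coeff_q_linear_prod_1: "coeff (q_linear_prod q N) 1 = (\<Sum>i<N. q ^ i)"
  by (induction N) (auto simp: coeff_q_linear_prod_Suc)

text \<open>
  This is the coefficient form of \<open>P\<^bsub>N+1\<^esub>(x) = (1 + x) P\<^sub>N(q x)\<close>, where
  \<open>P\<^sub>N\<close> is the product. Together with
  \<open>P\<^bsub>N+1\<^esub>(x) = P\<^sub>N(x) (1 + q\<^sup>N x)\<close> it relates consecutive coefficients of
  \<open>P\<^sub>N\<close>.
\<close>

lemma coeff_q_linear_prod_shift:
  "coeff (q_linear_prod q (Suc N)) (Suc t) =
     q ^ Suc t * coeff (q_linear_prod q N) (Suc t) + q ^ t * coeff (q_linear_prod q N) t"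
proof (induction N arbitrary: t)
  case 0
  then show ?case by (cases t) (auto simp: coeff_q_linear_prod_Suc)
next
  case (Suc N)
  show ?case
  proof (cases t)
    case 0
    define X where "X = coeff (q_linear_prod q N) (Suc 0)"
    have "X + q ^ N = q * X + 1" using Suc[of 0] by (simp add: X_def coeff_q_linear_prod_Suc)
    have "X * q + q * q ^ N = q * (X + q ^ N)" by (simp add: algebra_simps)
    also have "\<dots> = q * (q * X + 1)" by (simp only: \<open>X + q ^ N = q * X + 1\<close>)
    also have "\<dots> = q + X * (q * q)" by (simp add: algebra_simps)
    finally have "X * q + q * q ^ N = q + X * (q * q)" .
    with \<open>X + q ^ N = q * X + 1\<close> show ?thesis using 0
      by (simp add: coeff_q_linear_prod_Suc[of q "Suc N" 0] coeff_q_linear_prod_Suc[of q N 0]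
          algebra_simps flip: X_def)
  next
    case t: (Suc t')
    have "coeff (q_linear_prod q (Suc (Suc N))) (Suc t)
        = coeff (q_linear_prod q (Suc N)) (Suc t) + q ^ Suc N * coeff (q_linear_prod q (Suc N)) t"
      by (rule coeff_q_linear_prod_Suc)
    also have "\<dots> = q ^ Suc t * coeff (q_linear_prod q N) (Suc t) + q ^ t * coeff (q_linear_prod q N) t
        + q ^ Suc N * (q ^ t * coeff (q_linear_prod q N) t + q ^ t' * coeff (q_linear_prod q N) t')"
      using Suc[of t] Suc[of t'] t by simp
    also have "\<dots> = q ^ Suc t * coeff (q_linear_prod q (Suc N)) (Suc t) + q ^ t * coeff (q_linear_prod q (Suc N)) t"
      using t by (simp add: coeff_q_linear_prod_Suc[of q N] algebra_simps)
    finally show ?thesis .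
  qed
qed

lemma coeff_q_linear_prod_top: "coeff (q_linear_prod q N) N \<noteq> 0 \<and> degree (q_linear_prod q N) = N"
  if "q \<noteq> 0" for q :: "'a::field"
proof -
  have "degree (q_linear_prod q N) = N"
    unfolding q_linear_prod_def using that by (subst degree_prod_eq_sum_degree) auto
  moreover have "q_linear_prod q N \<noteq> 0"
    using coeff_q_linear_prod_0[of q N] by (metis coeff_0 zero_neq_one)
  ultimately show ?thesis by (metis leading_coeff_0_iff)
qed

lemma CHAR_eq_quantum_char_1:
  assumes "is_quantum_char (1::'a::field) e"
  shows "CHAR('a) = e"
proof -
  have "(of_nat k :: 'a) = 0 \<longleftrightarrow> e dvd k" for k
    using q_number_eq_0_iff[OF assms, of k] by simp
  then show ?thesis by (meson dvd_antisym of_nat_eq_0_iff_char_dvd dvd_refl)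
qed

lemma CHAR_poly: "CHAR('a::field poly) = CHAR('a)"
proof -
  have "CHAR('a poly) dvd k \<longleftrightarrow> CHAR('a) dvd k" for k
    by (simp flip: of_nat_eq_0_iff_char_dvd add: of_nat_poly)
  then show ?thesis by (meson dvd_antisym dvd_refl)
qed

text \<open>
  The intermediate Gaussian binomial coefficients of \<open>e\<close> vanish. If \<open>q = 1\<close>, then
  \<open>e\<close> is the characteristic and this is the binomial formula for \<open>e\<close>-th powers. Otherwise
  \<open>q\<close> is a primitive \<open>e\<close>-th root of unity, and the two recursions for
  \<open>P\<^bsub>e+1\<^esub>\<close> determine the coefficients successively.
\<close>

lemma q_linear_prod_quantum_char:
  fixes q :: "'a::field"
  assumes e: "is_quantum_char q e" and q: "q \<noteq> 0"
  obtains c where "c \<noteq> 0" "q_linear_prod q e = 1 + monom c e"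
proof -
  have e1: "e > 1" using e by (simp add: is_quantum_char_def)
  have low: "coeff (q_linear_prod q e) k = 0" if "0 < k" "k < e" for k
  proof (cases "q = 1")
    case True
    then have "CHAR('a) = e" using CHAR_eq_quantum_char_1 e by blast
    then have "prime e" using e1 prime_CHAR_semidom[where ?'a='a] by simp
    have "q_linear_prod q e = (1 + monom 1 1) ^ (CHAR('a poly) ^ 1)"
      using True \<open>CHAR('a) = e\<close> by (simp add: q_linear_prod_def CHAR_poly monom_altdef one_pCons)
    also have "\<dots> = 1 + monom 1 e"
      using \<open>CHAR('a) = e\<close> \<open>prime e\<close> by (subst freshmans_dream'[OF _ refl]) (auto simp: CHAR_poly monom_power)
    finally show ?thesis using that by simp
  next
    case False
    have qk: "q ^ k \<noteq> 1" if "0 < k" "k < e" for k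
    proof
      assume "q ^ k = 1"
      then have "(q - 1) * (\<Sum>i<k. q ^ i) = 0" by (simp add: power_diff_1_eq[symmetric])
      then have "e dvd k" using q_number_eq_0_iff[OF e] False by simp
      then show False using that by (auto dest: dvd_imp_le)
    qed
    \<comment> \<open>The two expressions for coefficient \<open>k + 1\<close> of the product with \<open>e + 1\<close> factors agree, and
        \<open>q ^ e = 1\<close>.\<close>
    have rec: "(q ^ Suc k - 1) * coeff (q_linear_prod q e) (Suc k)
        = (1 - q ^ k) * coeff (q_linear_prod q e) k" for k
      using coeff_q_linear_prod_shift[of q e k] coeff_q_linear_prod_Suc[of q e k]
        quantum_char_power[OF e] by (simp add: algebra_simps) 
    show ?thesis using that
    proof (induction k)
      case (Suc k)
      then have "(1 - q ^ k) * coeff (q_linear_prod q e) k = 0" by (cases k) auto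
      then have "(q ^ Suc k - 1) * coeff (q_linear_prod q e) (Suc k) = 0" by (simp only: rec)
      then show ?case using qk[of "Suc k"] Suc.prems by (simp del: power_Suc)
    qed simp
  qed
  have "coeff (q_linear_prod q e) k = coeff (1 + monom (coeff (q_linear_prod q e) e) e) k" for k
  proof -
    consider "k = 0" | "0 < k" "k < e" | "k = e" | "k > e" by linarith
    then show ?thesis
    proof cases
      case 4
      then show ?thesis using coeff_q_linear_prod_top[OF q, of e] by (simp add: coeff_eq_0)
    qed (use low e1 in auto)
  qed
  then show ?thesis using that coeff_q_linear_prod_top[OF q, of e] poly_eqI by blast
qed

text \<open>
  The factors are periodic with period \<open>e\<close>.
\<close>

lemma q_linear_prod_mult:
  fixes q :: "'a::field"
  assumes "is_quantum_char q e"
  shows "q_linear_prod q (e * m) = q_linear_prod q e ^ m"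
proof (induction m)
  case (Suc m)
  have "q_linear_prod q (a + e) = q_linear_prod q a * (\<Prod>i<e. [:1, q ^ (a + i):])" for a and e
    by (induction e) (auto simp: q_linear_prod_Suc mult_ac simp del: mult_pCons_right mult_pCons_left)
  from this[of "e * m" e] have "q_linear_prod q (e * Suc m) = q_linear_prod q (e * m) * (\<Prod>i<e. [:1, q ^ (e * m + i):])"
    by (simp add: add.commute)
  also have "(\<Prod>i<e. [:1, q ^ (e * m + i):]) = q_linear_prod q e"
    using quantum_char_power[OF assms] by (simp add: power_add power_mult q_linear_prod_def)
  finally show ?case using Suc by simp
qed simp

lemma one_plus_monom_power_low_coeffs:
  fixes c :: "'a::field"
  assumes "c \<noteq> 0" "of_nat m \<noteq> (0::'a)" "D \<ge> 1"
  shows "(\<forall>t. 1 \<le> t \<and> t \<le> b \<longrightarrow> coeff ((1 + monom c D) ^ m) t = 0) \<longleftrightarrow> b < D"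
proof -
  have coeff: "coeff ((1 + monom c D) ^ m) t = (\<Sum>k\<le>m. if D * k = t then of_nat (m choose k) * c ^ k else 0)" for t
  proof -
    have "(1 + monom c D) ^ m = (\<Sum>k\<le>m. of_nat (m choose k) * monom c D ^ k)"
      by (subst add.commute, subst binomial_ring) simp
    also have "\<dots> = (\<Sum>k\<le>m. monom (of_nat (m choose k) * c ^ k) (D * k))"
      by (simp add: monom_power of_nat_monom mult_monom mult.commute)
    finally show ?thesis by (simp add: coeff_sum)
  qed
  have m: "m \<ge> 1" using assms by (cases m) auto
  have "coeff ((1 + monom c D) ^ m) D = (\<Sum>k\<le>m. if k = 1 then of_nat (m choose k) * c ^ k else 0)"
    unfolding coeff using assms by (intro sum.cong) auto
  then have D: "coeff ((1 + monom c D) ^ m) D \<noteq> 0" using assms m by simp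
  have "coeff ((1 + monom c D) ^ m) t = 0" if "1 \<le> t" "t < D" for t
    unfolding coeff
  proof (intro sum.neutral ballI)
    fix k assume "k \<in> {..m}"
    have "D * k \<noteq> t" using that by (cases k) auto
    then show "(if D * k = t then of_nat (m choose k) * c ^ k else 0) = 0" by simp
  qed
  then show ?thesis using D assms by (meson leI le_less_trans)
qed

lemma ell_le_iff: "ell p b \<le> k \<longleftrightarrow> b < p ^ k" if "p > 1"
proof
  have ex: "b < p ^ ell p b"
    unfolding ell_def by (rule LeastI[of _ b]) (use that in \<open>simp add: power_gt_expt\<close>)
  assume "ell p b \<le> k"
  then show "b < p ^ k" using ex that by (meson less_le_trans power_increasing less_imp_le)
next
  assume "b < p ^ k"
  then show "ell p b \<le> k" unfolding ell_def by (rule Least_le)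
qed

lemma q_binomials_vanish_iff_char_0:
  fixes q :: "'a::field"
  assumes e: "is_quantum_char q e" and q: "q \<noteq> 0" and char: "CHAR('a) = 0" and b: "b \<ge> 1"
  shows "(\<forall>t. 1 \<le> t \<and> t \<le> b \<longrightarrow> coeff (q_linear_prod q (a + t)) t = 0) \<longleftrightarrow> e dvd a + 1 \<and> b < e"
proof (cases "e dvd a + 1")
  case False
  then have "coeff (q_linear_prod q (a + 1)) 1 \<noteq> 0"
    using q_number_eq_0_iff[OF e, of "a + 1"] by (simp only: coeff_q_linear_prod_1 not_False_eq_True)
  then show ?thesis using False b by force
next
  case True
  then obtain m where m: "a + 1 = e * m" by blast
  obtain c where c: "c \<noteq> 0" "q_linear_prod q e = 1 + monom c e"
    using q_linear_prod_quantum_char[OF e q] .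
  have "m \<noteq> 0" using m by (cases m) auto
  then have "of_nat m \<noteq> (0::'a)" using char by (simp only: of_nat_eq_0_iff_char_dvd) simp
  moreover have "e \<ge> 1" using e by (simp add: is_quantum_char_def)
  ultimately show ?thesis
    unfolding q_binomials_vanish_iff m q_linear_prod_mult[OF e] c(2)
    using one_plus_monom_power_low_coeffs[OF c(1)] True m by simp
qed

text \<open>
  Write \<open>a + 1 = e p\<^sup>k m'\<close> with \<open>m'\<close> prime to \<open>p\<close>. Raising to the power
  \<open>p\<^sup>k\<close> is additive, which moves the first nonconstant term of
  \<open>(1 + c x\<^sup>e)\<^sup>m\<close>, where \<open>m = p\<^sup>k m'\<close>, to degree \<open>e p\<^sup>k\<close>.
\<close>

lemma q_binomials_vanish_iff_char_pos:
  fixes q :: "'a::field"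
  assumes e: "is_quantum_char q e" and q: "q \<noteq> 0" and char: "CHAR('a) = p" "p > 0" and b: "b \<ge> 1"
  shows "(\<forall>t. 1 \<le> t \<and> t \<le> b \<longrightarrow> coeff (q_linear_prod q (a + t)) t = 0) \<longleftrightarrow>
         e * p ^ ell p (b div e) dvd a + 1"
proof (cases "e dvd a + 1")
  case False
  then have "coeff (q_linear_prod q (a + 1)) 1 \<noteq> 0"
    using q_number_eq_0_iff[OF e, of "a + 1"] by (simp only: coeff_q_linear_prod_1 not_False_eq_True)
  then show ?thesis using False b by (metis dvd_mult_left le_refl)
next
  case True
  then obtain m where m: "a + 1 = e * m" by blast
  have m0: "m \<noteq> 0" using m by (cases m) auto
  have p: "prime p" using char prime_CHAR_semidom[where ?'a='a] by simp
  have e0: "e > 0" using e by (simp add: is_quantum_char_def)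
  obtain c where c: "c \<noteq> 0" "q_linear_prod q e = 1 + monom c e"
    using q_linear_prod_quantum_char[OF e q] .
  define k where "k = multiplicity p m"
  obtain m' where m': "m = p ^ k * m'" "\<not> p dvd m'"
    using multiplicity_decompose'[of m p] m0 p unfolding k_def by (metis not_prime_unit)
  have "(1 + monom c e) ^ m = ((1 + monom c e) ^ (CHAR('a poly) ^ k)) ^ m'"
    using char by (simp add: m' power_mult CHAR_poly)
  also have "\<dots> = (1 + monom (c ^ p ^ k) (e * p ^ k)) ^ m'"
    using char p by (subst freshmans_dream'[OF _ refl]) (auto simp: CHAR_poly monom_power mult.commute)
  finally have P: "q_linear_prod q (a + 1) = (1 + monom (c ^ p ^ k) (e * p ^ k)) ^ m'"
    using m c q_linear_prod_mult[OF e, of m] by simp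
  have "of_nat m' \<noteq> (0::'a)" using m' char by (simp add: of_nat_eq_0_iff_char_dvd)
  moreover have "e * p ^ k \<ge> 1" using e0 p by (simp add: prime_gt_0_nat Suc_le_eq)
  ultimately have "(\<forall>t. 1 \<le> t \<and> t \<le> b \<longrightarrow> coeff (q_linear_prod q (a + t)) t = 0) \<longleftrightarrow> b < e * p ^ k"
    unfolding q_binomials_vanish_iff P
    using one_plus_monom_power_low_coeffs[of "c ^ p ^ k" m' "e * p ^ k" b] c by simp
  also have "\<dots> \<longleftrightarrow> b div e < p ^ k"
    using e0 by (simp add: div_less_iff_less_mult mult.commute)
  also have "\<dots> \<longleftrightarrow> ell p (b div e) \<le> k" using ell_le_iff p prime_gt_1_nat by blast
  also have "\<dots> \<longleftrightarrow> p ^ ell p (b div e) dvd m"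
    using m0 p unfolding k_def by (subst power_dvd_iff_le_multiplicity) auto
  also have "\<dots> \<longleftrightarrow> e * p ^ ell p (b div e) dvd a + 1" using m e0 by simp
  finally show ?thesis .
qed

section \<open>Functions on words and the maps \<open>\<psi>\<close>\<close>

definition positions :: "nat \<Rightarrow> (nat \<Rightarrow> nat) \<Rightarrow> nat \<Rightarrow> nat set" where
  "positions n c r = {k \<in> {1..n}. c k = r}"

text \<open>
  The exponent of \<open>q\<close> differs from the number of pairs \<open>k < k'\<close> with \<open>k \<in> C\<close>
  and \<open>k' \<in> R - C\<close> by the constant \<open>t(t-1)/2\<close>, where \<open>t\<close> is the size of
  \<open>C\<close>. In this normalization the weight is multiplicative in \<open>C\<close>.
\<close>

definition weight :: "'a::field \<Rightarrow> nat set \<Rightarrow> nat set \<Rightarrow> 'a" where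
  "weight q R C = (\<Prod>k\<in>C. q ^ card {k' \<in> R. k < k'})"

definition recolour :: "(nat \<Rightarrow> nat) \<Rightarrow> nat set \<Rightarrow> nat \<Rightarrow> (nat \<Rightarrow> nat)" where
  "recolour c C r = (\<lambda>k. if k \<in> C then r else c k)"

text \<open>
  Right multiplication by \<open>T\<^sub>i\<close> on functions on words. If the letters in positions \<open>i\<close>
  and \<open>i + 1\<close> agree, both branches give \<open>q F a\<close>.
\<close>

definition act :: "'a::field \<Rightarrow> ((nat \<Rightarrow> nat) \<Rightarrow> 'a) \<Rightarrow> nat \<Rightarrow> ((nat \<Rightarrow> nat) \<Rightarrow> 'a)" where
  "act q F i = (\<lambda>a. if a (Suc i) < a i then F (a \<circ> simple_refl i) + (q - 1) * F a
                    else q * F (a \<circ> simple_refl i))"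

text \<open>
  Up to a power of \<open>q\<close>, the homomorphism of permutation modules that changes \<open>t\<close> letters
  \<open>r + 1\<close> into \<open>r\<close>: its value at \<open>c\<close> collects the words from which
  \<open>c\<close> arises.
\<close>

definition psi :: "'a::field \<Rightarrow> nat \<Rightarrow> nat \<Rightarrow> nat \<Rightarrow> ((nat \<Rightarrow> nat) \<Rightarrow> 'a) \<Rightarrow> ((nat \<Rightarrow> nat) \<Rightarrow> 'a)" where
  "psi q n r t F = (\<lambda>c. \<Sum>C | C \<subseteq> positions n c r \<and> card C = t.
      weight q (positions n c r) C * F (recolour c C (Suc r)))"

definition psi_kernel :: "'a::field \<Rightarrow> nat \<Rightarrow> ((nat \<Rightarrow> nat) \<Rightarrow> 'a) set" where
  "psi_kernel q n = {F. \<forall>r\<ge>1. \<forall>t\<ge>1. \<forall>c. psi q n r t F c = 0}"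

lemma finite_positions [simp]: "finite (positions n c r)"
  by (simp add: positions_def)

lemma finite_subsets_card [simp]: "finite R \<Longrightarrow> finite {C. C \<subseteq> R \<and> card C = t}"
  by (rule finite_subset[of _ "Pow R"]) auto

lemma simple_refl_simps [simp]:
  "simple_refl i i = Suc i" "simple_refl i (Suc i) = i"
  "k \<noteq> i \<Longrightarrow> k \<noteq> Suc i \<Longrightarrow> simple_refl i k = k"
  "simple_refl i (simple_refl i k) = k"
  by (simp_all add: simple_refl_def)

lemma comp_simple_refl_twice [simp]: "a \<circ> simple_refl i \<circ> simple_refl i = a"
  by (simp add: fun_eq_iff)

lemma inj_simple_refl: "inj_on (simple_refl i) A"
  by (rule inj_on_inverseI[where g = "simple_refl i"]) simp

lemma mem_simple_refl_image: "k \<in> simple_refl i ` A \<longleftrightarrow> simple_refl i k \<in> A"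
proof
  assume "simple_refl i k \<in> A"
  then have "simple_refl i (simple_refl i k) \<in> simple_refl i ` A" by (rule imageI)
  then show "k \<in> simple_refl i ` A" by simp
qed auto

lemma image_simple_refl_twice [simp]: "simple_refl i ` simple_refl i ` A = A"
  by (simp add: set_eq_iff mem_simple_refl_image)

lemma simple_refl_in_iff: "1 \<le> i \<Longrightarrow> i < n \<Longrightarrow> simple_refl i k \<in> {1..n} \<longleftrightarrow> k \<in> {1..n}"
  by (auto simp: simple_refl_def transpose_def)

lemma positions_comp_simple_refl:
  "1 \<le> i \<Longrightarrow> i < n \<Longrightarrow> positions n (c \<circ> simple_refl i) r = simple_refl i ` positions n c r"
  by (simp only: positions_def set_eq_iff mem_simple_refl_image mem_Collect_eq simple_refl_in_iff comp_apply) simp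

lemma recolour_comp_simple_refl:
  "recolour (c \<circ> simple_refl i) (simple_refl i ` C) r = recolour c C r \<circ> simple_refl i"
  by (auto simp: recolour_def fun_eq_iff mem_simple_refl_image)

lemma simple_refl_less_iff:
  "\<not> (k = i \<and> k' = Suc i) \<Longrightarrow> \<not> (k = Suc i \<and> k' = i) \<Longrightarrow>
   simple_refl i k < simple_refl i k' \<longleftrightarrow> k < k'"
  by (auto simp: simple_refl_def transpose_def)

lemma weight_simple_refl:
  assumes "\<not> (i \<in> R \<and> Suc i \<in> R)" "C \<subseteq> R"
  shows "weight q (simple_refl i ` R) (simple_refl i ` C) = weight q R C"
proof -
  have "card {k' \<in> simple_refl i ` R. simple_refl i k < k'} = card {k' \<in> R. k < k'}" if "k \<in> R" for k
  proof -
    have "{k' \<in> simple_refl i ` R. simple_refl i k < k'} = simple_refl i ` {k' \<in> R. k < k'}"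
    proof (intro set_eqI)
      fix x
      have "simple_refl i k < x \<longleftrightarrow> k < simple_refl i x" if "simple_refl i x \<in> R"
      proof -
        have "\<not> (k = i \<and> simple_refl i x = Suc i)" "\<not> (k = Suc i \<and> simple_refl i x = i)"
          using assms(1) \<open>k \<in> R\<close> that by auto
        from simple_refl_less_iff[OF this] show ?thesis by simp
      qed
      then show "x \<in> {k' \<in> simple_refl i ` R. simple_refl i k < k'} \<longleftrightarrow>
          x \<in> simple_refl i ` {k' \<in> R. k < k'}"
        by (auto simp: mem_simple_refl_image)
    qed
    then show ?thesis by (simp add: card_image inj_simple_refl)
  qed
  then show ?thesis using assms(2) unfolding weight_def
    by (subst prod.reindex[OF inj_simple_refl]) (auto intro!: prod.cong)
qed

lemma bij_betw_image_subsets: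
  "bij_betw ((`) (simple_refl i)) {C. C \<subseteq> R \<and> card C = t} {C. C \<subseteq> simple_refl i ` R \<and> card C = t}"
  by (rule bij_betw_byWitness[where f' = "(`) (simple_refl i)"])
    (auto simp: image_comp card_image inj_simple_refl)

text \<open>
  Unless both positions carry the letter \<open>r\<close>, the transposition preserves the order of the
  positions of \<open>r\<close>, so reindexing the subsets does not change the weights.
\<close>

lemma psi_comp_simple_refl:
  assumes "1 \<le> i" "i < n" "\<not> (c i = r \<and> c (Suc i) = r)"
  shows "psi q n r t F (c \<circ> simple_refl i) = (\<Sum>C | C \<subseteq> positions n c r \<and> card C = t.
      weight q (positions n c r) C * F (recolour c C (Suc r) \<circ> simple_refl i))"
  unfolding psi_def positions_comp_simple_refl[OF assms(1,2)]
  using assms(3)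
  by (subst sum.reindex_bij_betw[OF bij_betw_image_subsets, symmetric])
    (auto intro!: sum.cong simp: recolour_comp_simple_refl weight_simple_refl positions_def)

text \<open>
  Only \<open>Suc i\<close> lies above \<open>i\<close> without lying above \<open>Suc i\<close>.
\<close>

lemma weight_Suc_shift:
  assumes R: "finite R" "i \<in> R" "Suc i \<in> R" and C: "C \<subseteq> R" "i \<in> C" "Suc i \<notin> C"
  shows "weight q R C = q * weight q R (simple_refl i ` C)"
proof -
  have fin: "finite C" using C R finite_subset by blast
  have im: "simple_refl i ` C = insert (Suc i) (C - {i})"
  proof (intro set_eqI)
    fix x show "x \<in> simple_refl i ` C \<longleftrightarrow> x \<in> insert (Suc i) (C - {i})"
      using C by (cases "x = i"; cases "x = Suc i") (auto simp: mem_simple_refl_image)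
  qed
  have "{k' \<in> R. i < k'} = insert (Suc i) {k' \<in> R. Suc i < k'}" using R by auto
  then have "card {k' \<in> R. i < k'} = Suc (card {k' \<in> R. Suc i < k'})" using R by simp
  then show ?thesis
    unfolding im weight_def using C fin by (simp add: prod.remove[of C i] mult.assoc)
qed

text \<open>
  If not both positions carry \<open>r\<close>, the relative order of the letters in \<open>c\<close> is, up to ties,
  the one in each recoloured word; ties are harmless because both branches of \<open>act\<close> agree there.
  If both positions carry \<open>r\<close>, the terms are compared with \<open>q\<close> times the terms of
  \<open>\<psi>\<close> at \<open>c\<close>.
\<close>

lemma psi_act:
  assumes i: "1 \<le> i" "i < n"
  shows "psi q n r t (act q F i) c = act q (psi q n r t F) i c"
proof (cases "c i = r \<and> c (Suc i) = r")
  case False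
  let ?S = "{C. C \<subseteq> positions n c r \<and> card C = t}"
  let ?d = "\<lambda>C. recolour c C (Suc r)"
  have d: "?d C i = (if i \<in> C then Suc r else c i)" "?d C (Suc i) = (if Suc i \<in> C then Suc r else c (Suc i))" for C
    by (auto simp: recolour_def)
  have mem: "i \<in> C \<Longrightarrow> c i = r" "Suc i \<in> C \<Longrightarrow> c (Suc i) = r" if "C \<in> ?S" for C
    using that by (auto simp: positions_def)
  have same: "?d C \<circ> simple_refl i = ?d C" if "?d C i = ?d C (Suc i)" for C
    using that by (auto simp: fun_eq_iff simple_refl_def transpose_def)
  show ?thesis
  proof (cases "c (Suc i) < c i")
    case True
    have "act q F i (?d C) = F (?d C \<circ> simple_refl i) + (q - 1) * F (?d C)" if "C \<in> ?S" for C
    proof (cases "?d C (Suc i) < ?d C i")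
      case False
      then have "?d C i = ?d C (Suc i)" using d[of C] mem[OF that] True by (auto split: if_splits)
      then show ?thesis using same[of C] by (simp add: act_def algebra_simps)
    qed (simp add: act_def)
    then have "psi q n r t (act q F i) c =
        (\<Sum>C\<in>?S. weight q (positions n c r) C * (F (?d C \<circ> simple_refl i) + (q - 1) * F (?d C)))"
      unfolding psi_def by (intro sum.cong) auto
    also have "\<dots> = (\<Sum>C\<in>?S. weight q (positions n c r) C * F (?d C \<circ> simple_refl i)) +
        (\<Sum>C\<in>?S. (q - 1) * (weight q (positions n c r) C * F (?d C)))"
      by (subst sum.distrib[symmetric], intro sum.cong) (auto simp: algebra_simps)
    also have "\<dots> = psi q n r t F (c \<circ> simple_refl i) + (q - 1) * psi q n r t F c"
      by (simp only: psi_comp_simple_refl[OF i False] sum_distrib_left[symmetric]) (simp add: psi_def)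
    finally show ?thesis using True by (simp add: act_def)
  next
    case ge: False
    have "act q F i (?d C) = q * F (?d C \<circ> simple_refl i)" if "C \<in> ?S" for C
      using d[of C] mem[OF that] ge False by (auto simp: act_def split: if_splits)
    then have "psi q n r t (act q F i) c =
        (\<Sum>C\<in>?S. weight q (positions n c r) C * (q * F (?d C \<circ> simple_refl i)))"
      unfolding psi_def by (intro sum.cong) auto
    also have "\<dots> = q * psi q n r t F (c \<circ> simple_refl i)"
      unfolding psi_comp_simple_refl[OF i False] 
      by (simp add: sum_distrib_left algebra_simps)
    finally show ?thesis using ge by (simp add: act_def)
  qed
next
  case True
  define R where "R = positions n c r"
  let ?s = "simple_refl i"
  let ?d = "\<lambda>C. recolour c C (Suc r)"
  have R: "finite R" "i \<in> R" "Suc i \<in> R" using True i by (auto simp: R_def positions_def)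
  have image_eq: "?s ` C = C" if "i \<in> C \<longleftrightarrow> Suc i \<in> C" for C
  proof (intro set_eqI)
    fix x show "x \<in> ?s ` C \<longleftrightarrow> x \<in> C"
      using that by (cases "x = i"; cases "x = Suc i") (auto simp: mem_simple_refl_image)
  qed
  have sR: "?s ` R = R" using R image_eq by simp
  have cs: "c \<circ> ?s = c" using True by (auto simp: fun_eq_iff simple_refl_def transpose_def)
  have ds: "?d C \<circ> ?s = ?d (?s ` C)" for C
    using recolour_comp_simple_refl[of c i C "Suc r"] cs by simp
  define S where "S = {C. C \<subseteq> R \<and> card C = t}"
  have sS: "?s ` C \<in> S" if "C \<in> S" for C
    using that image_mono[of C R ?s] sR by (auto simp: S_def card_image inj_simple_refl)
  have bij: "bij_betw ((`) ?s) S S"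
    by (rule bij_betw_byWitness[where f' = "(`) ?s"]) (use sS in auto)
  \<comment> \<open>In the sum the correction \<open>g (?s ` C) - g C\<close> cancels, because \<open>?s\<close> permutes the subsets.\<close>
  define g where "g C = (if i \<in> C then 1 else q) * (weight q R C * F (?d C))" for C
  have step: "weight q R C * act q F i (?d C) = q * (weight q R C * F (?d C)) + (g (?s ` C) - g C)" if C: "C \<in> S" for C
  proof -
    have CR: "C \<subseteq> R" using C by (simp add: S_def)
    have d: "?d C i = (if i \<in> C then Suc r else r)" "?d C (Suc i) = (if Suc i \<in> C then Suc r else r)"
      using True by (auto simp: recolour_def)
    have mem: "i \<in> ?s ` C \<longleftrightarrow> Suc i \<in> C" "Suc i \<in> ?s ` C \<longleftrightarrow> i \<in> C"
      by (simp_all add: mem_simple_refl_image)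
    consider "i \<in> C" "Suc i \<notin> C" | "i \<notin> C" "Suc i \<in> C" | "i \<in> C \<longleftrightarrow> Suc i \<in> C" by blast
    then show ?thesis
    proof cases
      case 1
      have w: "weight q R C = q * weight q R (?s ` C)" using weight_Suc_shift[OF R CR 1] .
      have a: "act q F i (?d C) = F (?d (?s ` C)) + (q - 1) * F (?d C)" using 1 by (simp add: act_def ds d)
      show ?thesis unfolding a w g_def mem using 1 by (simp add: w algebra_simps)
    next
      case 2
      have w: "weight q R (?s ` C) = q * weight q R C"
        using weight_Suc_shift[OF R, of "?s ` C"] sS[OF C] 2 mem by (simp add: S_def)
      have "act q F i (?d C) = q * F (?d (?s ` C))" using 2 by (simp add: act_def ds d)
      then show ?thesis using 2 w by (simp add: g_def mem algebra_simps)
    next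
      case 3
      then have "act q F i (?d C) = q * F (?d C)" using image_eq[OF 3] by (auto simp: act_def ds d)
      then show ?thesis using image_eq[OF 3] by simp
    qed
  qed
  have "psi q n r t (act q F i) c = (\<Sum>C\<in>S. weight q R C * act q F i (?d C))"
    by (simp add: psi_def S_def R_def)
  also have "\<dots> = q * (\<Sum>C\<in>S. weight q R C * F (?d C)) + ((\<Sum>C\<in>S. g (?s ` C)) - (\<Sum>C\<in>S. g C))"
    by (simp only: step sum.distrib sum_subtractf sum_distrib_left cong: sum.cong)
  also have "(\<Sum>C\<in>S. g (?s ` C)) = (\<Sum>C\<in>S. g C)"
    by (rule sum.reindex_bij_betw[OF bij])
  finally have "psi q n r t (act q F i) c = q * (\<Sum>C\<in>S. weight q R C * F (?d C))" by simp
  then show ?thesis using True by (simp add: act_def cs psi_def S_def R_def)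
qed

lemma psi_kernel_act:
  "F \<in> psi_kernel q n \<Longrightarrow> 1 \<le> i \<Longrightarrow> i < n \<Longrightarrow> act q F i \<in> psi_kernel q n"
proof -
  assume F: "F \<in> psi_kernel q n" and i: "1 \<le> i" "i < n"
  have "psi q n r t (act q F i) c = 0" if "r \<ge> 1" "t \<ge> 1" for r t c
    unfolding psi_act[OF i] using F that by (simp add: act_def psi_kernel_def)
  then show ?thesis by (simp add: psi_kernel_def)
qed

lemma psi_lincomb:
  "psi q n r t (\<lambda>a. x * F a + y * G a) c = x * psi q n r t F c + y * psi q n r t G c"
  unfolding psi_def sum_distrib_left sum.distrib[symmetric]
  by (intro sum.cong) (auto simp: algebra_simps)

lemma psi_kernel_lincomb:
  "F \<in> psi_kernel q n \<Longrightarrow> G \<in> psi_kernel q n \<Longrightarrow> (\<lambda>a. x * F a + y * G a) \<in> psi_kernel q n"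
  by (simp add: psi_kernel_def psi_lincomb)

section \<open>Dominance of words\<close>

definition cnt :: "(nat \<Rightarrow> nat) \<Rightarrow> nat \<Rightarrow> nat \<Rightarrow> nat" where
  "cnt a m r = card {k \<in> {1..m}. a k = r}"

definition cnt_le :: "(nat \<Rightarrow> nat) \<Rightarrow> nat \<Rightarrow> nat \<Rightarrow> nat" where
  "cnt_le a m r = card {k \<in> {1..m}. a k \<le> r}"

definition dominated :: "nat \<Rightarrow> (nat \<Rightarrow> nat) \<Rightarrow> (nat \<Rightarrow> nat) \<Rightarrow> bool" where
  "dominated n a b \<longleftrightarrow> (\<forall>m\<le>n. \<forall>r. cnt_le a m r \<le> cnt_le b m r)"

definition ballot :: "nat \<Rightarrow> (nat \<Rightarrow> nat) \<Rightarrow> bool" where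
  "ballot n b \<longleftrightarrow> (\<forall>m\<le>n. \<forall>r\<ge>1. cnt b m (Suc r) \<le> cnt b m r)"

lemma cnt_0 [simp]: "cnt a 0 r = 0" by (simp add: cnt_def)
lemma cnt_le_0 [simp]: "cnt_le a 0 r = 0" by (simp add: cnt_le_def)

lemma Collect_atLeastAtMost_Suc:
  "{k \<in> {1..Suc m}. P k} = (if P (Suc m) then insert (Suc m) {k \<in> {1..m}. P k} else {k \<in> {1..m}. P k})"
  by (auto simp: le_Suc_eq)

lemma cnt_Suc: "cnt a (Suc m) r = cnt a m r + (if a (Suc m) = r then 1 else 0)"
  unfolding cnt_def Collect_atLeastAtMost_Suc by simp

lemma cnt_le_Suc: "cnt_le a (Suc m) r = cnt_le a m r + (if a (Suc m) \<le> r then 1 else 0)"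
  unfolding cnt_le_def Collect_atLeastAtMost_Suc by simp

lemma cnt_mono: "m \<le> m' \<Longrightarrow> cnt a m r \<le> cnt a m' r"
  unfolding cnt_def by (intro card_mono) auto

lemma cnt_cong: "(\<And>k. 1 \<le> k \<Longrightarrow> k \<le> m \<Longrightarrow> a k = b k) \<Longrightarrow> cnt a m r = cnt b m r"
  unfolding cnt_def by (intro arg_cong[where f = card]) auto

lemma card_prefix_swap:
  assumes "1 \<le> i" "m \<noteq> i"
  shows "card {k \<in> {1..m}. P ((a \<circ> simple_refl i) k)} = card {k \<in> {1..m}. P (a k)}"
proof -
  have "simple_refl i k \<in> {1..m} \<longleftrightarrow> k \<in> {1..m}" for k
    using assms by (auto simp: simple_refl_def transpose_def)
  then have "{k \<in> {1..m}. P ((a \<circ> simple_refl i) k)} = simple_refl i ` {k \<in> {1..m}. P (a k)}"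
    by (simp only: set_eq_iff mem_simple_refl_image mem_Collect_eq comp_apply) simp
  then show ?thesis by (simp only: card_image inj_simple_refl)
qed

lemma cnt_swap: "1 \<le> i \<Longrightarrow> m \<noteq> i \<Longrightarrow> cnt (a \<circ> simple_refl i) m r = cnt a m r"
  unfolding cnt_def by (rule card_prefix_swap)

lemma cnt_le_swap: "1 \<le> i \<Longrightarrow> m \<noteq> i \<Longrightarrow> cnt_le (a \<circ> simple_refl i) m r = cnt_le a m r"
  unfolding cnt_le_def by (rule card_prefix_swap)

lemma cnt_swap_at:
  "cnt (a \<circ> simple_refl (Suc j)) (Suc j) r = cnt a j r + (if a (Suc (Suc j)) = r then 1 else 0)"
  using cnt_swap[of "Suc j" j a r] by (simp add: cnt_Suc)

lemma dominated_refl [simp]: "dominated n a a"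
  by (simp add: dominated_def)

lemma dominated_trans: "dominated n a b \<Longrightarrow> dominated n b c \<Longrightarrow> dominated n a c"
  unfolding dominated_def by (meson le_trans)

text \<open>
  The counts determine, for each position, which bounds \<open>r\<close> the letter satisfies.
\<close>

lemma dominated_antisym:
  assumes "dominated n a b" "dominated n b a" "1 \<le> k" "k \<le> n"
  shows "a k = b k"
proof -
  have eq: "cnt_le a m r = cnt_le b m r" if "m \<le> n" for m r
    using assms that by (simp add: dominated_def eq_iff)
  obtain m where m: "k = Suc m" using assms(3) by (cases k) auto
  have "a k \<le> r \<longleftrightarrow> b k \<le> r" for r
    using eq[of "Suc m" r] eq[of m r] assms(4) m by (auto simp: cnt_le_Suc split: if_splits)
  then show ?thesis by (meson le_antisym le_refl)
qed

text \<open>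
  Only the counts for the prefix of length \<open>i\<close> change. They are controlled by the counts for the
  prefixes of lengths \<open>i - 1\<close> and \<open>i + 1\<close>, because a descent of \<open>b\<close> makes
  \<open>b\<close> extremal there. The second and third claims are the lifting properties of this order.
\<close>

lemma dominated_swap:
  assumes i: "1 \<le> i" "i < n" and b: "b (Suc i) < b i"
  shows "dominated n b (b \<circ> simple_refl i)"
    and "dominated n c b \<Longrightarrow> dominated n (c \<circ> simple_refl i) (b \<circ> simple_refl i)"
    and "dominated n (b \<circ> simple_refl i) c \<Longrightarrow> dominated n b (c \<circ> simple_refl i)"
proof -
  obtain j where j: "i = Suc j" using i by (cases i) auto
  show "dominated n b (b \<circ> simple_refl i)"
    unfolding dominated_def
  proof (intro allI impI)
    fix m r assume "m \<le> n"
    show "cnt_le b m r \<le> cnt_le (b \<circ> simple_refl i) m r"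
    proof (cases "m = i")
      case True
      then show ?thesis using b by (auto simp: j cnt_le_Suc cnt_le_swap[of "Suc j" j])
    qed (use cnt_le_swap[OF i(1)] in auto)
  qed
  show "dominated n (c \<circ> simple_refl i) (b \<circ> simple_refl i)" if "dominated n c b"
    unfolding dominated_def
  proof (intro allI impI)
    fix m r assume "m \<le> n"
    show "cnt_le (c \<circ> simple_refl i) m r \<le> cnt_le (b \<circ> simple_refl i) m r"
    proof (cases "m = i")
      case True
      have "cnt_le c j r \<le> cnt_le b j r" "cnt_le c (Suc i) r \<le> cnt_le b (Suc i) r"
        using that i j by (auto simp: dominated_def)
      then show ?thesis using b True by (auto simp: j cnt_le_Suc cnt_le_swap[of "Suc j" j] split: if_splits)
    qed (use cnt_le_swap[OF i(1)] that \<open>m \<le> n\<close> in \<open>auto simp: dominated_def\<close>)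
  qed
  show "dominated n b (c \<circ> simple_refl i)" if "dominated n (b \<circ> simple_refl i) c"
    unfolding dominated_def
  proof (intro allI impI)
    fix m r assume "m \<le> n"
    show "cnt_le b m r \<le> cnt_le (c \<circ> simple_refl i) m r"
    proof (cases "m = i")
      case True
      have "cnt_le (b \<circ> simple_refl i) j r \<le> cnt_le c j r"
           "cnt_le (b \<circ> simple_refl i) (Suc i) r \<le> cnt_le c (Suc i) r"
        using that i j by (auto simp: dominated_def)
      then have "cnt_le b j r \<le> cnt_le c j r" "cnt_le b (Suc i) r \<le> cnt_le c (Suc i) r"
        using cnt_le_swap[OF i(1)] j by auto
      then show ?thesis using b True by (auto simp: j cnt_le_Suc cnt_le_swap[of "Suc j" j] split: if_splits)
    qed (use cnt_le_swap[OF i(1)] that \<open>m \<le> n\<close> in \<open>auto simp: dominated_def\<close>)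
  qed
qed

lemma swap_neq: "b (Suc i) \<noteq> b i \<Longrightarrow> b \<circ> simple_refl i \<noteq> b"
  by (metis comp_apply simple_refl_simps(1))

section \<open>Maximal words are ballot\<close>

definition maximal_word :: "nat \<Rightarrow> ((nat \<Rightarrow> nat) \<Rightarrow> 'a::field) \<Rightarrow> (nat \<Rightarrow> nat) \<Rightarrow> bool" where
  "maximal_word n F b \<longleftrightarrow> F b \<noteq> 0 \<and> (\<forall>c. F c \<noteq> 0 \<longrightarrow> dominated n b c \<longrightarrow> c = b)"

text \<open>
  If a word above the sorted word occurs in the new function, then it or its swap occurs in the
  old one, and both lie above \<open>b\<close>.
\<close>

lemma maximal_word_act:
  assumes i: "1 \<le> i" "i < n" and b: "b (Suc i) < b i" and q: "q \<noteq> 0" and max: "maximal_word n F b"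
  shows "maximal_word n (act q F i) (b \<circ> simple_refl i)"
proof -
  let ?bs = "b \<circ> simple_refl i"
  have neq: "\<not> dominated n ?bs b"
    using dominated_antisym[OF dominated_swap(1)[OF i b], of i] b i by auto
  have "act q F i ?bs = q * F b" using b by (simp add: act_def)
  moreover have "c = ?bs" if "act q F i c \<noteq> 0" and dom: "dominated n ?bs c" for c
  proof -
    have "F c \<noteq> 0 \<or> F (c \<circ> simple_refl i) \<noteq> 0"
      using that(1) by (auto simp: act_def split: if_splits)
    then show ?thesis
    proof
      assume "F c \<noteq> 0"
      then have "c = b" using max dom dominated_trans dominated_swap(1)[OF i b]
        unfolding maximal_word_def by blast
      then show ?thesis using dom neq by simp
    next
      assume "F (c \<circ> simple_refl i) \<noteq> 0"
      then have "c \<circ> simple_refl i = b"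
        using max dominated_swap(3)[OF i b dom] unfolding maximal_word_def by blast
      then show ?thesis by auto
    qed
  qed
  ultimately show ?thesis using max q by (auto simp: maximal_word_def)
qed

text \<open>
  When \<open>A\<close> precedes \<open>X\<close>, the part of a subset in \<open>X\<close> contributes the same weight
  as in \<open>X\<close> alone, and the contribution of the part in \<open>A\<close> is independent of it.
\<close>

lemma weight_union_left:
  assumes fin: "finite X" "finite A" and left: "\<And>a x. a \<in> A \<Longrightarrow> x \<in> X \<Longrightarrow> a < x"
    and "S \<subseteq> A"
  obtains u where "\<And>C. C \<subseteq> X \<Longrightarrow> weight q (A \<union> X) (S \<union> C) = u * weight q X C"
proof
  fix C assume C: "C \<subseteq> X"
  have finC: "finite S" "finite C" using fin assms(4) C finite_subset by auto
  have disj: "S \<inter> C = {}" using left assms(4) C by force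
  have "{k' \<in> A \<union> X. k < k'} = {k' \<in> X. k < k'}" if "k \<in> C" for k
    using left that C by force
  then show "weight q (A \<union> X) (S \<union> C) = (\<Prod>k\<in>S. q ^ card {k' \<in> A \<union> X. k < k'}) * weight q X C"
    unfolding weight_def prod.union_disjoint[OF finC disj] by simp
qed

text \<open>
  The word \<open>c\<close> has the letter \<open>r\<close> exactly on \<open>A \<union> X\<close>. The claim is the
  equation that \<open>\<psi>\<close> gives when the new letters \<open>r + 1\<close> are placed on
  \<open>E \<subseteq> A\<close> and on a subset of \<open>X\<close> that varies, as if \<open>A\<close> did not take
  part in the sum. It is obtained by downward induction on \<open>E\<close>: the equation for \<open>c\<close> with
  \<open>E\<close> recoloured splits, according to the part \<open>S\<close> of the subset in \<open>A - E\<close>, into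
  multiples of the sums for \<open>E \<union> S\<close>, of which all but \<open>S = {}\<close> vanish. The hypothesis
  \<open>card A < j\<close> guarantees \<open>t \<ge> 1\<close> in each step.
\<close>

lemma garnir_relation:
  fixes F :: "(nat \<Rightarrow> nat) \<Rightarrow> 'a::field"
  assumes F: "F \<in> psi_kernel q n" and r: "r \<ge> 1"
    and c: "positions n c r = A \<union> X" and left: "\<And>a x. a \<in> A \<Longrightarrow> x \<in> X \<Longrightarrow> a < x"
    and E: "E \<subseteq> A" and j: "card A < j"
  shows "(\<Sum>C | C \<subseteq> X \<and> card C = j - card E. weight q X C * F (recolour c (E \<union> C) (Suc r))) = 0"
  using E
proof (induction "card A - card E" arbitrary: E rule: less_induct)
  case less
  have fin: "finite A" "finite X" using finite_positions[of n c r] unfolding c by auto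
  have disj: "A \<inter> X = {}" using left by force
  have finE: "finite E" using less.prems fin finite_subset by blast
  have cardE: "card E \<le> card A" using less.prems fin card_mono by blast
  define c' where "c' = recolour c E (Suc r)"
  have c': "positions n c' r = (A - E) \<union> X"
    using c less.prems disj by (auto simp: positions_def c'_def recolour_def)
  define t where "t = j - card E"
  define G where "G S = (\<Sum>C | C \<subseteq> X \<and> card C = j - card (E \<union> S). weight q X C * F (recolour c (E \<union> S \<union> C) (Suc r)))" for S
  define I where "I = {S. S \<subseteq> A - E \<and> card S \<le> t}"
  have finI: "finite I" unfolding I_def by (rule finite_subset[of _ "Pow A"]) (use fin in auto)
  have G0: "G S = 0" if "S \<in> I" "S \<noteq> {}" for S
  proof -
    have S: "S \<subseteq> A - E" "finite S" using that finite_subset[of S A] fin unfolding I_def by auto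
    have "E \<inter> S = {}" using S by auto
    then have "card (E \<union> S) > card E" using S that(2) finE by (simp add: card_Un_disjoint card_gt_0_iff)
    moreover have "card (E \<union> S) \<le> card A" using S less.prems fin by (intro card_mono) auto
    ultimately have "card A - card (E \<union> S) < card A - card E" by linarith
    moreover have "E \<union> S \<subseteq> A" using S less.prems by auto
    ultimately show ?thesis unfolding G_def by (rule less.hyps)
  qed
  have "psi q n r t F c' = 0" 
    using F r j cardE unfolding psi_kernel_def t_def by auto
  then have "0 = (\<Sum>D | D \<subseteq> (A - E) \<union> X \<and> card D = t. weight q ((A - E) \<union> X) D * F (recolour c' D (Suc r)))"
    unfolding psi_def c' by simp
  \<comment> \<open>A subset of \<open>(A - E) \<union> X\<close> is split into its traces \<open>S\<close> and \<open>C\<close>.\<close>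
  also have "\<dots> = (\<Sum>(S, C)\<in>(SIGMA S:I. {C. C \<subseteq> X \<and> card C = t - card S}).
      weight q ((A - E) \<union> X) (S \<union> C) * F (recolour c' (S \<union> C) (Suc r)))"
  proof (rule sum.reindex_bij_witness[of _ "\<lambda>(S, C). S \<union> C" "\<lambda>D. (D \<inter> (A - E), D \<inter> X)"], goal_cases)
    case (2 D)
    then have D: "D = (D \<inter> (A - E)) \<union> (D \<inter> X)" by auto
    have fD: "finite D" using 2 fin finite_subset[of D "(A - E) \<union> X"] by auto
    have "card D = card (D \<inter> (A - E)) + card (D \<inter> X)"
      by (subst D, rule card_Un_disjoint) (use fD disj in auto)
    then show ?case using 2 unfolding I_def by auto
  next
    case (1 D)
    then show ?case by auto
  next
    case (3 p)
    then show ?case using disj by (auto simp: I_def)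
  next
    case (4 p)
    obtain S C where p: "p = (S, C)" by (cases p)
    have sub: "S \<subseteq> A - E" "C \<subseteq> X" using 4 unfolding p I_def by auto
    then have "finite S" "finite C" using finite_subset[of S A] finite_subset[of C X] fin by auto
    moreover have "S \<inter> C = {}" using sub disj by auto
    ultimately show ?case using 4 unfolding p I_def by (auto simp: card_Un_disjoint)
  next
    case (5 D)
    then have "(D \<inter> (A - E)) \<union> (D \<inter> X) = D" by auto
    then show ?case by simp
  qed
  also have "\<dots> = (\<Sum>S\<in>I. \<Sum>C | C \<subseteq> X \<and> card C = t - card S.
      weight q ((A - E) \<union> X) (S \<union> C) * F (recolour c' (S \<union> C) (Suc r)))"
    using finI fin by (subst sum.Sigma) auto
  also have "\<dots> = (\<Sum>S\<in>I. if S = {} then \<Sum>C | C \<subseteq> X \<and> card C = t.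
      weight q ((A - E) \<union> X) C * F (recolour c' C (Suc r)) else 0)"
  proof (intro sum.cong refl)
    fix S assume S: "S \<in> I"
    have sub: "S \<subseteq> A - E" "finite S" using S finite_subset[of S A] fin unfolding I_def by auto
    have card: "j - card (E \<union> S) = t - card S"
      using sub finE by (subst card_Un_disjoint) (auto simp: t_def)
    have rec: "recolour c' (S \<union> C) (Suc r) = recolour c (E \<union> S \<union> C) (Suc r)" for C
      by (auto simp: c'_def recolour_def)
    obtain u where u: "\<And>C. C \<subseteq> X \<Longrightarrow> weight q ((A - E) \<union> X) (S \<union> C) = u * weight q X C"
      by (rule weight_union_left[of X "A - E" S q]) (use fin left sub in auto)
    have "(\<Sum>C | C \<subseteq> X \<and> card C = t - card S. weight q ((A - E) \<union> X) (S \<union> C) * F (recolour c' (S \<union> C) (Suc r)))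
        = u * G S"
      unfolding G_def card sum_distrib_left by (intro sum.cong) (auto simp: u rec)
    then show "(\<Sum>C | C \<subseteq> X \<and> card C = t - card S. weight q ((A - E) \<union> X) (S \<union> C) * F (recolour c' (S \<union> C) (Suc r)))
        = (if S = {} then \<Sum>C | C \<subseteq> X \<and> card C = t. weight q ((A - E) \<union> X) C * F (recolour c' C (Suc r)) else 0)"
      using G0[OF S] by auto
  qed
  also have "\<dots> = (\<Sum>C | C \<subseteq> X \<and> card C = t. weight q ((A - E) \<union> X) C * F (recolour c' C (Suc r)))"
    using finI by (subst sum.delta) (auto simp: I_def)
  also have "\<dots> = (\<Sum>C | C \<subseteq> X \<and> card C = t. weight q X C * F (recolour c (E \<union> C) (Suc r)))"
  proof (intro sum.cong refl)
    fix C assume C: "C \<in> {C. C \<subseteq> X \<and> card C = t}"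
    have "{k' \<in> A - E \<union> X. k < k'} = {k' \<in> X. k < k'}" if "k \<in> C" for k
      using left that C by force
    then have "weight q ((A - E) \<union> X) C = weight q X C" by (simp add: weight_def)
    moreover have "recolour c' C (Suc r) = recolour c (E \<union> C) (Suc r)"
      by (auto simp: c'_def recolour_def)
    ultimately show "weight q ((A - E) \<union> X) C * F (recolour c' C (Suc r)) = weight q X C * F (recolour c (E \<union> C) (Suc r))"
      by simp
  qed
  finally show ?case by (simp add: t_def)
qed

text \<open>
  If the prefix of length \<open>m\<close> has more letters \<open>r + 1\<close> than letters \<open>r\<close>, the
  Garnir relation for the letters \<open>r + 1\<close> of the prefix and the letters \<open>r\<close> behind it applies:
  in a sorted prefix, the letters \<open>r\<close> precede all of these. Every other term of the relation has
  letters \<open>r + 1\<close> further to the right, so it belongs to a larger word and vanishes by maximality.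
\<close>

lemma maximal_word_sorted_prefix_ballot:
  assumes F: "F \<in> psi_kernel q n" and q: "q \<noteq> 0" and max: "maximal_word n F b"
    and m: "m \<le> n" and r: "r \<ge> 1"
    and sorted: "\<And>i. 1 \<le> i \<Longrightarrow> i < m \<Longrightarrow> b i \<le> b (Suc i)"
  shows "cnt b m (Suc r) \<le> cnt b m r"
proof (rule ccontr)
  assume neg: "\<not> ?thesis"
  define A where "A = {k \<in> {1..m}. b k = r}"
  define P where "P = {k \<in> {1..m}. b k = Suc r}"
  define Q where "Q = {k \<in> {Suc m..n}. b k = r}"
  define X where "X = P \<union> Q"
  have j: "card A < card P" using neg by (simp add: A_def P_def cnt_def)
  have mono: "b i \<le> b k" if "1 \<le> i" "i \<le> k" "k \<le> m" for i k
    using that(2,3,1) by (induction rule: dec_induct) (use sorted in \<open>auto intro: order_trans\<close>)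
  have left: "a < x" if "a \<in> A" "x \<in> X" for a x
  proof (rule ccontr)
    assume "\<not> a < x"
    then show False using that mono[of x a] by (auto simp: A_def X_def P_def Q_def)
  qed
  define c where "c = recolour b P r"
  have c: "positions n c r = A \<union> X"
    using m by (auto simp: positions_def c_def recolour_def A_def X_def P_def Q_def)
  have fin: "finite X" "finite P" by (auto simp: X_def P_def Q_def)
  have cP: "recolour c P (Suc r) = b"
    by (auto simp: c_def recolour_def P_def)
  have zero: "F (recolour c C (Suc r)) = 0" if C: "C \<subseteq> X" "card C = card P" "C \<noteq> P" for C
  proof (rule ccontr)
    let ?d = "recolour c C (Suc r)"
    assume nz: "F ?d \<noteq> 0"
    have finC: "finite C" using C fin finite_subset by blast
    have "dominated n b ?d"
      unfolding dominated_def
    proof (intro allI impI)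
      fix m' s assume "m' \<le> n"
      show "cnt_le b m' s \<le> cnt_le ?d m' s"
      proof (cases "s = r")
        case False
        have eq: "b k \<le> s \<longleftrightarrow> ?d k \<le> s" for k
          using C(1) False by (auto simp: recolour_def c_def X_def P_def Q_def)
        show ?thesis unfolding cnt_le_def eq ..
      next
        case True
        let ?I = "{1..m'}"
        have "card (C \<inter> ?I) \<le> card (P \<inter> ?I)"
        proof (cases "m' \<le> m")
          case True
          then have "C \<inter> ?I \<subseteq> P \<inter> ?I" using C(1) by (auto simp: X_def Q_def)
          then show ?thesis using fin by (intro card_mono) auto
        next
          case False
          then have "P \<inter> ?I = P" by (auto simp: P_def)
          then show ?thesis using C(2) card_mono[OF finC, of "C \<inter> ?I"] by simp
        qed
        moreover have "cnt_le c m' r = cnt_le b m' r + card (P \<inter> ?I)"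
        proof -
          have "{k \<in> ?I. c k \<le> r} = {k \<in> ?I. b k \<le> r} \<union> (P \<inter> ?I)"
            by (auto simp: c_def recolour_def P_def)
          then show ?thesis unfolding cnt_le_def
            by (simp only:) (subst card_Un_disjoint, auto simp: P_def)
        qed
        moreover have "cnt_le c m' r = cnt_le ?d m' r + card (C \<inter> ?I)"
        proof -
          have cC: "c k = r" if "k \<in> C" for k using that C(1) by (auto simp: c_def recolour_def X_def P_def Q_def)
          have "{k \<in> ?I. c k \<le> r} = {k \<in> ?I. ?d k \<le> r} \<union> (C \<inter> ?I)"
            by (auto simp: recolour_def[of c] cC split: if_splits)
          then show ?thesis unfolding cnt_le_def
            by (simp only:) (subst card_Un_disjoint, auto simp: recolour_def[of c])
        qed
        ultimately show ?thesis using True by simp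
      qed
    qed
    then have eq: "?d = b" using max nz unfolding maximal_word_def by blast
    have "P \<subseteq> C"
    proof
      fix k assume "k \<in> P"
      then have "c k = r" "b k = Suc r" by (auto simp: c_def recolour_def P_def)
      then show "k \<in> C" using fun_cong[OF eq, of k] by (auto simp: recolour_def[of c] split: if_splits)
    qed
    then show False using card_subset_eq[OF finC, of P] C(2,3) by simp
  qed
  have "(\<Sum>C | C \<subseteq> X \<and> card C = card P. weight q X C * F (recolour c C (Suc r))) = 0"
    using garnir_relation[OF F r c left _ j, of "{}"] by simp
  also have "(\<Sum>C | C \<subseteq> X \<and> card C = card P. weight q X C * F (recolour c C (Suc r)))
      = (\<Sum>C | C \<subseteq> X \<and> card C = card P. if C = P then weight q X P * F b else 0)"
    by (intro sum.cong) (auto simp: zero cP)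
  also have "\<dots> = weight q X P * F b"
    using fin by (subst sum.delta) (auto simp: X_def)
  finally show False using max q fin by (simp add: maximal_word_def weight_def)
qed

text \<open>
  Sorting a descent inside the prefix keeps the function in the kernel and the word maximal, and
  does not change the number of letters of each kind in the prefix. So the prefix may be assumed
  to be sorted.
\<close>

lemma maximal_word_ballot:
  assumes F: "F \<in> psi_kernel q n" and q: "q \<noteq> 0" and max: "maximal_word n F b"
  shows "ballot n b"
  unfolding ballot_def
proof (intro allI impI)
  fix m r assume m: "m \<le> n" and r: "(1::nat) \<le> r"
  show "cnt b m (Suc r) \<le> cnt b m r"
    using F max
  proof (induction "\<Sum>k\<in>{1..m}. (m - k) * b k" arbitrary: F b rule: less_induct)
    case less
    show ?case
    proof (cases "\<exists>i. 1 \<le> i \<and> i < m \<and> b (Suc i) < b i")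
      case False
      then show ?thesis
        using maximal_word_sorted_prefix_ballot[OF less.prems(1) q less.prems(2) m r] by (meson not_le)
    next
      case True
      then obtain i where i: "1 \<le> i" "i < m" "b (Suc i) < b i" by blast
      let ?bs = "b \<circ> simple_refl i"
      have "(\<Sum>k\<in>{1..m}. (m - k) * ?bs k) < (\<Sum>k\<in>{1..m}. (m - k) * b k)"
      proof -
        have sub: "{i, Suc i} \<subseteq> {1..m}" using i by auto
        have split: "(\<Sum>k\<in>{1..m}. (m - k) * f k) =
            (\<Sum>k\<in>{1..m} - {i, Suc i}. (m - k) * f k) + ((m - i) * f i + (m - Suc i) * f (Suc i))" for f :: "nat \<Rightarrow> nat"
          using sum.subset_diff[OF sub, of "\<lambda>k. (m - k) * f k"] by simp
        obtain d where d: "m - i = Suc d" "m - Suc i = d" using i by (metis Suc_diff_Suc)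
        have "(\<Sum>k\<in>{1..m} - {i, Suc i}. (m - k) * ?bs k) = (\<Sum>k\<in>{1..m} - {i, Suc i}. (m - k) * b k)"
          by (intro sum.cong) auto
        then show ?thesis unfolding split d using i(3) by simp
      qed
      moreover have "act q F i \<in> psi_kernel q n" if "F \<in> psi_kernel q n" for F :: "(nat \<Rightarrow> nat) \<Rightarrow> 'a"
        by (rule psi_kernel_act[OF that]) (use i m in auto)
      moreover have "maximal_word n (act q F i) ?bs"
        using maximal_word_act[of i n b q F] i m q less.prems by simp
      ultimately have "cnt ?bs m (Suc r) \<le> cnt ?bs m r" using less.hyps less.prems by blast
      then show ?thesis using cnt_swap[of i m b] i by simp
    qed
  qed
qed

section \<open>Elimination of leading words\<close>

definition top_word :: "nat \<Rightarrow> ((nat \<Rightarrow> nat) \<Rightarrow> 'a::field) \<Rightarrow> (nat \<Rightarrow> nat) \<Rightarrow> bool" where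
  "top_word n F b \<longleftrightarrow> F b \<noteq> 0 \<and> (\<forall>c. F c \<noteq> 0 \<longrightarrow> dominated n c b)"

lemma top_word_act:
  assumes i: "1 \<le> i" "i < n" and b: "b (Suc i) < b i" and q: "q \<noteq> 0" and top: "top_word n F b"
  shows "top_word n (act q F i) (b \<circ> simple_refl i)"
proof -
  let ?bs = "b \<circ> simple_refl i"
  have "act q F i ?bs = q * F b" using b by (simp add: act_def)
  moreover have "dominated n c ?bs" if "act q F i c \<noteq> 0" for c
  proof -
    have "F c \<noteq> 0 \<or> F (c \<circ> simple_refl i) \<noteq> 0"
      using that by (auto simp: act_def split: if_splits)
    then show ?thesis
    proof
      assume "F c \<noteq> 0"
      then show ?thesis using top dominated_trans dominated_swap(1)[OF i b] unfolding top_word_def by blast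
    next
      assume "F (c \<circ> simple_refl i) \<noteq> 0"
      then show ?thesis using top dominated_swap(2)[OF i b, of "c \<circ> simple_refl i"] unfolding top_word_def by simp
    qed
  qed
  ultimately show ?thesis using top q by (auto simp: top_word_def)
qed

lemma ex_maximal_word:
  assumes W: "finite W" "\<And>a b. a \<in> W \<Longrightarrow> b \<in> W \<Longrightarrow> (\<And>k. 1 \<le> k \<Longrightarrow> k \<le> n \<Longrightarrow> a k = b k) \<Longrightarrow> a = b"
    and supp: "\<And>c. F c \<noteq> 0 \<Longrightarrow> c \<in> W" and c0: "F c0 \<noteq> 0"
  obtains b where "maximal_word n F b"
proof -
  define up where "up b = {c \<in> W. F c \<noteq> 0 \<and> dominated n b c}" for b
  obtain b where b: "F b \<noteq> 0" and least: "\<And>c. F c \<noteq> 0 \<Longrightarrow> card (up b) \<le> card (up c)"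
    using ex_has_least_nat[of "\<lambda>b. F b \<noteq> 0" c0 "\<lambda>b. card (up b)"] c0 by blast
  have "c = b" if c: "F c \<noteq> 0" "dominated n b c" for c
  proof (rule ccontr)
    assume "c \<noteq> b"
    have "\<not> dominated n c b"
      using dominated_antisym[OF c(2)] W(2)[of b c] supp b c(1) \<open>c \<noteq> b\<close> by metis
    then have "up c \<subset> up b"
      using c b supp by (auto simp: up_def intro: dominated_trans)
    then show False
      using least[OF c(1)] psubset_card_mono[of "up b" "up c"] W(1) by (simp add: up_def)
  qed
  then show ?thesis using b that by (auto simp: maximal_word_def)
qed

text \<open>
  A maximal word of the support is removed by subtracting a multiple of an element of \<open>S\<close> with
  this top word. This can only add smaller words, so the set of words below the support shrinks.
\<close>

lemma psi_kernel_subset_of_top_words: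
  fixes S :: "((nat \<Rightarrow> nat) \<Rightarrow> 'a::field) set"
  assumes q: "q \<noteq> 0"
    and W: "finite W" "\<And>a b. a \<in> W \<Longrightarrow> b \<in> W \<Longrightarrow> (\<And>k. 1 \<le> k \<Longrightarrow> k \<le> n \<Longrightarrow> a k = b k) \<Longrightarrow> a = b"
    and S0: "(\<lambda>_. 0) \<in> S" and S1: "\<And>F G x. F \<in> S \<Longrightarrow> G \<in> S \<Longrightarrow> (\<lambda>a. F a + x * G a) \<in> S"
    and SK: "S \<subseteq> psi_kernel q n" and SW: "\<And>F c. F \<in> S \<Longrightarrow> F c \<noteq> 0 \<Longrightarrow> c \<in> W"
    and tops: "\<And>b. b \<in> W \<Longrightarrow> ballot n b \<Longrightarrow> \<exists>F\<in>S. top_word n F b"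
    and F: "F \<in> psi_kernel q n" and FW: "\<And>c. F c \<noteq> 0 \<Longrightarrow> c \<in> W"
  shows "F \<in> S"
  using F FW
proof (induction "card {b \<in> W. \<exists>c. F c \<noteq> 0 \<and> dominated n b c}" arbitrary: F rule: less_induct)
  case less
  show ?case
  proof (cases "\<exists>c. F c \<noteq> 0")
    case False
    then have "F = (\<lambda>_. 0)" by auto
    then show ?thesis using S0 by simp
  next
    case True
    then obtain b where b: "maximal_word n F b" using ex_maximal_word[OF W less.prems(2)] by blast
    have bW: "b \<in> W" using b less.prems by (auto simp: maximal_word_def)
    obtain G where G: "G \<in> S" "top_word n G b"
      using tops[OF bW maximal_word_ballot[OF less.prems(1) q b]] by blast
    define x where "x = F b / G b"
    define F' where "F' = (\<lambda>a. F a + (- x) * G a)"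
    have F'b: "F' b = 0" using G by (simp add: F'_def x_def top_word_def)
    have "F' \<in> psi_kernel q n"
      using psi_kernel_lincomb[OF less.prems(1), of G 1 "- x"] G SK by (auto simp: F'_def)
    moreover have F'W: "c \<in> W" if "F' c \<noteq> 0" for c
      using that less.prems(2)[of c] SW[OF G(1), of c]
      by (cases "F c = 0"; cases "G c = 0") (auto simp: F'_def)
    moreover have "{b \<in> W. \<exists>c. F' c \<noteq> 0 \<and> dominated n b c} \<subset> {b \<in> W. \<exists>c. F c \<noteq> 0 \<and> dominated n b c}"
    proof
      have Fb: "F b \<noteq> 0" using b by (simp add: maximal_word_def)
      show "{b \<in> W. \<exists>c. F' c \<noteq> 0 \<and> dominated n b c} \<subseteq> {b \<in> W. \<exists>c. F c \<noteq> 0 \<and> dominated n b c}"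
      proof
        fix a assume "a \<in> {b \<in> W. \<exists>c. F' c \<noteq> 0 \<and> dominated n b c}"
        then obtain c where c: "a \<in> W" "F' c \<noteq> 0" "dominated n a c" by blast
        show "a \<in> {b \<in> W. \<exists>c. F c \<noteq> 0 \<and> dominated n b c}"
        proof (cases "F c = 0")
          case True
          then have "G c \<noteq> 0" using c by (auto simp: F'_def)
          then have "dominated n c b" using G by (simp add: top_word_def)
          then show ?thesis using Fb c dominated_trans by blast
        qed (use c in auto)
      qed
      have "\<not> (F' c \<noteq> 0 \<and> dominated n b c)" for c
      proof
        assume c: "F' c \<noteq> 0 \<and> dominated n b c"
        have "c = b"
        proof (cases "F c = 0")
          case True
          then have "G c \<noteq> 0" using c by (auto simp: F'_def)
          then have "dominated n c b" using G by (simp add: top_word_def)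
          then show ?thesis using dominated_antisym[of n c b] c W(2)[OF F'W bW] by blast
        qed (use b c in \<open>auto simp: maximal_word_def\<close>)
        then show False using F'b c by simp
      qed
      then show "{b \<in> W. \<exists>c. F' c \<noteq> 0 \<and> dominated n b c} \<noteq> {b \<in> W. \<exists>c. F c \<noteq> 0 \<and> dominated n b c}"
        using bW Fb dominated_refl by blast
    qed
    ultimately have "F' \<in> S"
      using less.hyps[of F'] psubset_card_mono[of "{b \<in> W. \<exists>c. F c \<noteq> 0 \<and> dominated n b c}"] W(1) by auto
    moreover have "F = (\<lambda>a. F' a + x * G a)" by (auto simp: F'_def)
    ultimately show ?thesis using S1[OF _ G(1)] by metis
  qed
qed

section \<open>Ballot words\<close>

lemma ballot_antimono:
  assumes "ballot n b" "m \<le> n" "1 \<le> x" "x \<le> y"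
  shows "cnt b m y \<le> cnt b m x"
  using assms(4,3) 
proof (induction rule: dec_induct)
  case (step y)
  then show ?case using assms(1,2) by (auto simp: ballot_def intro: order_trans)
qed simp

text \<open>
  Let \<open>i\<close> be the first position in which \<open>b\<close> differs from \<open>a0\<close>, and
  \<open>k\<close> the first position behind it with the letter \<open>x = a0 i\<close>. As \<open>a0\<close> is filled
  column by column, in the sense of the hypothesis \<open>col\<close>, the letters of \<open>b\<close> between
  \<open>i\<close> and \<open>k\<close> must be smaller than \<open>x\<close>: a larger letter would violate the ballot
  condition before \<open>x\<close> has been placed. So \<open>x\<close> forms an ascent with the letter in front of it,
  and may be moved forward because already \<open>a0\<close> satisfies the ballot condition with \<open>x\<close> in
  position \<open>i\<close>.
\<close>

lemma ballot_ascent: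
  assumes a0: "ballot n a0" and b: "ballot n b"
    and col: "\<And>i y. 1 \<le> i \<Longrightarrow> i \<le> n \<Longrightarrow> a0 i \<le> y \<Longrightarrow>
        cnt a0 (i - 1) y = cnt a0 (i - 1) (a0 i) \<or> cnt a0 (i - 1) y = cnt a0 n y"
    and pos: "\<And>k. 1 \<le> k \<Longrightarrow> k \<le> n \<Longrightarrow> 1 \<le> a0 k" "\<And>k. 1 \<le> k \<Longrightarrow> k \<le> n \<Longrightarrow> 1 \<le> b k"
    and content: "\<And>r. cnt b n r = cnt a0 n r"
    and ne: "\<exists>k. 1 \<le> k \<and> k \<le> n \<and> b k \<noteq> a0 k"
  obtains i where "1 \<le> i" "i < n" "b i < b (Suc i)" "ballot n (b \<circ> simple_refl i)"
proof -
  define i where "i = (LEAST k. 1 \<le> k \<and> k \<le> n \<and> b k \<noteq> a0 k)"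
  have i: "1 \<le> i" "i \<le> n" "b i \<noteq> a0 i"
    using LeastI_ex[OF ne] by (auto simp: i_def)
  have before: "b k = a0 k" if "1 \<le> k" "k < i" for k
    using not_less_Least[of k "\<lambda>k. 1 \<le> k \<and> k \<le> n \<and> b k \<noteq> a0 k"] that i by (auto simp: i_def)
  obtain i0 where i0: "i = Suc i0" using i by (cases i) auto
  have pre: "cnt b i0 r = cnt a0 i0 r" for r
    using before by (intro cnt_cong) (auto simp: i0)
  define x where "x = a0 i"
  have x1: "1 \<le> x" using pos(1) i by (simp add: x_def)
  have "cnt a0 i x \<le> cnt b n x" using cnt_mono[OF i(2)] content by metis
  then have more: "cnt b i0 x < cnt b n x" using pre by (simp add: i0 x_def cnt_Suc)
  have ex: "\<exists>k. i \<le> k \<and> k \<le> n \<and> b k = x"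
  proof (rule ccontr)
    assume none: "\<not> ?thesis"
    have "{k \<in> {1..n}. b k = x} \<subseteq> {k \<in> {1..i0}. b k = x}"
    proof
      fix k assume k: "k \<in> {k \<in> {1..n}. b k = x}"
      then have "\<not> i \<le> k" using none by auto
      then show "k \<in> {k \<in> {1..i0}. b k = x}" using k by (simp add: i0)
    qed
    then have "cnt b n x \<le> cnt b i0 x" unfolding cnt_def by (intro card_mono) auto
    then show False using more by simp
  qed
  define k where "k = (LEAST k. i \<le> k \<and> k \<le> n \<and> b k = x)"
  have k: "i \<le> k" "k \<le> n" "b k = x" using LeastI_ex[OF ex] by (auto simp: k_def)
  have between: "b k' \<noteq> x" if "i \<le> k'" "k' < k" for k'
    using not_less_Least[of k' "\<lambda>k. i \<le> k \<and> k \<le> n \<and> b k = x"] that k by (auto simp: k_def)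
  have "k \<noteq> i" using i k by (auto simp: x_def)
  then obtain j where j: "k = Suc j" "i \<le> j" using k by (cases k) auto
  have cnt_x: "cnt b m x = cnt b i0 x" if "i0 \<le> m" "m \<le> j" for m
    using that by (induction rule: dec_induct) (use between j i0 in \<open>auto simp: cnt_Suc\<close>)
  have less: "b j < x"
  proof (rule ccontr)
    define y where "y = b j"
    assume "\<not> b j < x"
    then have y: "x < y" using between[of j] j by (auto simp: y_def)
    obtain j0 where j0: "j = Suc j0" using j i by (cases j) auto
    have "cnt b i0 y \<le> cnt b j0 y" using cnt_mono j j0 i0 by simp
    then have up: "cnt b i0 y < cnt b j y" by (simp add: j0 y_def cnt_Suc)
    have "cnt b j y \<le> cnt b n y" using cnt_mono[of j n] j k by simp
    then have "cnt a0 i0 y \<noteq> cnt a0 n y" using up pre content by simp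
    then have "cnt a0 i0 y = cnt a0 i0 x" using col[of i y] i y by (auto simp: i0 x_def)
    then have "cnt b i0 x < cnt b j y" using up pre by simp
    moreover have "cnt b j y \<le> cnt b j x" using ballot_antimono[OF b] j k x1 y by simp
    ultimately show False using cnt_x[of j] j i0 by simp
  qed
  have "ballot n (b \<circ> simple_refl j)"
    unfolding ballot_def
  proof (intro allI impI)
    fix m r assume m: "m \<le> n" and r: "(1::nat) \<le> r"
    show "cnt (b \<circ> simple_refl j) m (Suc r) \<le> cnt (b \<circ> simple_refl j) m r"
    proof (cases "m = j")
      case False
      then show ?thesis using cnt_swap[of j m b] b m r i j by (simp add: ballot_def)
    next
      case True
      obtain j0 where j0: "j = Suc j0" using j i by (cases j) auto
      have le: "cnt b j0 (Suc r) \<le> cnt b j0 r" using b r m j0 True by (simp add: ballot_def)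
      show ?thesis
      proof (cases "Suc r = x")
        case False
        then show ?thesis using le k j unfolding True j0 cnt_swap_at by auto
      next
        case x: True
        have "cnt a0 i x \<le> cnt a0 i r" using a0 i r x unfolding ballot_def by blast
        moreover have "a0 (Suc i0) = x" by (simp add: x_def i0)
        ultimately have "Suc (cnt a0 i0 x) \<le> cnt a0 i0 r"
          using x unfolding i0 cnt_Suc by simp
        then have "Suc (cnt b i0 x) \<le> cnt b i0 r" using pre by simp
        also have "\<dots> \<le> cnt b j0 r" using cnt_mono j j0 i0 by simp
        finally show ?thesis
          using x cnt_x[of j0] j j0 i0 k unfolding True j0 cnt_swap_at by auto
      qed
    qed
  qed
  then show ?thesis using that[of j] less k j i by auto
qed

text \<open>
  Undoing the ascents provided by \<open>ballot_ascent\<close> leads from any ballot word to \<open>a0\<close>. Each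
  step decreases the sum of \<open>k * b k\<close>, and \<open>top_word_act\<close> follows the path back.
\<close>

lemma top_words_exist:
  fixes S :: "((nat \<Rightarrow> nat) \<Rightarrow> 'a::field) set"
  assumes q: "q \<noteq> 0" and Z: "Z \<in> S" "top_word n Z a0" and a0W: "a0 \<in> W"
    and act: "\<And>F i. F \<in> S \<Longrightarrow> 1 \<le> i \<Longrightarrow> i < n \<Longrightarrow> act q F i \<in> S"
    and swapW: "\<And>b i. b \<in> W \<Longrightarrow> 1 \<le> i \<Longrightarrow> i < n \<Longrightarrow> b \<circ> simple_refl i \<in> W"
    and extW: "\<And>a b. a \<in> W \<Longrightarrow> b \<in> W \<Longrightarrow> (\<And>k. 1 \<le> k \<Longrightarrow> k \<le> n \<Longrightarrow> a k = b k) \<Longrightarrow> a = b"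
    and posW: "\<And>b k. b \<in> W \<Longrightarrow> 1 \<le> k \<Longrightarrow> k \<le> n \<Longrightarrow> 1 \<le> b k"
    and contentW: "\<And>b r. b \<in> W \<Longrightarrow> cnt b n r = cnt a0 n r"
    and a0: "ballot n a0"
    and col: "\<And>i y. 1 \<le> i \<Longrightarrow> i \<le> n \<Longrightarrow> a0 i \<le> y \<Longrightarrow>
        cnt a0 (i - 1) y = cnt a0 (i - 1) (a0 i) \<or> cnt a0 (i - 1) y = cnt a0 n y"
    and b: "b \<in> W" "ballot n b"
  shows "\<exists>F\<in>S. top_word n F b"
  using b
proof (induction "\<Sum>k\<in>{1..n}. k * b k" arbitrary: b rule: less_induct)
  case less
  show ?case
  proof (cases "b = a0")
    case True
    then show ?thesis using Z by blast
  next
    case False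
    then have ne: "\<exists>k. 1 \<le> k \<and> k \<le> n \<and> b k \<noteq> a0 k" using extW less.prems a0W by blast
    obtain i where i: "1 \<le> i" "i < n" "b i < b (Suc i)" "ballot n (b \<circ> simple_refl i)"
      by (rule ballot_ascent[OF a0 less.prems(2) _ _ _ _ ne])
        (use col posW a0W less.prems contentW in blast)+
    let ?bs = "b \<circ> simple_refl i"
    have "(\<Sum>k\<in>{1..n}. k * ?bs k) < (\<Sum>k\<in>{1..n}. k * b k)"
    proof -
      have sub: "{i, Suc i} \<subseteq> {1..n}" using i by auto
      have split: "(\<Sum>k\<in>{1..n}. k * f k) =
          (\<Sum>k\<in>{1..n} - {i, Suc i}. k * f k) + (i * f i + Suc i * f (Suc i))" for f :: "nat \<Rightarrow> nat"
        using sum.subset_diff[OF sub, of "\<lambda>k. k * f k"] by simp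
      have "(\<Sum>k\<in>{1..n} - {i, Suc i}. k * ?bs k) = (\<Sum>k\<in>{1..n} - {i, Suc i}. k * b k)"
        by (intro sum.cong) auto
      then show ?thesis unfolding split using i(3) by simp
    qed
    then obtain F where F: "F \<in> S" "top_word n F ?bs"
      using less.hyps[of ?bs] swapW[OF less.prems(1) i(1,2)] i(4) by blast
    have "top_word n (act q F i) (?bs \<circ> simple_refl i)"
      by (rule top_word_act[OF i(1,2) _ q F(2)]) (use i in auto)
    then show ?thesis using act[OF F(1) i(1,2)] by auto
  qed
qed

section \<open>Inversions and descents\<close>

definition inversions :: "nat \<Rightarrow> permutation \<Rightarrow> (nat \<times> nat) set" where
  "inversions n w = {(x, y). 1 \<le> x \<and> x < y \<and> y \<le> n \<and> w y < w x}"

text \<open>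
  The condition \<open>\<ell>(w s\<^sub>i) < \<ell>(w)\<close>, for the product read from left to right.
\<close>

definition descent :: "permutation \<Rightarrow> nat \<Rightarrow> bool" where
  "descent w i \<longleftrightarrow> inv w (Suc i) < inv w i"

lemma finite_inversions [simp]: "finite (inversions n w)"
  by (rule finite_subset[of _ "{1..n} \<times> {1..n}"]) (auto simp: inversions_def)

lemma finite_sym_grp [simp]: "finite (sym_grp n)"
  by (simp add: sym_grp_def finite_permutations)

lemma id_sym_grp [simp]: "id \<in> sym_grp n"
  by (simp add: sym_grp_def permutes_id)

lemma comp_sym_grp: "v \<in> sym_grp n \<Longrightarrow> w \<in> sym_grp n \<Longrightarrow> v \<circ> w \<in> sym_grp n"
  by (simp add: sym_grp_def permutes_compose)

lemma inv_sym_grp: "v \<in> sym_grp n \<Longrightarrow> inv v \<in> sym_grp n"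
  by (simp add: sym_grp_def permutes_inv)

lemma sym_grp_bij: "v \<in> sym_grp n \<Longrightarrow> bij v"
  by (simp add: sym_grp_def permutes_bij)

lemma sym_grp_inv_eq_iff: "v \<in> sym_grp n \<Longrightarrow> inv v x = y \<longleftrightarrow> v y = x"
  by (metis sym_grp_bij bij_inv_eq_iff)

lemma sym_grp_eq_iff: "v \<in> sym_grp n \<Longrightarrow> v x = v y \<longleftrightarrow> x = y"
  by (metis sym_grp_bij bij_is_inj injD)

lemma sym_grp_in_iff: "v \<in> sym_grp n \<Longrightarrow> v x \<in> {1..n} \<longleftrightarrow> x \<in> {1..n}"
  unfolding sym_grp_def mem_Collect_eq by (rule permutes_in_image)

lemma sym_grp_range: "v \<in> sym_grp n \<Longrightarrow> 1 \<le> x \<Longrightarrow> x \<le> n \<Longrightarrow> 1 \<le> v x \<and> v x \<le> n"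
  using sym_grp_in_iff[of v n x] by simp

lemma simple_refl_sym_grp: "1 \<le> i \<Longrightarrow> i < n \<Longrightarrow> simple_refl i \<in> sym_grp n"
  unfolding sym_grp_def simple_refl_def by (simp add: permutes_swap_id)

lemma simple_refl_comp_sym_grp:
  "1 \<le> i \<Longrightarrow> i < n \<Longrightarrow> w \<in> sym_grp n \<Longrightarrow> simple_refl i \<circ> w \<in> sym_grp n"
  by (intro comp_sym_grp simple_refl_sym_grp)

lemma inv_simple_refl [simp]: "inv (simple_refl i) = simple_refl i"
  by (simp add: simple_refl_def inv_transpose_eq)

lemma comp_simple_refl_left_twice [simp]: "simple_refl i \<circ> (simple_refl i \<circ> w) = w"
  by (simp add: fun_eq_iff)

lemma inv_simple_refl_comp: "v \<in> sym_grp n \<Longrightarrow> inv (simple_refl i \<circ> v) = inv v \<circ> simple_refl i"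
  by (subst o_inv_distrib) (auto simp: sym_grp_bij simple_refl_def)

lemma inv_comp_simple_refl: "v \<in> sym_grp n \<Longrightarrow> inv (v \<circ> simple_refl i) = simple_refl i \<circ> inv v"
  by (subst o_inv_distrib) (auto simp: sym_grp_bij simple_refl_def)

lemma inv_inv_sym_grp: "v \<in> sym_grp n \<Longrightarrow> inv (inv v) = v"
  by (simp add: sym_grp_bij inv_inv_eq)

lemma descent_simple_refl_comp:
  "v \<in> sym_grp n \<Longrightarrow> descent (simple_refl i \<circ> v) i \<longleftrightarrow> \<not> descent v i"
proof -
  assume v: "v \<in> sym_grp n"
  have "inv v i \<noteq> inv v (Suc i)" using sym_grp_eq_iff[OF inv_sym_grp[OF v]] by simp
  then show ?thesis using v by (auto simp: descent_def inv_simple_refl_comp)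
qed

lemma inversions_ascent:
  assumes w: "w \<in> sym_grp n" and i: "1 \<le> i" "i < n" and asc: "\<not> descent w i"
  shows "inversions n (simple_refl i \<circ> w) = insert (inv w i, inv w (Suc i)) (inversions n w)"
    and "(inv w i, inv w (Suc i)) \<notin> inversions n w"
proof -
  have neq: "inv w i \<noteq> inv w (Suc i)" using sym_grp_eq_iff[OF inv_sym_grp[OF w]] by simp
  have less: "inv w i < inv w (Suc i)" using asc neq by (simp add: descent_def)
  have ww: "w (inv w x) = x" for x using sym_grp_inv_eq_iff[OF w] by blast
  show "(inv w i, inv w (Suc i)) \<notin> inversions n w" by (simp add: inversions_def ww)
  have range: "1 \<le> inv w i" "inv w (Suc i) \<le> n"
    using sym_grp_range[OF inv_sym_grp[OF w]] i by auto
  show "inversions n (simple_refl i \<circ> w) = insert (inv w i, inv w (Suc i)) (inversions n w)"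
  proof (intro set_eqI, clarify)
    fix x y
    consider "w x = i \<and> w y = Suc i" | "w x = Suc i \<and> w y = i"
      | "\<not> (w y = i \<and> w x = Suc i)" "\<not> (w y = Suc i \<and> w x = i)" by blast
    then show "(x, y) \<in> inversions n (simple_refl i \<circ> w) \<longleftrightarrow>
        (x, y) \<in> insert (inv w i, inv w (Suc i)) (inversions n w)"
    proof cases
      case 1
      then have "x = inv w i" "y = inv w (Suc i)" using sym_grp_inv_eq_iff[OF w] by metis+
      then show ?thesis using less range 1 by (simp add: inversions_def)
    next
      case 2
      then have "x = inv w (Suc i)" "y = inv w i" using sym_grp_inv_eq_iff[OF w] by metis+
      then show ?thesis using less 2 by (simp add: inversions_def)
    next
      case 3
      then have "(x, y) \<noteq> (inv w i, inv w (Suc i))" using ww by auto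
      then show ?thesis using simple_refl_less_iff[OF 3] by (auto simp: inversions_def)
    qed
  qed
qed

lemma card_inversions_ascent:
  assumes "w \<in> sym_grp n" "1 \<le> i" "i < n" "\<not> descent w i"
  shows "card (inversions n (simple_refl i \<circ> w)) = Suc (card (inversions n w))"
  using inversions_ascent[OF assms] by simp

lemma card_inversions_descent:
  assumes "w \<in> sym_grp n" "1 \<le> i" "i < n" "descent w i"
  shows "card (inversions n w) = Suc (card (inversions n (simple_refl i \<circ> w)))"
  using card_inversions_ascent[of "simple_refl i \<circ> w" n i] assms
  by (simp add: comp_sym_grp simple_refl_sym_grp descent_simple_refl_comp)

text \<open>
  The inverse is strictly increasing on \<open>{1..n}\<close>.
\<close>

lemma no_descent_imp_id:
  assumes w: "w \<in> sym_grp n" and asc: "\<And>i. 1 \<le> i \<Longrightarrow> i < n \<Longrightarrow> \<not> descent w i"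
  shows "w = id"
proof -
  define v where "v = inv w"
  have v: "v \<in> sym_grp n" using inv_sym_grp[OF w] by (simp add: v_def)
  have less: "v i < v (Suc i)" if "1 \<le> i" "i < n" for i
    using asc[OF that] sym_grp_eq_iff[OF v, of i "Suc i"] by (auto simp: descent_def v_def)
  have ge: "Suc k \<le> v (Suc k)" if "k < n" for k
    using that
  proof (induction k)
    case 0
    then show ?case using sym_grp_range[OF v, of 1] by simp
  next
    case (Suc k)
    then show ?case using less[of "Suc k"] by simp
  qed
  have le: "v k + (m - k) \<le> v m" if "k \<le> m" "1 \<le> k" "m \<le> n" for k m
    using that
  proof (induction rule: dec_induct)
    case (step m)
    then show ?case using less[of m] by (simp add: Suc_diff_le)
  qed simp
  have "v k = k" for k
  proof (cases "k \<in> {1..n}")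
    case True
    then obtain k' where k': "k = Suc k'" by (cases k) auto
    have "v k + (n - k) \<le> v n" using le[of k n] True by simp
    moreover have "v n \<le> n" using sym_grp_range[OF v, of n] True by simp
    ultimately show ?thesis using ge[of k'] True k' by simp
  next
    case False
    then show ?thesis using v by (auto simp: sym_grp_def permutes_not_in)
  qed
  then have "v = id" by auto
  then show ?thesis using inv_inv_sym_grp[OF w] by (metis inv_id v_def)
qed

section \<open>Reduced words\<close>

lemma is_word_Nil: "is_word n w [] \<longleftrightarrow> w = id"
  by (auto simp: is_word_def)

lemma is_word_snoc:
  "is_word n w (js @ [i]) \<longleftrightarrow> 1 \<le> i \<and> i < n \<and> is_word n (simple_refl i \<circ> w) js"
  by (auto simp: is_word_def right_mult_simple_def)

lemma is_word_sym_grp: "is_word n w js \<Longrightarrow> w \<in> sym_grp n"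
proof (induction js arbitrary: w rule: rev_induct)
  case (snoc i js)
  then have i: "1 \<le> i" "i < n" and "simple_refl i \<circ> w \<in> sym_grp n" by (auto simp: is_word_snoc)
  then have "simple_refl i \<circ> (simple_refl i \<circ> w) \<in> sym_grp n"
    by (rule comp_sym_grp[OF simple_refl_sym_grp])
  then show ?case by (simp only: comp_simple_refl_left_twice)
qed (simp add: is_word_Nil)

lemma card_inversions_le_length: "is_word n w js \<Longrightarrow> card (inversions n w) \<le> length js"
proof (induction js arbitrary: w rule: rev_induct)
  case Nil
  then have "inversions n w = {}" by (auto simp: is_word_Nil inversions_def)
  then show ?case by simp
next
  case (snoc i js)
  then have i: "1 \<le> i" "i < n" and js: "is_word n (simple_refl i \<circ> w) js" by (auto simp: is_word_snoc)
  have w: "w \<in> sym_grp n" using is_word_sym_grp snoc.prems by blast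
  have "card (inversions n w) \<le> Suc (card (inversions n (simple_refl i \<circ> w)))"
    using card_inversions_ascent[OF w i] card_inversions_descent[OF w i] by linarith
  also have "\<dots> \<le> Suc (length js)" using snoc.IH[OF js] by blast
  finally show ?case by simp
qed

lemma ex_reduced_word:
  assumes "w \<in> sym_grp n"
  shows "\<exists>js. is_word n w js \<and> length js = card (inversions n w)"
  using assms
proof (induction "card (inversions n w)" arbitrary: w rule: less_induct)
  case less
  show ?case
  proof (cases "\<exists>i. 1 \<le> i \<and> i < n \<and> descent w i")
    case False
    then have "w = id" using no_descent_imp_id[OF less.prems] by blast
    then have "is_word n w []" "inversions n w = {}" by (auto simp: is_word_Nil inversions_def)
    then show ?thesis by (intro exI[of _ "[]"]) simp
  next
    case True
    then obtain i where i: "1 \<le> i" "i < n" "descent w i" by blast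
    have s: "simple_refl i \<circ> w \<in> sym_grp n" using i less.prems by (simp add: comp_sym_grp simple_refl_sym_grp)
    obtain js where "is_word n (simple_refl i \<circ> w) js" "length js = card (inversions n (simple_refl i \<circ> w))"
      using less.hyps[OF _ s] card_inversions_descent[OF less.prems i] by auto
    then show ?thesis using i card_inversions_descent[OF less.prems i]
      by (intro exI[of _ "js @ [i]"]) (simp add: is_word_snoc)
  qed
qed

lemma perm_length_eq: 
  assumes "w \<in> sym_grp n"
  shows "perm_length n w = card (inversions n w)"
  unfolding perm_length_def
  by (rule Least_equality) (use ex_reduced_word[OF assms] card_inversions_le_length in blast)+

definition reduced :: "nat \<Rightarrow> permutation \<Rightarrow> nat list \<Rightarrow> bool" where
  "reduced n w js \<longleftrightarrow> is_word n w js \<and> length js = card (inversions n w)"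

lemma reduced_reduced_word:
  assumes "w \<in> sym_grp n"
  shows "reduced n w (reduced_word n w)"
  using someI_ex[of "\<lambda>js. is_word n w js \<and> length js = perm_length n w"] ex_reduced_word[OF assms]
  unfolding reduced_def reduced_word_def perm_length_eq[OF assms] by blast

lemma reduced_snoc:
  "reduced n w (js @ [i]) \<longleftrightarrow> 1 \<le> i \<and> i < n \<and> w \<in> sym_grp n \<and> descent w i \<and> reduced n (simple_refl i \<circ> w) js"
proof
  assume r: "reduced n w (js @ [i])"
  then have i: "1 \<le> i" "i < n" and js: "is_word n (simple_refl i \<circ> w) js" 
    by (auto simp: reduced_def is_word_snoc)
  have w: "w \<in> sym_grp n" using r is_word_sym_grp unfolding reduced_def by blast
  have len: "Suc (length js) = card (inversions n w)" using r by (simp add: reduced_def)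
  have d: "descent w i"
  proof (rule ccontr)
    assume "\<not> descent w i"
    then show False
      using card_inversions_ascent[OF w i] card_inversions_le_length[OF js] len by simp
  qed
  then show "1 \<le> i \<and> i < n \<and> w \<in> sym_grp n \<and> descent w i \<and> reduced n (simple_refl i \<circ> w) js"
    using i w js len card_inversions_descent[OF w i] by (simp add: reduced_def)
next
  assume "1 \<le> i \<and> i < n \<and> w \<in> sym_grp n \<and> descent w i \<and> reduced n (simple_refl i \<circ> w) js"
  then show "reduced n w (js @ [i])"
    using card_inversions_descent[of w n i] by (auto simp: reduced_def is_word_snoc)
qed

lemma reduced_Nil: "reduced n w [] \<longleftrightarrow> w = id"
proof -
  have "inversions n id = {}" by (auto simp: inversions_def)
  then show ?thesis unfolding reduced_def is_word_Nil by auto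
qed

section \<open>The right regular representation\<close>

text \<open>
  The coefficient at \<open>v\<close> receives contributions from \<open>T\<^sub>v\<close> and from its partner
  \<open>s\<^sub>i \<circ> v\<close> only, and exactly one of the two has a descent at \<open>i\<close>.
\<close>

lemma hecke_mult_simple_apply:
  fixes f :: "'a::field hecke"
  assumes i: "1 \<le> i" "i < n"
  shows "hecke_mult_simple n q f i v =
    (if v \<in> sym_grp n then
       if descent v i then f (simple_refl i \<circ> v) + (q - 1) * f v else q * f (simple_refl i \<circ> v)
     else 0)"
proof -
  let ?s = "simple_refl i"
  have sv: "?s \<circ> v \<in> sym_grp n \<longleftrightarrow> v \<in> sym_grp n" for v
    using comp_sym_grp[OF simple_refl_sym_grp[OF i], of v] comp_sym_grp[OF simple_refl_sym_grp[OF i], of "?s \<circ> v"] by auto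
  have eq: "w = ?s \<circ> v \<longleftrightarrow> v = ?s \<circ> w" for w by auto
  have T: "T_mult_simple n q w i v = (if v = ?s \<circ> w then if descent w i then q else 1 else 0)
      + (if v = w then if descent w i then q - 1 else 0 else 0)" if w: "w \<in> sym_grp n" for w
  proof -
    have s: "?s \<circ> w \<in> sym_grp n" using sv w by blast
    have "perm_length n (?s \<circ> w) = perm_length n w + 1 \<longleftrightarrow> \<not> descent w i"
      using card_inversions_ascent[OF w i] card_inversions_descent[OF w i]
      by (auto simp: perm_length_eq[OF w] perm_length_eq[OF s])
    then show ?thesis
      by (simp add: T_mult_simple_def Let_def right_mult_simple_def hecke_T_def)
  qed
  have "hecke_mult_simple n q f i v = (\<Sum>w\<in>sym_grp n. (if w = ?s \<circ> v then f w * (if descent w i then q else 1) else 0)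
      + (if w = v then f w * (if descent w i then q - 1 else 0) else 0))"
    unfolding hecke_mult_simple_def
  proof (intro sum.cong refl)
    fix w assume w: "w \<in> sym_grp n"
    show "f w * T_mult_simple n q w i v = (if w = ?s \<circ> v then f w * (if descent w i then q else 1) else 0)
      + (if w = v then f w * (if descent w i then q - 1 else 0) else 0)"
      unfolding T[OF w] eq[of w] eq_commute[of w v] by (simp add: distrib_left)
  qed
  also have "\<dots> = (if v \<in> sym_grp n then f (?s \<circ> v) * (if descent (?s \<circ> v) i then q else 1)
      + f v * (if descent v i then q - 1 else 0) else 0)"
    unfolding sum.distrib by (simp add: sv)
  finally show ?thesis using descent_simple_refl_comp[of v n i] by (auto simp: mult.commute)
qed

definition hecke_mult_word :: "nat \<Rightarrow> 'a::field \<Rightarrow> 'a hecke \<Rightarrow> nat list \<Rightarrow> 'a hecke" where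
  "hecke_mult_word n q f js = foldl (hecke_mult_simple n q) f js"

lemma hecke_mult_word_Nil [simp]: "hecke_mult_word n q f [] = f"
  by (simp add: hecke_mult_word_def)

lemma hecke_mult_word_snoc [simp]:
  "hecke_mult_word n q f (js @ [i]) = hecke_mult_simple n q (hecke_mult_word n q f js) i"
  by (simp add: hecke_mult_word_def)

lemma hecke_mult_simple_sum:
  "hecke_mult_simple n q (\<lambda>v. \<Sum>u\<in>U. c u * G u v) i = (\<lambda>v. \<Sum>u\<in>U. c u * hecke_mult_simple n q (G u) i v)"
  unfolding hecke_mult_simple_def sum_distrib_left sum_distrib_right
  by (subst sum.swap) (simp add: mult.assoc)

lemma hecke_mult_word_sum:
  "hecke_mult_word n q (\<lambda>v. \<Sum>u\<in>U. c u * G u v) js = (\<lambda>v. \<Sum>u\<in>U. c u * hecke_mult_word n q (G u) js v)"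
  by (induction js rule: rev_induct) (auto simp: hecke_mult_simple_sum)

lemma hecke_T_in_carrier: "w \<in> sym_grp n \<Longrightarrow> hecke_T w \<in> hecke_carrier n"
  by (auto simp: hecke_carrier_def hecke_T_def)

lemma hecke_mult_simple_carrier:
  "1 \<le> i \<Longrightarrow> i < n \<Longrightarrow> hecke_mult_simple n q f i \<in> hecke_carrier n"
  by (simp add: hecke_carrier_def hecke_mult_simple_apply)

lemma hecke_mult_word_carrier:
  "f \<in> hecke_carrier n \<Longrightarrow> set js \<subseteq> {1..<n} \<Longrightarrow> hecke_mult_word n q f js \<in> hecke_carrier n"
  by (induction js rule: rev_induct) (auto intro: hecke_mult_simple_carrier)

lemma hecke_carrier_expand:
  "f \<in> hecke_carrier n \<Longrightarrow> f = (\<lambda>v. \<Sum>u\<in>sym_grp n. f u * hecke_T u v)"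
proof
  fix v assume f: "f \<in> hecke_carrier n"
  have "(\<Sum>u\<in>sym_grp n. f u * hecke_T u v) = (\<Sum>u\<in>sym_grp n. if u = v then f u else 0)"
    by (intro sum.cong) (auto simp: hecke_T_def)
  also have "\<dots> = f v" using f by (auto simp: hecke_carrier_def)
  finally show "f v = (\<Sum>u\<in>sym_grp n. f u * hecke_T u v)" by simp
qed

lemma hecke_mult_simple_T:
  assumes w: "w \<in> sym_grp n" and i: "1 \<le> i" "i < n"
  shows "hecke_mult_simple n q (hecke_T w) i =
    (if descent w i then (\<lambda>v. q * hecke_T (simple_refl i \<circ> w) v + (q - 1) * hecke_T w v)
     else hecke_T (simple_refl i \<circ> w))"
proof
  fix v
  have s: "simple_refl i \<circ> w \<in> sym_grp n" using i w by (simp only: simple_refl_comp_sym_grp)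
  have eq: "simple_refl i \<circ> v = w \<longleftrightarrow> v = simple_refl i \<circ> w" by auto
  show "hecke_mult_simple n q (hecke_T w) i v =
    (if descent w i then (\<lambda>v. q * hecke_T (simple_refl i \<circ> w) v + (q - 1) * hecke_T w v)
     else hecke_T (simple_refl i \<circ> w)) v"
    using w s descent_simple_refl_comp[OF w, of i] 
    by (auto simp: hecke_mult_simple_apply[OF i] hecke_T_def eq)
qed

lemma hecke_mult_word_one:
  "reduced n w js \<Longrightarrow> hecke_mult_word n q (hecke_T id) js = hecke_T w"
proof (induction js arbitrary: w rule: rev_induct)
  case (snoc i js)
  then have i: "1 \<le> i" "i < n" and w: "w \<in> sym_grp n" "descent w i"
    and r: "reduced n (simple_refl i \<circ> w) js" by (auto simp: reduced_snoc)
  have s: "simple_refl i \<circ> w \<in> sym_grp n" using i w by (simp only: simple_refl_comp_sym_grp)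
  show ?case unfolding hecke_mult_word_snoc snoc.IH[OF r] hecke_mult_simple_T[OF s i]
    using descent_simple_refl_comp[OF w(1)] w(2) by simp
qed (simp add: reduced_Nil)

section \<open>The left regular representation and Matsumoto's theorem\<close>

definition hecke_flip :: "nat \<Rightarrow> 'a::field hecke \<Rightarrow> 'a hecke" where
  "hecke_flip n f = (\<lambda>v. if v \<in> sym_grp n then f (inv v) else 0)"

text \<open>
  Left multiplication by \<open>T\<^sub>j\<close>, obtained by conjugating right multiplication with the
  anti-automorphism that inverts the index of the basis elements.
\<close>

definition hecke_left_mult_simple :: "nat \<Rightarrow> 'a::field \<Rightarrow> 'a hecke \<Rightarrow> nat \<Rightarrow> 'a hecke" where
  "hecke_left_mult_simple n q f j = hecke_flip n (hecke_mult_simple n q (hecke_flip n f) j)"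

lemma hecke_flip_flip: "f \<in> hecke_carrier n \<Longrightarrow> hecke_flip n (hecke_flip n f) = f"
  by (auto simp: hecke_flip_def hecke_carrier_def fun_eq_iff inv_sym_grp inv_inv_sym_grp)

lemma hecke_left_mult_simple_apply:
  assumes j: "1 \<le> j" "j < n"
  shows "hecke_left_mult_simple n q f j v =
    (if v \<in> sym_grp n then
       if v (Suc j) < v j then f (v \<circ> simple_refl j) + (q - 1) * f v else q * f (v \<circ> simple_refl j)
     else 0)"
proof (cases "v \<in> sym_grp n")
  case True
  then have s: "simple_refl j \<circ> inv v \<in> sym_grp n" "v \<circ> simple_refl j \<in> sym_grp n"
    using j by (auto simp: comp_sym_grp simple_refl_sym_grp inv_sym_grp)
  have i: "inv (simple_refl j \<circ> inv v) = v \<circ> simple_refl j"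
    using True by (simp add: inv_simple_refl_comp[OF inv_sym_grp] inv_inv_sym_grp)
  show ?thesis using True s
    by (simp add: hecke_left_mult_simple_def hecke_flip_def hecke_mult_simple_apply[OF j] 
        inv_sym_grp inv_inv_sym_grp descent_def i)
qed (simp add: hecke_left_mult_simple_def hecke_flip_def)

text \<open>
  Away from the case \<open>s\<^sub>i \<circ> v = v \<circ> s\<^sub>j\<close>, multiplying on one side does not change
  the descent on the other side. In that case both descents agree at \<open>v\<close> and flip together.
\<close>

lemma hecke_left_right_commute:
  fixes f :: "'a::field hecke"
  assumes i: "1 \<le> i" "i < n" and j: "1 \<le> j" "j < n"
  shows "hecke_mult_simple n q (hecke_left_mult_simple n q f j) i
       = hecke_left_mult_simple n q (hecke_mult_simple n q f i) j"
proof
  fix v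
  let ?s = "simple_refl i" and ?t = "simple_refl j"
  show "hecke_mult_simple n q (hecke_left_mult_simple n q f j) i v
       = hecke_left_mult_simple n q (hecke_mult_simple n q f i) j v"
  proof (cases "v \<in> sym_grp n")
    case False
    then show ?thesis by (simp add: hecke_mult_simple_apply[OF i] hecke_left_mult_simple_apply[OF j])
  next
    case v: True
    have sv: "?s \<circ> v \<in> sym_grp n" and vt: "v \<circ> ?t \<in> sym_grp n"
      using v i j by (auto simp: comp_sym_grp simple_refl_sym_grp)
    show ?thesis
    proof (cases "?s \<circ> v = v \<circ> ?t")
      case True
      have st: "?s \<circ> (v \<circ> ?t) = v" using True by (metis comp_simple_refl_left_twice)
      have ts: "(?s \<circ> v) \<circ> ?t = v" using True by simp
      have pts: "?s (v k) = v (?t k)" for k using fun_cong[OF True, of k] by simp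
      \<comment> \<open>The reflection \<open>s\<^sub>i\<close> moves \<open>v j\<close>.\<close>
      have "{v j, v (Suc j)} = {i, Suc i}"
      proof -
        have "v j \<noteq> v (Suc j)" using sym_grp_eq_iff[OF v] by simp
        then have "?s (v j) \<noteq> v j" using pts[of j] by simp
        then have "v j = i \<or> v j = Suc i" by (metis simple_refl_simps(3))
        then show ?thesis
        proof
          assume h: "v j = i"
          then have "v (Suc j) = Suc i" using pts[of j] by simp
          then show ?thesis by (simp only: h)
        next
          assume h: "v j = Suc i"
          then have "v (Suc j) = i" using pts[of j] by simp
          then show ?thesis using h by (simp only: insert_commute)
        qed
      qed
      then have "v j = i \<and> v (Suc j) = Suc i \<or> v j = Suc i \<and> v (Suc j) = i"
        by (auto simp: doubleton_eq_iff)
      then have "descent v i \<longleftrightarrow> v (Suc j) < v j"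
        unfolding descent_def using sym_grp_inv_eq_iff[OF v] by (metis lessI not_less_iff_gr_or_eq)
      moreover have "descent (v \<circ> ?t) i \<longleftrightarrow> \<not> descent v i"
        using descent_simple_refl_comp[OF v] True by metis
      moreover have "(?s \<circ> v) (Suc j) < (?s \<circ> v) j \<longleftrightarrow> \<not> v (Suc j) < v j"
        using True sym_grp_eq_iff[OF v, of j "Suc j"] by auto
      ultimately show ?thesis
        using v sv vt True st ts
        by (simp add: hecke_mult_simple_apply[OF i] hecke_left_mult_simple_apply[OF j] algebra_simps)
    next
      case False
      have stuv: "\<not> (v j = i \<and> v (Suc j) = Suc i)" "\<not> (v j = Suc i \<and> v (Suc j) = i)"
      proof -
        have *: False if h: "{v j, v (Suc j)} = {i, Suc i}"
        proof -
          have "(?s \<circ> v) k = (v \<circ> ?t) k" for k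
          proof (cases "k = j \<or> k = Suc j")
            case True
            then show ?thesis using h by (auto simp: doubleton_eq_iff)
          next
            case k: False
            then have "v k \<noteq> v j" "v k \<noteq> v (Suc j)" using sym_grp_eq_iff[OF v] by auto
            then have "v k \<noteq> i" "v k \<noteq> Suc i" using h by (auto simp: doubleton_eq_iff)
            then show ?thesis using k by simp
          qed
          then show False using False by blast
        qed
        show "\<not> (v j = i \<and> v (Suc j) = Suc i)" "\<not> (v j = Suc i \<and> v (Suc j) = i)"
          using * by (auto simp: insert_commute)
      qed
      have 1: "(?s \<circ> v) (Suc j) < (?s \<circ> v) j \<longleftrightarrow> v (Suc j) < v j"
        using simple_refl_less_iff[of "v (Suc j)" i "v j"] stuv by auto
      have ninv: "\<not> (inv v (Suc i) = j \<and> inv v i = Suc j)" "\<not> (inv v (Suc i) = Suc j \<and> inv v i = j)"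
        using stuv sym_grp_inv_eq_iff[OF v] by metis+
      have 2: "descent (v \<circ> ?t) i \<longleftrightarrow> descent v i"
        using simple_refl_less_iff[OF ninv] by (simp add: descent_def inv_comp_simple_refl[OF v])
      have assoc: "(?s \<circ> v) \<circ> ?t = ?s \<circ> (v \<circ> ?t)" by (simp add: comp_assoc)
      show ?thesis
        using v sv vt 1 2
        by (simp add: hecke_mult_simple_apply[OF i] hecke_left_mult_simple_apply[OF j] assoc algebra_simps)
    qed
  qed
qed

lemma hecke_word_left_commute:
  assumes "set js \<subseteq> {1..<n}" "1 \<le> j" "j < n"
  shows "hecke_mult_word n q (hecke_left_mult_simple n q f j) js
       = hecke_left_mult_simple n q (hecke_mult_word n q f js) j"
  using assms by (induction js rule: rev_induct) (auto simp: hecke_left_right_commute)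

lemma hecke_words_commute:
  assumes "set js \<subseteq> {1..<n}" "set ks \<subseteq> {1..<n}"
  shows "hecke_mult_word n q (foldl (hecke_left_mult_simple n q) f ks) js
       = foldl (hecke_left_mult_simple n q) (hecke_mult_word n q f js) ks"
  using assms by (induction ks rule: rev_induct) (auto simp: hecke_word_left_commute)

lemma hecke_flip_T: "w \<in> sym_grp n \<Longrightarrow> hecke_flip n (hecke_T w) = hecke_T (inv w)"
proof
  fix v assume w: "w \<in> sym_grp n"
  have "inv v = w \<longleftrightarrow> v = inv w" if "v \<in> sym_grp n" using that w by (metis inv_inv_sym_grp)
  moreover have "v \<noteq> inv w" if "v \<notin> sym_grp n" using that inv_sym_grp[OF w] by blast
  ultimately show "hecke_flip n (hecke_T w) v = hecke_T (inv w) v"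
    unfolding hecke_flip_def hecke_T_def by (cases "v \<in> sym_grp n") simp_all
qed

lemma ex_left_word:
  fixes q :: "'a::field"
  assumes w: "w \<in> sym_grp n"
  obtains ks where "set ks \<subseteq> {1..<n}" "foldl (hecke_left_mult_simple n q) (hecke_T id) ks = hecke_T w"
proof -
  let ?ks = "reduced_word n (inv w)"
  have r: "reduced n (inv w) ?ks" by (rule reduced_reduced_word[OF inv_sym_grp[OF w]])
  then have ks: "set ?ks \<subseteq> {1..<n}" by (simp add: reduced_def is_word_def)
  have "foldl (hecke_left_mult_simple n q) (hecke_T id) js = hecke_flip n (hecke_mult_word n q (hecke_T id) js)"
    if "set js \<subseteq> {1..<n}" for js
    using that
  proof (induction js rule: rev_induct)
    case Nil
    show ?case by (simp only: foldl.simps hecke_mult_word_Nil hecke_flip_T[OF id_sym_grp] inv_id)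
  next
    case (snoc j js)
    have c: "hecke_mult_word n q (hecke_T id) js \<in> hecke_carrier n"
      using snoc.prems by (intro hecke_mult_word_carrier hecke_T_in_carrier) auto
    have IH: "foldl (hecke_left_mult_simple n q) (hecke_T id) js = hecke_flip n (hecke_mult_word n q (hecke_T id) js)"
      by (rule snoc.IH) (use snoc.prems in auto)
    have step: "hecke_left_mult_simple n q (hecke_flip n f) j = hecke_flip n (hecke_mult_simple n q f j)"
      if "f \<in> hecke_carrier n" for f :: "'a hecke"
      by (simp only: hecke_left_mult_simple_def hecke_flip_flip[OF that])
    show ?case
      by (simp only: foldl_append foldl.simps IH step[OF c] hecke_mult_word_snoc)
  qed
  from this[OF ks] have "foldl (hecke_left_mult_simple n q) (hecke_T id) ?ks = hecke_T w"
    by (simp only: hecke_mult_word_one[OF r] hecke_flip_T[OF inv_sym_grp[OF w]] inv_inv_sym_grp[OF w])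
  then show ?thesis using ks that by blast
qed

text \<open>
  Any two reduced words of \<open>w\<close> give the same operator on the identity element, namely
  \<open>T\<^sub>w\<close>. Every \<open>T\<^sub>u\<close> arises from the identity by left multiplications, which
  commute with the right ones, so the operators agree everywhere.
\<close>

lemma hecke_mult_word_reduced_unique:
  fixes f :: "'a::field hecke"
  assumes js: "reduced n w js" and js': "reduced n w js'" and f: "f \<in> hecke_carrier n"
  shows "hecke_mult_word n q f js = hecke_mult_word n q f js'"
proof -
  have set: "set js \<subseteq> {1..<n}" "set js' \<subseteq> {1..<n}" using js js' by (auto simp: reduced_def is_word_def)
  have T: "hecke_mult_word n q (hecke_T u) js = hecke_mult_word n q (hecke_T u) js'" if u: "u \<in> sym_grp n" for u
  proof -
    obtain ks where ks: "set ks \<subseteq> {1..<n}" "foldl (hecke_left_mult_simple n q) (hecke_T id) ks = hecke_T u"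
      using ex_left_word[OF u] .
    show ?thesis
      unfolding ks(2)[symmetric] hecke_words_commute[OF set(1) ks(1)] hecke_words_commute[OF set(2) ks(1)]
        hecke_mult_word_one[OF js] hecke_mult_word_one[OF js'] ..
  qed
  have "hecke_mult_word n q (\<lambda>v. \<Sum>u\<in>sym_grp n. f u * hecke_T u v) js
      = hecke_mult_word n q (\<lambda>v. \<Sum>u\<in>sym_grp n. f u * hecke_T u v) js'"
    unfolding hecke_mult_word_sum by (simp add: T cong: sum.cong)
  then show ?thesis using hecke_carrier_expand[OF f] by simp
qed

section \<open>Multiplication in the Hecke algebra\<close>

lemma hecke_mult_eq:
  "hecke_mult n q f g = (\<lambda>v. \<Sum>w\<in>sym_grp n. g w * hecke_mult_word n q f (reduced_word n w) v)"
  by (simp add: hecke_mult_def hecke_mult_word_def)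

lemma hecke_mult_T:
  "w \<in> sym_grp n \<Longrightarrow> hecke_mult n q f (hecke_T w) = hecke_mult_word n q f (reduced_word n w)"
proof
  fix v assume w: "w \<in> sym_grp n"
  have "hecke_mult n q f (hecke_T w) v
      = (\<Sum>u\<in>sym_grp n. if u = w then hecke_mult_word n q f (reduced_word n u) v else 0)"
    unfolding hecke_mult_eq by (intro sum.cong) (auto simp: hecke_T_def)
  then show "hecke_mult n q f (hecke_T w) v = hecke_mult_word n q f (reduced_word n w) v" using w by simp
qed

lemma hecke_mult_T_id [simp]: "hecke_mult n q f (hecke_T id) = f"
proof -
  have "reduced n id (reduced_word n id)" by (simp add: reduced_reduced_word)
  then have "length (reduced_word n id) = card (inversions n id)" by (simp add: reduced_def)
  also have "inversions n id = {}" by (auto simp: inversions_def)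
  finally have "reduced_word n id = []" unfolding card.empty length_0_conv .
  then show ?thesis by (simp only: hecke_mult_T[OF id_sym_grp] hecke_mult_word_Nil)
qed

lemma hecke_mult_T_simple:
  assumes "1 \<le> i" "i < n"
  shows "hecke_mult n q f (hecke_T (simple_refl i)) = hecke_mult_simple n q f i"
proof -
  have s: "simple_refl i \<in> sym_grp n" using simple_refl_sym_grp[OF assms] .
  have "inversions n (simple_refl i) = {(i, Suc i)}"
  proof -
    have asc: "\<not> descent id i" by (simp add: descent_def)
    have "inversions n id = {}" by (auto simp: inversions_def)
    then show ?thesis
      using inversions_ascent(1)[OF id_sym_grp assms asc] by (simp only: comp_id inv_id id_apply)
  qed
  then have "length (reduced_word n (simple_refl i)) = 1" and
    w: "is_word n (simple_refl i) (reduced_word n (simple_refl i))"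
    using reduced_reduced_word[OF s] by (auto simp: reduced_def)
  then obtain k where k: "reduced_word n (simple_refl i) = [k]" by (auto simp: length_Suc_conv)
  have "simple_refl k = simple_refl i" using w by (simp add: k is_word_def right_mult_simple_def)
  from fun_cong[OF this, of i] fun_cong[OF this, of "Suc i"] have "k = i"
    by (cases "i = k"; cases "i = Suc k") auto
  then show ?thesis using hecke_mult_word_snoc[of n q f "[]" i] by (simp add: hecke_mult_T[OF s] k)
qed

lemma hecke_mult_carrier: "f \<in> hecke_carrier n \<Longrightarrow> hecke_mult n q f g \<in> hecke_carrier n"
proof -
  assume f: "f \<in> hecke_carrier n"
  have "hecke_mult_word n q f (reduced_word n w) v = 0" if "w \<in> sym_grp n" "v \<notin> sym_grp n" for w v
    using hecke_mult_word_carrier[OF f, of "reduced_word n w" q] reduced_reduced_word[OF that(1)] that(2)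
    by (auto simp: reduced_def is_word_def hecke_carrier_def)
  then show ?thesis by (simp add: hecke_carrier_def hecke_mult_eq)
qed

lemma hecke_mult_sum:
  "hecke_mult n q f (\<lambda>v. \<Sum>u\<in>U. c u * G u v) = (\<lambda>v. \<Sum>u\<in>U. c u * hecke_mult n q f (G u) v)"
  unfolding hecke_mult_eq sum_distrib_left sum_distrib_right
  by (subst sum.swap) (simp add: mult.assoc)

lemma hecke_mult_lincomb:
  "hecke_mult n q f (\<lambda>v. x * g v + y * h v) = (\<lambda>v. x * hecke_mult n q f g v + y * hecke_mult n q f h v)"
  unfolding hecke_mult_eq by (simp add: sum.distrib sum_distrib_left distrib_right mult.assoc)

lemma hecke_mult_simple_lincomb:
  "hecke_mult_simple n q (\<lambda>v. x * f v + y * g v) i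
   = (\<lambda>v. x * hecke_mult_simple n q f i v + y * hecke_mult_simple n q g i v)"
  unfolding hecke_mult_simple_def by (simp add: sum.distrib sum_distrib_left distrib_right mult.assoc)

lemma hecke_mult_T_step:
  fixes f :: "'a::field hecke"
  assumes f: "f \<in> hecke_carrier n" and w: "w \<in> sym_grp n" and i: "1 \<le> i" "i < n" and asc: "\<not> descent w i"
  shows "hecke_mult_simple n q (hecke_mult n q f (hecke_T w)) i = hecke_mult n q f (hecke_T (simple_refl i \<circ> w))"
proof -
  have s: "simple_refl i \<circ> w \<in> sym_grp n" using i w by (simp only: simple_refl_comp_sym_grp)
  have "reduced n (simple_refl i \<circ> w) (reduced_word n w @ [i])"
    using reduced_reduced_word[OF w] s asc i w by (simp add: reduced_snoc descent_simple_refl_comp)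
  from hecke_mult_word_reduced_unique[OF this reduced_reduced_word[OF s] f, of q]
  show ?thesis unfolding hecke_mult_T[OF s] hecke_mult_T[OF w] hecke_mult_word_snoc .
qed

lemma hecke_mult_simple_quadratic:
  assumes i: "1 \<le> i" "i < n" and f: "f \<in> hecke_carrier n"
  shows "hecke_mult_simple n q (hecke_mult_simple n q f i) i
       = (\<lambda>v. q * f v + (q - 1) * hecke_mult_simple n q f i v)"
proof
  fix v
  have s: "simple_refl i \<circ> v \<in> sym_grp n" if "v \<in> sym_grp n" using i that by (simp add: comp_sym_grp simple_refl_sym_grp)
  show "hecke_mult_simple n q (hecke_mult_simple n q f i) i v = q * f v + (q - 1) * hecke_mult_simple n q f i v"
    using f s descent_simple_refl_comp[of v n i]
    by (auto simp: hecke_mult_simple_apply[OF i] algebra_simps hecke_carrier_def)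
qed

text \<open>
  For basis elements this combines the independence of the reduced word with the quadratic
  relation.
\<close>

lemma hecke_mult_assoc_simple:
  fixes f :: "'a::field hecke"
  assumes f: "f \<in> hecke_carrier n" and h: "h \<in> hecke_carrier n" and i: "1 \<le> i" "i < n"
  shows "hecke_mult_simple n q (hecke_mult n q f h) i = hecke_mult n q f (hecke_mult_simple n q h i)"
proof -
  have T: "hecke_mult_simple n q (hecke_mult n q f (hecke_T w)) i
      = hecke_mult n q f (hecke_mult_simple n q (hecke_T w) i)" if w: "w \<in> sym_grp n" for w
  proof (cases "descent w i")
    case False
    then show ?thesis using hecke_mult_T_step[OF f w i] by (simp add: hecke_mult_simple_T[OF w i])
  next
    case True
    let ?u = "simple_refl i \<circ> w"
    have u: "?u \<in> sym_grp n" using i w by (simp only: simple_refl_comp_sym_grp)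
    have "hecke_mult_simple n q (hecke_mult n q f (hecke_T ?u)) i = hecke_mult n q f (hecke_T w)"
      using hecke_mult_T_step[OF f u i] True by (simp add: descent_simple_refl_comp[OF w])
    then have "hecke_mult_simple n q (hecke_mult n q f (hecke_T w)) i
        = (\<lambda>v. q * hecke_mult n q f (hecke_T ?u) v + (q - 1) * hecke_mult n q f (hecke_T w) v)"
      using hecke_mult_simple_quadratic[OF i hecke_mult_carrier[OF f, of q "hecke_T ?u"], of q] by simp
    then show ?thesis using True by (simp add: hecke_mult_simple_T[OF w i] hecke_mult_lincomb)
  qed
  have "hecke_mult_simple n q (hecke_mult n q f (\<lambda>v. \<Sum>u\<in>sym_grp n. h u * hecke_T u v)) i
      = hecke_mult n q f (hecke_mult_simple n q (\<lambda>v. \<Sum>u\<in>sym_grp n. h u * hecke_T u v) i)"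
    unfolding hecke_mult_sum hecke_mult_simple_sum by (simp add: T cong: sum.cong)
  then show ?thesis using hecke_carrier_expand[OF h] by simp
qed

section \<open>Permutation modules as spaces of functions on words\<close>

text \<open>
  For \<open>a\<close> the row word of a composition \<open>\<mu>\<close>, this identifies the functions on the words of
  content \<open>\<mu>\<close> with \<open>x\<^sub>\<mu> H\<close>.
\<close>

definition lift :: "nat \<Rightarrow> (nat \<Rightarrow> nat) \<Rightarrow> ((nat \<Rightarrow> nat) \<Rightarrow> 'a::field) \<Rightarrow> 'a hecke" where
  "lift n a F = (\<lambda>v. if v \<in> sym_grp n then F (a \<circ> inv v) else 0)"

definition single :: "(nat \<Rightarrow> nat) \<Rightarrow> ((nat \<Rightarrow> nat) \<Rightarrow> 'a::field)" where
  "single a = (\<lambda>c. if c = a then 1 else 0)"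

lemma lift_carrier: "lift n a F \<in> hecke_carrier n"
  by (simp add: lift_def hecke_carrier_def)

text \<open>
  Because \<open>a\<close> is weakly increasing, different letters in positions \<open>i\<close> and
  \<open>i + 1\<close> are in the order of their preimages under \<open>v\<close>. For equal letters the descent of
  \<open>v\<close> is immaterial.
\<close>

lemma hecke_mult_simple_lift:
  assumes i: "1 \<le> i" "i < n" and mono: "\<And>x y. 1 \<le> x \<Longrightarrow> x \<le> y \<Longrightarrow> y \<le> n \<Longrightarrow> a x \<le> a y"
  shows "hecke_mult_simple n q (lift n a F) i = lift n a (act q F i)"
proof
  fix v
  show "hecke_mult_simple n q (lift n a F) i v = lift n a (act q F i) v"
  proof (cases "v \<in> sym_grp n")
    case False
    then show ?thesis by (simp add: lift_def hecke_mult_simple_apply[OF i])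
  next
    case v: True
    let ?c = "a \<circ> inv v"
    have s: "simple_refl i \<circ> v \<in> sym_grp n" using i v by (simp add: comp_sym_grp simple_refl_sym_grp)
    have c: "a \<circ> inv (simple_refl i \<circ> v) = ?c \<circ> simple_refl i"
      by (simp add: inv_simple_refl_comp[OF v] comp_assoc)
    have range: "1 \<le> inv v i" "inv v i \<le> n" "1 \<le> inv v (Suc i)" "inv v (Suc i) \<le> n"
      using sym_grp_range[OF inv_sym_grp[OF v]] i by auto
    have lhs: "hecke_mult_simple n q (lift n a F) i v =
        (if descent v i then F (?c \<circ> simple_refl i) + (q - 1) * F ?c else q * F (?c \<circ> simple_refl i))"
      using v s by (simp add: hecke_mult_simple_apply[OF i] lift_def c)
    consider "?c (Suc i) < ?c i" | "?c i < ?c (Suc i)" | "?c i = ?c (Suc i)" by linarith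
    then show ?thesis
    proof cases
      case 1
      then have "descent v i" using mono[of "inv v i" "inv v (Suc i)"] range by (force simp: descent_def)
      then show ?thesis using v 1 unfolding lhs by (simp add: lift_def act_def)
    next
      case 2
      then have "\<not> descent v i" using mono[of "inv v (Suc i)" "inv v i"] range by (force simp: descent_def)
      then show ?thesis using v 2 unfolding lhs by (simp add: lift_def act_def)
    next
      case 3
      then have "?c \<circ> simple_refl i = ?c" by (auto simp: fun_eq_iff simple_refl_def transpose_def)
      then show ?thesis using v 3 unfolding lhs by (simp add: lift_def act_def algebra_simps)
    qed
  qed
qed

lemma hecke_mult_word_lift:
  assumes "set js \<subseteq> {1..<n}" and "\<And>x y. 1 \<le> x \<Longrightarrow> x \<le> y \<Longrightarrow> y \<le> n \<Longrightarrow> a x \<le> a y"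
  shows "hecke_mult_word n q (lift n a F) js = lift n a (foldl (act q) F js)"
  using assms(1) by (induction js rule: rev_induct) (auto simp: hecke_mult_simple_lift assms(2))

lemma act_single:
  assumes "a i < a (Suc i)"
  shows "act q (single a) i = single (a \<circ> simple_refl i)"
proof
  fix c
  have eq: "c \<circ> simple_refl i = a \<longleftrightarrow> c = a \<circ> simple_refl i" by auto
  show "act q (single a) i c = single (a \<circ> simple_refl i) c"
    using assms swap_neq[of a i] by (auto simp: act_def single_def eq)
qed

text \<open>
  Along a reduced word the inversion sets increase, so the hypothesis on \<open>w\<close> makes every step an
  ascent of the current word. Then \<open>act\<close> just swaps two letters, and the word becomes smaller in
  the dominance order.
\<close>

lemma act_word_single:
  assumes "reduced n w js" and "\<And>x y. (x, y) \<in> inversions n w \<Longrightarrow> a x < a y"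
  shows "foldl (act q) (single a) js = single (a \<circ> inv w) \<and> dominated n (a \<circ> inv w) a"
  using assms
proof (induction js arbitrary: w rule: rev_induct)
  case Nil
  then show ?case by (simp add: reduced_Nil)
next
  case (snoc i js)
  let ?u = "simple_refl i \<circ> w"
  have i: "1 \<le> i" "i < n" and w: "w \<in> sym_grp n" "descent w i"
    and r: "reduced n ?u js" using snoc.prems(1) by (auto simp: reduced_snoc)
  have u: "?u \<in> sym_grp n" using i w by (simp only: simple_refl_comp_sym_grp)
  have asc: "\<not> descent ?u i" using w by (simp add: descent_simple_refl_comp[OF w(1)])
  have inv: "inversions n w = insert (inv ?u i, inv ?u (Suc i)) (inversions n ?u)"
    using inversions_ascent(1)[OF u i asc] by simp
  have IH: "foldl (act q) (single a) js = single (a \<circ> inv ?u)" "dominated n (a \<circ> inv ?u) a"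
  proof -
    have "\<And>x y. (x, y) \<in> inversions n ?u \<Longrightarrow> a x < a y" using snoc.prems(2) unfolding inv by blast
    from snoc.IH[OF r this] show "foldl (act q) (single a) js = single (a \<circ> inv ?u)" "dominated n (a \<circ> inv ?u) a"
      by blast+
  qed
  have less: "(a \<circ> inv ?u) i < (a \<circ> inv ?u) (Suc i)"
    using snoc.prems(2)[of "inv ?u i" "inv ?u (Suc i)"] unfolding inv comp_apply by blast
  have w_eq: "a \<circ> inv w = a \<circ> inv ?u \<circ> simple_refl i"
    unfolding inv_simple_refl_comp[OF w(1)] by (simp add: fun_eq_iff)
  have "dominated n (a \<circ> inv w) (a \<circ> inv w \<circ> simple_refl i)"
    using less i by (intro dominated_swap(1)) (simp_all add: w_eq)
  also have "a \<circ> inv w \<circ> simple_refl i = a \<circ> inv ?u" unfolding w_eq comp_simple_refl_twice ..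
  finally have "dominated n (a \<circ> inv w) a" using IH(2) dominated_trans by blast
  moreover have "foldl (act q) (single a) (js @ [i]) = single (a \<circ> inv w)"
    by (simp only: foldl_append foldl.simps IH(1) act_single[OF less] w_eq)
  ultimately show ?case by blast
qed

section \<open>Column antisymmetrizers\<close>

lemma card_inversions_inv:
  assumes w: "w \<in> sym_grp n"
  shows "card (inversions n (inv w)) = card (inversions n w)"
proof -
  have ww: "w (inv w x) = x" "inv w (w x) = x" for x
    using sym_grp_inv_eq_iff[OF w] by blast+
  have "bij_betw (\<lambda>(x, y). (w y, w x)) (inversions n w) (inversions n (inv w))"
  proof (rule bij_betw_byWitness[where f' = "\<lambda>(x, y). (inv w y, inv w x)"])
    show "(\<lambda>(x, y). (w y, w x)) ` inversions n w \<subseteq> inversions n (inv w)"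
      using sym_grp_range[OF w] by (auto simp: inversions_def ww)
    show "(\<lambda>(x, y). (inv w y, inv w x)) ` inversions n (inv w) \<subseteq> inversions n w"
      using sym_grp_range[OF inv_sym_grp[OF w]] by (auto simp: inversions_def ww)
  qed (auto simp: ww)
  then show ?thesis by (simp add: bij_betw_same_card)
qed

lemma card_inversions_comp_simple_refl:
  assumes u: "u \<in> sym_grp n" and y: "1 \<le> y" "y < n" and less: "u y < u (Suc y)"
  shows "card (inversions n (u \<circ> simple_refl y)) = Suc (card (inversions n u))"
proof -
  have us: "u \<circ> simple_refl y \<in> sym_grp n" using u y by (simp add: comp_sym_grp simple_refl_sym_grp)
  have "\<not> descent (inv u) y" using less by (simp add: descent_def inv_inv_sym_grp[OF u])
  from card_inversions_ascent[OF inv_sym_grp[OF u] y this]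
  show ?thesis
    using card_inversions_inv[OF us] card_inversions_inv[OF u] unfolding inv_comp_simple_refl[OF u] by linarith
qed

definition young_subgroup :: "nat \<Rightarrow> (nat \<Rightarrow> nat) \<Rightarrow> permutation set" where
  "young_subgroup n col = {u \<in> sym_grp n. \<forall>k\<in>{1..n}. col (u k) = col k}"

text \<open>
  If \<open>a\<close> increases strictly on the fibres of \<open>col\<close> and these are intervals, this is the word
  \<open>a\<close> multiplied by the sum of the \<open>(-q)\<^bsup>-\<ell>(u)\<^esup> T\<^sub>u\<close> over the group
  that preserves the fibres.
\<close>

definition antisymmetrizer ::
  "'a::field \<Rightarrow> nat \<Rightarrow> (nat \<Rightarrow> nat) \<Rightarrow> (nat \<Rightarrow> nat) \<Rightarrow> ((nat \<Rightarrow> nat) \<Rightarrow> 'a)" where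
  "antisymmetrizer q n col a = (\<lambda>c. \<Sum>u\<in>young_subgroup n col.
     (- q) powi (- int (card (inversions n u))) * single (a \<circ> inv u) c)"

lemma weight_image: "inj_on u D \<Longrightarrow> weight q R (u ` D) = (\<Prod>d\<in>D. q ^ card {k' \<in> R. u d < k'})"
  by (simp add: weight_def prod.reindex)

text \<open>
  The letter \<open>r + 1\<close> at a position \<open>x\<close> of \<open>D\<close> becomes \<open>r\<close>, and the
  preceding position \<open>y\<close> of the same column already carries \<open>r\<close>. So \<open>u\<close> and its
  product with the transposition of \<open>x\<close> and \<open>y\<close> contribute together. The signed power of
  \<open>q\<close> changes by \<open>-1/q\<close>. The weight changes by \<open>q\<close>, because the images of
  \<open>x\<close> and \<open>y\<close> are neighbours among the positions of \<open>r\<close>: a position between them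
  lies in the same column, which has no third letter \<open>r\<close>.
\<close>

lemma signed_sum_vanishes:
  fixes q :: "'a::field"
  assumes q: "q \<noteq> 0" and mono: "\<And>k k'. 1 \<le> k \<Longrightarrow> k \<le> k' \<Longrightarrow> k' \<le> n \<Longrightarrow> col k \<le> col k'"
    and step: "\<And>x r. 1 \<le> x \<Longrightarrow> x \<le> n \<Longrightarrow> 1 \<le> r \<Longrightarrow> a x = Suc r \<Longrightarrow>
        \<exists>y. x = Suc y \<and> 1 \<le> y \<and> a y = r \<and> col y = col x"
    and uniq: "\<And>k k'. k \<in> {1..n} \<Longrightarrow> k' \<in> {1..n} \<Longrightarrow> col k = col k' \<Longrightarrow> a k = a k' \<Longrightarrow> k = k'"
    and r: "1 \<le> r" and D: "D \<subseteq> positions n a (Suc r)" "D \<noteq> {}"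
  shows "(\<Sum>u | u \<in> young_subgroup n col \<and> c \<circ> u = recolour a D r.
      (- q) powi (- int (card (inversions n u))) * weight q (positions n c r) (u ` D)) = 0"
proof -
  obtain x where x: "x \<in> D" using D by blast
  then have xn: "1 \<le> x" "x \<le> n" "a x = Suc r" using D by (auto simp: positions_def)
  obtain y where y: "x = Suc y" "1 \<le> y" "a y = r" "col y = col x"
    using step[OF xn(1,2) r xn(3)] by blast
  have yn: "y < n" using y xn by simp
  let ?s = "simple_refl y"
  let ?b = "recolour a D r"
  define R where "R = positions n c r"
  define U where "U = {u \<in> young_subgroup n col. c \<circ> u = ?b}"
  define g where "g u = (- q) powi (- int (card (inversions n u))) * weight q R (u ` D)" for u
  have Usym: "u \<in> sym_grp n" if "u \<in> U" for u using that by (simp add: U_def young_subgroup_def)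
  have yD: "y \<notin> D" using D y(3) by (auto simp: positions_def)
  have bs: "?b \<circ> ?s = ?b"
  proof
    fix k show "(?b \<circ> ?s) k = ?b k"
      using x y yD by (cases "k = y"; cases "k = Suc y") (auto simp: recolour_def)
  qed
  have U_s: "u \<circ> ?s \<in> U" if u: "u \<in> U" for u
  proof -
    have "u \<circ> ?s \<in> sym_grp n" using Usym[OF u] y yn by (simp add: comp_sym_grp simple_refl_sym_grp)
    moreover have "col ((u \<circ> ?s) k) = col k" if k: "k \<in> {1..n}" for k
    proof -
      have c: "col (u k) = col k" if "k \<in> {1..n}" for k using that u by (auto simp: U_def young_subgroup_def)
      have "?s k \<in> {1..n}" using k simple_refl_in_iff[OF y(2) yn] by blast
      then have "col ((u \<circ> ?s) k) = col (?s k)" using c by simp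
      also have "\<dots> = col k" using y by (cases "k = y"; cases "k = Suc y") auto
      finally show ?thesis .
    qed
    moreover have "c \<circ> (u \<circ> ?s) = ?b"
    proof -
      have "c \<circ> u = ?b" using u by (simp add: U_def)
      then show ?thesis using bs by (metis comp_assoc)
    qed
    ultimately show ?thesis by (simp add: U_def young_subgroup_def)
  qed
  have bij: "bij_betw (\<lambda>u. u \<circ> ?s) U U"
    by (rule bij_betw_byWitness[where f' = "\<lambda>u. u \<circ> ?s"])
      (use U_s in \<open>auto simp: comp_assoc[symmetric] simp del: comp_assoc\<close>)
  have neg: "g (u \<circ> ?s) = - g u" if uU: "u \<in> U" and less: "u y < u x" for u
  proof -
    have us: "u \<in> sym_grp n" by (rule Usym[OF uU])
    have cu: "c (u k) = ?b k" for k using uU by (auto simp: U_def fun_eq_iff)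
    have colu: "col (u k) = col k" if "k \<in> {1..n}" for k using that uU by (auto simp: U_def young_subgroup_def)
    have inR: "u x \<in> R" using sym_grp_range[OF us xn(1,2)] cu[of x] x by (simp add: R_def positions_def recolour_def)
    \<comment> \<open>A position of \<open>r\<close> in between would be a third entry \<open>r\<close> or \<open>r + 1\<close> of the
        column.\<close>
    have between: "\<not> (u y < p \<and> p < u x)" if p: "p \<in> R" for p
    proof
      assume btw: "u y < p \<and> p < u x"
      define k where "k = inv u p"
      have uk: "u k = p" using sym_grp_inv_eq_iff[OF us] by (auto simp: k_def)
      have kn: "k \<in> {1..n}" using p uk sym_grp_in_iff[OF us, of k] by (auto simp: R_def positions_def)
      have range: "1 \<le> u y" "u x \<le> n" using sym_grp_range[OF us] xn y yn by auto
      have "col p = col x"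
        using mono[of "u y" p] mono[of p "u x"] btw range colu[of y] colu[of x] y xn yn by auto
      then have ck: "col k = col x" using colu[OF kn] uk by simp
      have "?b k = r" using cu[of k] uk p by (simp add: R_def positions_def)
      then have "a k = r \<or> a k = Suc r" using D(1) by (auto simp: recolour_def positions_def split: if_splits)
      then have "k = y \<or> k = x"
        using uniq[OF kn, of y] uniq[OF kn, of x] ck y xn yn by auto
      then show False using btw uk by auto
    qed
    have "{p \<in> R. u y < p} = insert (u x) {p \<in> R. u x < p}"
    proof (intro set_eqI)
      fix p show "p \<in> {p \<in> R. u y < p} \<longleftrightarrow> p \<in> insert (u x) {p \<in> R. u x < p}"
        using between[of p] less inR by (cases "p = u x"; cases "p \<in> R") auto
    qed
    then have h: "card {p \<in> R. u y < p} = Suc (card {p \<in> R. u x < p})"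
      by (simp add: R_def)
    have inj: "inj_on v A" if "v \<in> sym_grp n" for v and A :: "nat set"
      using sym_grp_eq_iff[OF that] by (auto simp: inj_on_def)
    have uss: "u \<circ> ?s \<in> sym_grp n" using us y yn by (simp add: comp_sym_grp simple_refl_sym_grp)
    have finD: "finite D" using D finite_subset finite_positions by blast
    have other: "(u \<circ> ?s) d = u d" if "d \<in> D - {x}" for d
    proof -
      have "d \<noteq> y" "d \<noteq> Suc y" using that yD y by auto
      then show ?thesis by simp
    qed
    have at: "(u \<circ> ?s) x = u y" by (simp add: y)
    have "weight q R ((u \<circ> ?s) ` D) = q ^ card {p \<in> R. u y < p} * (\<Prod>d\<in>D - {x}. q ^ card {k' \<in> R. u d < k'})"
      unfolding weight_image[OF inj[OF uss]] prod.remove[OF finD x] at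
      by (intro arg_cong2[where f = "(*)"] prod.cong refl) (simp only: other)
    also have "\<dots> = q * weight q R (u ` D)"
      unfolding weight_image[OF inj[OF us]] prod.remove[OF finD x] h by (simp add: mult.assoc)
    finally have w: "weight q R ((u \<circ> ?s) ` D) = q * weight q R (u ` D)" .
    have len: "card (inversions n (u \<circ> ?s)) = Suc (card (inversions n u))"
      using card_inversions_comp_simple_refl[OF us y(2) yn] less y by simp
    have "(- q) powi (- int (Suc m)) * q = - ((- q) powi (- int m))" for m
    proof -
      have "- int (Suc m) = - int m + (- 1)" by simp
      then have "(- q) powi (- int (Suc m)) = (- q) powi (- int m + (- 1))" by (simp only:)
      also have "\<dots> = (- q) powi (- int m) * (- q) powi (- 1)"
        using q by (intro power_int_add) simp
      finally show ?thesis using q by simp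
    qed
    then show ?thesis unfolding g_def w len by (metis mult.assoc mult_minus_left)
  qed
  \<comment> \<open>Pairing the terms \<open>g u\<close> and \<open>g (u \<circ> ?s)\<close> as a difference of sums avoids a division by
      2.\<close>
  define h where "h u = (if u y < u x then g u else 0)" for u
  have "g u = h u - h (u \<circ> ?s)" if u: "u \<in> U" for u
  proof (cases "u y < u x")
    case True
    then show ?thesis by (simp add: h_def y)
  next
    case False
    then have "u x < u y" using sym_grp_eq_iff[OF Usym[OF u], of x y] y by (metis linorder_neqE_nat n_not_Suc_n)
    then show ?thesis using neg[OF U_s[OF u]] False by (simp add: h_def y)
  qed
  then have "(\<Sum>u\<in>U. g u) = (\<Sum>u\<in>U. h u) - (\<Sum>u\<in>U. h (u \<circ> ?s))"
    by (simp add: sum_subtractf cong: sum.cong)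
  also have "(\<Sum>u\<in>U. h (u \<circ> ?s)) = (\<Sum>u\<in>U. h u)"
    by (rule sum.reindex_bij_betw[OF bij])
  finally have "(\<Sum>u\<in>U. g u) = 0" by simp
  then show ?thesis by (simp only: g_def U_def R_def)
qed

text \<open>
  The defining sum of \<open>\<psi>\<close> runs over pairs of a set \<open>C\<close> and a permutation
  \<open>u\<close>. Passing from \<open>C\<close> to its preimage \<open>D\<close> under \<open>u\<close> makes the set
  independent of the permutation, and the inner sum over \<open>u\<close> vanishes.
\<close>

lemma antisymmetrizer_in_kernel:
  fixes q :: "'a::field"
  assumes q: "q \<noteq> 0" and mono: "\<And>k k'. 1 \<le> k \<Longrightarrow> k \<le> k' \<Longrightarrow> k' \<le> n \<Longrightarrow> col k \<le> col k'"
    and step: "\<And>x r. 1 \<le> x \<Longrightarrow> x \<le> n \<Longrightarrow> 1 \<le> r \<Longrightarrow> a x = Suc r \<Longrightarrow>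
        \<exists>y. x = Suc y \<and> 1 \<le> y \<and> a y = r \<and> col y = col x"
    and uniq: "\<And>k k'. k \<in> {1..n} \<Longrightarrow> k' \<in> {1..n} \<Longrightarrow> col k = col k' \<Longrightarrow> a k = a k' \<Longrightarrow> k = k'"
  shows "antisymmetrizer q n col a \<in> psi_kernel q n"
proof -
  have "psi q n r t (antisymmetrizer q n col a) c = 0" if r: "1 \<le> r" and t: "1 \<le> t" for r t c
  proof -
    let ?R = "positions n c r"
    define Y where "Y = young_subgroup n col"
    define coef where "coef u = (- q) powi (- int (card (inversions n u)))" for u :: permutation
    define S where "S = {C. C \<subseteq> ?R \<and> card C = t}"
    define S' where "S' = {D. D \<subseteq> positions n a (Suc r) \<and> card D = t}"
    have fin: "finite Y" "finite S" "finite S'" unfolding Y_def young_subgroup_def S_def S'_def by simp_all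
    have reindex: "(\<Sum>C\<in>S. if recolour c C (Suc r) = a \<circ> inv u then weight q ?R C else 0)
        = (\<Sum>D\<in>S'. if c \<circ> u = recolour a D r then weight q ?R (u ` D) else 0)" if "u \<in> Y" for u
    proof -
      have u: "u \<in> sym_grp n" using that by (simp add: Y_def young_subgroup_def)
      have uu: "u (inv u k) = k" "inv u (u k) = k" for k using sym_grp_inv_eq_iff[OF u] by blast+
      have inj: "inj_on u A" "inj_on (inv u) A" for A using uu by (metis inj_on_inverseI)+
      have "(\<Sum>C\<in>S. if recolour c C (Suc r) = a \<circ> inv u then weight q ?R C else 0)
          = (\<Sum>C\<in>{C\<in>S. recolour c C (Suc r) = a \<circ> inv u}. weight q ?R C)"
        using fin by (simp add: sum.If_cases Int_def)
      also have "\<dots> = (\<Sum>D\<in>{D\<in>S'. c \<circ> u = recolour a D r}. weight q ?R (u ` D))"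
      proof (rule sum.reindex_bij_witness[of _ "\<lambda>D. u ` D" "\<lambda>C. inv u ` C"])
        have im: "u ` inv u ` C = C" "inv u ` u ` C = C" for C by (simp_all add: image_comp comp_def uu)
        \<comment> \<open>Both sides are compared position by position.\<close>
        have key: "u ` D \<subseteq> ?R \<and> recolour c (u ` D) (Suc r) = a \<circ> inv u \<longleftrightarrow>
          D \<subseteq> positions n a (Suc r) \<and> c \<circ> u = recolour a D r" for D
        proof -
          have eq: "f = g \<longleftrightarrow> (\<forall>k. f (u k) = g (u k))" for f g :: "nat \<Rightarrow> nat"
            using uu by (metis ext)
          have mem: "u k \<in> u ` D \<longleftrightarrow> k \<in> D" for k using uu by (metis imageE imageI)
          have sub: "u ` D \<subseteq> ?R \<longleftrightarrow> (\<forall>k. k \<in> D \<longrightarrow> k \<in> {1..n} \<and> c (u k) = r)"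
            unfolding positions_def image_subset_iff mem_Collect_eq sym_grp_in_iff[OF u] by blast
          have "u ` D \<subseteq> ?R \<and> recolour c (u ` D) (Suc r) = a \<circ> inv u \<longleftrightarrow>
            (\<forall>k. (k \<in> D \<longrightarrow> k \<in> {1..n} \<and> c (u k) = r) \<and> (if k \<in> D then Suc r else c (u k)) = a k)"
            unfolding sub eq[of "recolour c (u ` D) (Suc r)"]
            unfolding recolour_def mem comp_apply uu by blast
          also have "\<dots> \<longleftrightarrow> (\<forall>k. (k \<in> D \<longrightarrow> k \<in> {1..n} \<and> a k = Suc r) \<and> c (u k) = (if k \<in> D then r else a k))"
            by (intro all_cong1) auto
          also have "\<dots> \<longleftrightarrow> D \<subseteq> positions n a (Suc r) \<and> c \<circ> u = recolour a D r"
            unfolding subset_iff fun_eq_iff recolour_def positions_def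
            by (simp only: mem_Collect_eq comp_apply) blast
          finally show ?thesis .
        qed
        show "u ` D \<in> {C \<in> S. recolour c C (Suc r) = a \<circ> inv u}"
          if "D \<in> {D \<in> S'. c \<circ> u = recolour a D r}" for D
          using that key[of D] by (simp add: S_def S'_def card_image inj)
        show "inv u ` C \<in> {D \<in> S'. c \<circ> u = recolour a D r}"
          if "C \<in> {C \<in> S. recolour c C (Suc r) = a \<circ> inv u}" for C
          using that key[of "inv u ` C"] by (simp add: S_def S'_def card_image inj im)
      qed (simp_all add: image_comp comp_def uu)
      also have "\<dots> = (\<Sum>D\<in>S'. if c \<circ> u = recolour a D r then weight q ?R (u ` D) else 0)"
        using fin by (simp add: sum.If_cases Int_def)
      finally show ?thesis .
    qed
    have "psi q n r t (antisymmetrizer q n col a) c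
        = (\<Sum>C\<in>S. \<Sum>u\<in>Y. coef u * (if recolour c C (Suc r) = a \<circ> inv u then weight q ?R C else 0))"
      unfolding psi_def antisymmetrizer_def S_def Y_def coef_def sum_distrib_left
      by (intro sum.cong refl) (simp add: single_def)
    also have "\<dots> = (\<Sum>u\<in>Y. coef u * (\<Sum>C\<in>S. if recolour c C (Suc r) = a \<circ> inv u then weight q ?R C else 0))"
      unfolding sum_distrib_left by (rule sum.swap)
    also have "\<dots> = (\<Sum>u\<in>Y. \<Sum>D\<in>S'. coef u * (if c \<circ> u = recolour a D r then weight q ?R (u ` D) else 0))"
      unfolding sum_distrib_left[symmetric] by (intro sum.cong refl) (simp only: reindex)
    also have "\<dots> = (\<Sum>D\<in>S'. \<Sum>u\<in>Y. coef u * (if c \<circ> u = recolour a D r then weight q ?R (u ` D) else 0))"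
      by (rule sum.swap)
    also have "\<dots> = (\<Sum>D\<in>S'. 0)"
    proof (intro sum.cong refl)
      fix D assume D: "D \<in> S'"
      then have "D \<noteq> {}" using t by (auto simp: S'_def)
      have "(\<Sum>u\<in>Y. coef u * (if c \<circ> u = recolour a D r then weight q ?R (u ` D) else 0))
          = (\<Sum>u\<in>Y. if c \<circ> u = recolour a D r then coef u * weight q ?R (u ` D) else 0)"
        by (intro sum.cong) auto
      also have "\<dots> = (\<Sum>u | u \<in> Y \<and> c \<circ> u = recolour a D r. coef u * weight q ?R (u ` D))"
        using fin by (simp add: sum.If_cases Int_def)
      also have "\<dots> = 0"
        unfolding coef_def Y_def
        by (rule signed_sum_vanishes[OF q mono step uniq r]) (use D \<open>D \<noteq> {}\<close> in \<open>auto simp: S'_def\<close>)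
      finally show "(\<Sum>u\<in>Y. coef u * (if c \<circ> u = recolour a D r then weight q ?R (u ` D) else 0)) = 0" .
    qed
    finally show ?thesis by simp
  qed
  then show ?thesis by (simp add: psi_kernel_def)
qed

section \<open>Ranks in finite total orders\<close>

locale finite_total_order_on =
  fixes D :: "'b set" and le :: "'b \<Rightarrow> 'b \<Rightarrow> bool"
  assumes finite: "finite D"
    and refl: "x \<in> D \<Longrightarrow> le x x"
    and trans: "x \<in> D \<Longrightarrow> y \<in> D \<Longrightarrow> z \<in> D \<Longrightarrow> le x y \<Longrightarrow> le y z \<Longrightarrow> le x z"
    and antisym: "x \<in> D \<Longrightarrow> y \<in> D \<Longrightarrow> le x y \<Longrightarrow> le y x \<Longrightarrow> x = y"
    and total: "x \<in> D \<Longrightarrow> y \<in> D \<Longrightarrow> le x y \<or> le y x"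
begin

definition rank :: "'b \<Rightarrow> nat" where
  "rank x = card {y \<in> D. le y x}"

lemma rank_le_iff:
  assumes "x \<in> D" "y \<in> D"
  shows "rank x \<le> rank y \<longleftrightarrow> le x y"
proof -
  have sub: "{z \<in> D. le z x} \<subseteq> {z \<in> D. le z y}" if "x \<in> D" "y \<in> D" "le x y" for x y
    using trans[OF _ that(1,2) _ that(3)] by auto
  have mono: "rank x \<le> rank y" if "x \<in> D" "y \<in> D" "le x y" for x y
    unfolding rank_def by (rule card_mono[OF _ sub[OF that]]) (simp add: finite)
  have strict: "rank x < rank y" if "x \<in> D" "y \<in> D" "le x y" "\<not> le y x" for x y
  proof -
    have "y \<in> {z \<in> D. le z y}" "y \<notin> {z \<in> D. le z x}" using that refl by auto
    then have "{z \<in> D. le z x} \<subset> {z \<in> D. le z y}" using sub[OF that(1-3)] by blast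
    then show ?thesis unfolding rank_def by (rule psubset_card_mono[rotated]) (simp add: finite)
  qed
  show ?thesis
  proof
    assume "rank x \<le> rank y"
    then show "le x y" using strict[of y x] assms total[of x y] by fastforce
  qed (use mono assms in blast)
qed

lemma rank_inj: "inj_on rank D"
  by (metis antisym inj_onI order_refl rank_le_iff)

lemma rank_bij: "bij_betw rank D {1..card D}"
proof -
  have "rank ` D \<subseteq> {1..card D}"
  proof
    fix k assume "k \<in> rank ` D"
    then obtain x where x: "x \<in> D" "k = rank x" by blast
    have "rank x \<le> card D" unfolding rank_def using finite by (intro card_mono) auto
    moreover have "rank x \<noteq> 0" unfolding rank_def using finite x refl by auto
    ultimately show "k \<in> {1..card D}" using x by auto
  qed
  moreover have "card (rank ` D) = card {1..card D}" using rank_inj by (simp add: card_image)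
  ultimately have "rank ` D = {1..card D}" by (intro card_subset_eq) auto
  then show ?thesis using rank_inj by (simp add: bij_betw_def)
qed

end

section \<open>Diagrams and tableaux\<close>

definition row_le :: "nat \<times> nat \<Rightarrow> nat \<times> nat \<Rightarrow> bool" where
  "row_le y x \<longleftrightarrow> fst y < fst x \<or> fst y = fst x \<and> snd y \<le> snd x"

definition col_le :: "nat \<times> nat \<Rightarrow> nat \<times> nat \<Rightarrow> bool" where
  "col_le y x \<longleftrightarrow> snd y < snd x \<or> snd y = snd x \<and> fst y \<le> fst x"

lemma diagram_Sigma: "diagram \<nu> = (SIGMA i:{1..length \<nu>}. {1..part \<nu> i})"
  by (auto simp: diagram_def)

lemma finite_diagram [simp]: "finite (diagram \<nu>)"
  by (simp add: diagram_Sigma)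

lemma card_diagram: "card (diagram \<nu>) = sum_list \<nu>"
proof -
  have "card (diagram \<nu>) = (\<Sum>i\<in>{1..length \<nu>}. part \<nu> i)"
    by (simp add: diagram_Sigma)
  also have "\<dots> = (\<Sum>i\<in>{0..<length \<nu>}. \<nu> ! i)"
    by (rule sum.reindex_bij_witness[of _ Suc "\<lambda>i. i - 1"]) (auto simp: part_def)
  finally show ?thesis by (simp add: sum_list_sum_nth)
qed

text \<open>
  The entries of \<open>t\<^sup>\<nu>\<close> and \<open>t\<^sub>\<nu>\<close> are the ranks of the nodes in the two
  lexicographic orders.
\<close>

interpretation row: finite_total_order_on "diagram \<nu>" row_le for \<nu>
  by unfold_locales (auto simp: row_le_def prod_eq_iff)

interpretation col: finite_total_order_on "diagram \<nu>" col_le for \<nu>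
  by unfold_locales (auto simp: col_le_def prod_eq_iff)

lemma row_tableau_eq_rank: "row_tableau \<nu> x = row.rank \<nu> x"
  unfolding row_tableau_def row.rank_def row_le_def
  by (auto simp: case_prod_unfold intro!: arg_cong[where f = card])

lemma col_tableau_eq_rank: "col_tableau \<nu> x = col.rank \<nu> x"
  unfolding col_tableau_def col.rank_def col_le_def
  by (auto simp: case_prod_unfold intro!: arg_cong[where f = card])

lemma row_tableau_bij: "bij_betw (row_tableau \<nu>) (diagram \<nu>) {1..sum_list \<nu>}"
  using row.rank_bij[of \<nu>] by (simp add: row_tableau_eq_rank[abs_def] card_diagram)

lemma col_tableau_bij: "bij_betw (col_tableau \<nu>) (diagram \<nu>) {1..sum_list \<nu>}"
  using col.rank_bij[of \<nu>] by (simp add: col_tableau_eq_rank[abs_def] card_diagram)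

lemma row_tableau_le_iff:
  "x \<in> diagram \<nu> \<Longrightarrow> y \<in> diagram \<nu> \<Longrightarrow> row_tableau \<nu> x \<le> row_tableau \<nu> y \<longleftrightarrow> row_le x y"
  by (simp add: row_tableau_eq_rank row.rank_le_iff)

lemma col_tableau_le_iff:
  "x \<in> diagram \<nu> \<Longrightarrow> y \<in> diagram \<nu> \<Longrightarrow> col_tableau \<nu> x \<le> col_tableau \<nu> y \<longleftrightarrow> col_le x y"
  by (simp add: col_tableau_eq_rank col.rank_le_iff)

text \<open>
  The words that list the rows of the entries 1 to \<open>n\<close> of \<open>t\<^sup>\<nu>\<close> and of
  \<open>t\<^sub>\<nu>\<close>. The value 0 outside \<open>{1..n}\<close> makes the words that permutations produce from
  them comparable as functions.
\<close>

definition row_word :: "nat list \<Rightarrow> nat \<Rightarrow> nat" where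
  "row_word \<nu> k = (if k \<in> {1..sum_list \<nu>} then fst (inv_into (diagram \<nu>) (row_tableau \<nu>) k) else 0)"

definition col_word :: "nat list \<Rightarrow> nat \<Rightarrow> nat" where
  "col_word \<nu> k = (if k \<in> {1..sum_list \<nu>} then fst (inv_into (diagram \<nu>) (col_tableau \<nu>) k) else 0)"

lemma row_tableau_in: "x \<in> diagram \<nu> \<Longrightarrow> row_tableau \<nu> x \<in> {1..sum_list \<nu>}"
  using row_tableau_bij bij_betwE by blast

lemma col_tableau_in: "x \<in> diagram \<nu> \<Longrightarrow> col_tableau \<nu> x \<in> {1..sum_list \<nu>}"
  using col_tableau_bij bij_betwE by blast

lemma col_tableau_inj: "x \<in> diagram \<nu> \<Longrightarrow> y \<in> diagram \<nu> \<Longrightarrow> col_tableau \<nu> x = col_tableau \<nu> y \<longleftrightarrow> x = y"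
  using col_tableau_bij[of \<nu>] by (meson bij_betw_imp_inj_on inj_onD)

lemma row_tableau_cases:
  assumes "k \<in> {1..sum_list \<nu>}" obtains x where "x \<in> diagram \<nu>" "k = row_tableau \<nu> x"
  using assms row_tableau_bij[of \<nu>] by (metis bij_betw_imp_surj_on imageE)

lemma col_tableau_cases:
  assumes "k \<in> {1..sum_list \<nu>}" obtains x where "x \<in> diagram \<nu>" "k = col_tableau \<nu> x"
  using assms col_tableau_bij[of \<nu>] by (metis bij_betw_imp_surj_on imageE)

lemma row_word_tableau: "x \<in> diagram \<nu> \<Longrightarrow> row_word \<nu> (row_tableau \<nu> x) = fst x"
  using row_tableau_in[of x \<nu>] row_tableau_bij[of \<nu>]
  by (simp add: row_word_def bij_betw_imp_inj_on inv_into_f_f)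

lemma col_word_tableau: "x \<in> diagram \<nu> \<Longrightarrow> col_word \<nu> (col_tableau \<nu> x) = fst x"
  using col_tableau_in[of x \<nu>] col_tableau_bij[of \<nu>]
  by (simp add: col_word_def bij_betw_imp_inj_on inv_into_f_f)

lemma row_word_mono:
  assumes "1 \<le> k" "k \<le> k'" "k' \<le> sum_list \<nu>"
  shows "row_word \<nu> k \<le> row_word \<nu> k'"
proof -
  obtain x where x: "x \<in> diagram \<nu>" "k = row_tableau \<nu> x" using row_tableau_cases[of k \<nu>] assms by auto
  obtain y where y: "y \<in> diagram \<nu>" "k' = row_tableau \<nu> y" using row_tableau_cases[of k' \<nu>] assms by auto
  show ?thesis using assms(2) x y by (auto simp: row_word_tableau row_tableau_le_iff row_le_def)
qed

lemma row_stabilizer_eq: "row_stabilizer \<nu> = young_subgroup (sum_list \<nu>) (row_word \<nu>)"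
proof (intro set_eqI)
  fix w
  let ?n = "sum_list \<nu>"
  show "w \<in> row_stabilizer \<nu> \<longleftrightarrow> w \<in> young_subgroup ?n (row_word \<nu>)"
  proof
    assume w: "w \<in> row_stabilizer \<nu>"
    have "row_word \<nu> (w k) = row_word \<nu> k" if k: "k \<in> {1..?n}" for k
    proof -
      obtain x where x: "x \<in> diagram \<nu>" "k = row_tableau \<nu> x" using row_tableau_cases[OF k] .
      obtain j' where j': "(fst x, j') \<in> diagram \<nu>" "w k = row_tableau \<nu> (fst x, j')"
        using w x unfolding row_stabilizer_def by (cases x) fastforce
      show ?thesis using row_word_tableau[OF j'(1)] row_word_tableau[OF x(1)] j' x by simp
    qed
    then show "w \<in> young_subgroup ?n (row_word \<nu>)"
      using w by (simp add: row_stabilizer_def young_subgroup_def)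
  next
    assume w: "w \<in> young_subgroup ?n (row_word \<nu>)"
    have "\<exists>j'. (i, j') \<in> diagram \<nu> \<and> w (row_tableau \<nu> (i, j)) = row_tableau \<nu> (i, j')"
      if ij: "(i, j) \<in> diagram \<nu>" for i j
    proof -
      let ?k = "row_tableau \<nu> (i, j)"
      have k: "?k \<in> {1..?n}" by (rule row_tableau_in[OF ij])
      then have "w ?k \<in> {1..?n}" using w sym_grp_in_iff unfolding young_subgroup_def by blast
      then obtain y where y: "y \<in> diagram \<nu>" "w ?k = row_tableau \<nu> y" using row_tableau_cases by blast
      have "row_word \<nu> (w ?k) = row_word \<nu> ?k" using w k unfolding young_subgroup_def by blast
      then have "fst y = i" using row_word_tableau[OF y(1)] row_word_tableau[OF ij] y(2) by simp
      then show ?thesis using y by (cases y) auto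
    qed
    then show "w \<in> row_stabilizer \<nu>"
      using w by (auto simp: row_stabilizer_def young_subgroup_def)
  qed
qed

lemma word_stable_iff:
  assumes a: "\<And>k. k \<notin> {1..n} \<Longrightarrow> a k = 0"
  shows "w \<in> young_subgroup n a \<longleftrightarrow> w \<in> sym_grp n \<and> a \<circ> inv w = a"
proof
  assume w: "w \<in> young_subgroup n a"
  then have ws: "w \<in> sym_grp n" by (simp add: young_subgroup_def)
  have "(a \<circ> inv w) k = a k" for k
  proof (cases "k \<in> {1..n}")
    case True
    have "w (inv w k) = k" using sym_grp_inv_eq_iff[OF ws] by blast
    moreover have "inv w k \<in> {1..n}" using True sym_grp_in_iff[OF inv_sym_grp[OF ws]] by blast
    ultimately show ?thesis using w unfolding young_subgroup_def by force
  next
    case False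
    then have "inv w k \<notin> {1..n}" using sym_grp_in_iff[OF inv_sym_grp[OF ws]] by blast
    then show ?thesis using a False by simp
  qed
  then show "w \<in> sym_grp n \<and> a \<circ> inv w = a" using ws by auto
next
  assume w: "w \<in> sym_grp n \<and> a \<circ> inv w = a"
  have "a (w k) = a k" for k
  proof -
    have "inv w (w k) = k" using sym_grp_inv_eq_iff w by blast
    then show ?thesis using w by (metis comp_apply)
  qed
  then show "w \<in> young_subgroup n a" using w by (simp add: young_subgroup_def)
qed

lemma row_word_outside: "k \<notin> {1..sum_list \<nu>} \<Longrightarrow> row_word \<nu> k = 0"
  unfolding row_word_def by (simp only: if_False)

lemma col_word_outside: "k \<notin> {1..sum_list \<nu>} \<Longrightarrow> col_word \<nu> k = 0"
  unfolding col_word_def by (simp only: if_False)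

lemma sum_single:
  assumes "finite U"
  shows "(\<Sum>u\<in>U. f u * hecke_T u v) = (if v \<in> U then f v else 0)"
proof -
  have "(\<Sum>u\<in>U. f u * hecke_T u v) = (\<Sum>u\<in>U. if u = v then f u else 0)"
    by (intro sum.cong) (auto simp: hecke_T_def)
  then show ?thesis using assms by simp
qed

lemma finite_young_subgroup [simp]: "finite (young_subgroup n a)"
  by (simp add: young_subgroup_def)

lemma hecke_x_eq_lift: "hecke_x \<nu> = lift (sum_list \<nu>) (row_word \<nu>) (single (row_word \<nu>))"
proof
  fix v
  have "hecke_x \<nu> v = (\<Sum>u\<in>young_subgroup (sum_list \<nu>) (row_word \<nu>). 1 * hecke_T u v)"
    by (simp add: hecke_x_def row_stabilizer_eq)
  also have "\<dots> = (if v \<in> young_subgroup (sum_list \<nu>) (row_word \<nu>) then 1 else 0)"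
    by (rule sum_single) simp
  finally show "hecke_x \<nu> v = lift (sum_list \<nu>) (row_word \<nu>) (single (row_word \<nu>)) v"
    using word_stable_iff[of "sum_list \<nu>" "row_word \<nu>" v] row_word_outside[of _ \<nu>]
    by (auto simp: lift_def single_def)
qed

lemma w_tab_spec:
  shows "w_tab \<nu> \<in> sym_grp (sum_list \<nu>)"
    and "x \<in> diagram \<nu> \<Longrightarrow> w_tab \<nu> (row_tableau \<nu> x) = col_tableau \<nu> x"
proof -
  let ?n = "sum_list \<nu>" and ?D = "diagram \<nu>"
  let ?P = "\<lambda>w. w \<in> sym_grp ?n \<and> (\<forall>x\<in>?D. w (row_tableau \<nu> x) = col_tableau \<nu> x)"
  define w where "w k = (if k \<in> {1..?n} then col_tableau \<nu> (inv_into ?D (row_tableau \<nu>) k) else k)" for k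
  have "bij_betw (\<lambda>k. col_tableau \<nu> (inv_into ?D (row_tableau \<nu>) k)) {1..?n} {1..?n}"
    using bij_betw_trans[OF bij_betw_inv_into[OF row_tableau_bij] col_tableau_bij, of \<nu>]
    by (simp add: comp_def)
  then have "bij_betw w {1..?n} {1..?n}"
    by (rule bij_betw_cong[THEN iffD1, rotated]) (simp add: w_def)
  then have "w permutes {1..?n}"
    by (rule bij_imp_permutes) (simp only: w_def if_False)
  moreover have "w (row_tableau \<nu> x) = col_tableau \<nu> x" if x: "x \<in> ?D" for x
    using row_tableau_in[OF x] x row_tableau_bij[of \<nu>] by (simp add: w_def bij_betw_imp_inj_on inv_into_f_f)
  ultimately have "?P w" by (simp add: sym_grp_def)
  moreover have "w' = w" if "?P w'" for w'
  proof
    fix k show "w' k = w k"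
    proof (cases "k \<in> {1..?n}")
      case True
      then obtain x where "x \<in> ?D" "k = row_tableau \<nu> x" using row_tableau_cases by blast
      then show ?thesis using that \<open>?P w\<close> by simp
    next
      case False
      then show ?thesis using that \<open>?P w\<close> by (auto simp: sym_grp_def permutes_not_in)
    qed
  qed
  ultimately have "?P (w_tab \<nu>)" unfolding w_tab_def by (rule theI)
  then show "w_tab \<nu> \<in> sym_grp ?n" "x \<in> ?D \<Longrightarrow> w_tab \<nu> (row_tableau \<nu> x) = col_tableau \<nu> x" by auto
qed

lemma row_word_w_tab: "row_word \<nu> \<circ> inv (w_tab \<nu>) = col_word \<nu>"
proof
  fix k
  note w = w_tab_spec(1)[of \<nu>]
  show "(row_word \<nu> \<circ> inv (w_tab \<nu>)) k = col_word \<nu> k"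
  proof (cases "k \<in> {1..sum_list \<nu>}")
    case True
    then obtain x where x: "x \<in> diagram \<nu>" "k = col_tableau \<nu> x" using col_tableau_cases by blast
    then have "inv (w_tab \<nu>) k = row_tableau \<nu> x" using sym_grp_inv_eq_iff[OF w] w_tab_spec(2) by blast
    then show ?thesis using x by (simp add: row_word_tableau col_word_tableau)
  next
    case False
    then have "inv (w_tab \<nu>) k \<notin> {1..sum_list \<nu>}" using sym_grp_in_iff[OF inv_sym_grp[OF w]] by blast
    then show ?thesis using False row_word_outside col_word_outside unfolding comp_apply by metis
  qed
qed

text \<open>
  Both tableaux increase along rows, so an inversion of \<open>w\<^sub>\<nu>\<close> involves two different rows.
\<close>

lemma inversions_w_tab:
  assumes "(k, k') \<in> inversions (sum_list \<nu>) (w_tab \<nu>)"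
  shows "row_word \<nu> k < row_word \<nu> k'"
proof -
  have k: "1 \<le> k" "k < k'" "k' \<le> sum_list \<nu>" "w_tab \<nu> k' < w_tab \<nu> k"
    using assms by (auto simp: inversions_def)
  obtain x where x: "x \<in> diagram \<nu>" "k = row_tableau \<nu> x" using row_tableau_cases[of k \<nu>] k by auto
  obtain y where y: "y \<in> diagram \<nu>" "k' = row_tableau \<nu> y" using row_tableau_cases[of k' \<nu>] k by auto
  have "\<not> row_le y x" using row_tableau_le_iff[OF y(1) x(1)] k x y by simp
  moreover have "\<not> col_le x y"
    using col_tableau_le_iff[OF x(1) y(1)] k(4) x y w_tab_spec(2) by simp
  ultimately show ?thesis using x y by (auto simp: row_word_tableau row_le_def col_le_def)
qed

section \<open>Conjugate partitions\<close>

lemma part_antimono: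
  assumes "is_partition n \<mu>" "1 \<le> i" "i \<le> i'" "i' \<le> length \<mu>"
  shows "part \<mu> i' \<le> part \<mu> i"
proof (cases "i = i'")
  case False
  then show ?thesis
    using assms sorted_wrt_nth_less[of "(\<ge>)" \<mu> "i - 1" "i' - 1"] by (simp add: is_partition_def part_def)
qed simp

lemma diagram_down_closed:
  assumes "is_partition n \<mu>" "(i, j) \<in> diagram \<mu>" "1 \<le> i'" "i' \<le> i" "1 \<le> j'" "j' \<le> j"
  shows "(i', j') \<in> diagram \<mu>"
  using assms part_antimono[OF assms(1), of i' i] by (auto simp: diagram_def)

lemma part_conjugate:
  assumes "1 \<le> j" "j \<le> hd \<mu>"
  shows "part (conjugate \<mu>) j = card {i \<in> {1..length \<mu>}. j \<le> part \<mu> i}"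
proof -
  have "[1..<Suc (hd \<mu>)] ! (j - 1) = j" using assms by (subst nth_upt) auto
  then show ?thesis using assms by (simp add: conjugate_def part_def del: upt_Suc)
qed

text \<open>
  As the parts decrease, the rows of length at least \<open>j\<close> form an initial segment.
\<close>

lemma diagram_conjugate:
  assumes \<mu>: "is_partition n \<mu>" "\<mu> \<noteq> []"
  shows "(j, i) \<in> diagram (conjugate \<mu>) \<longleftrightarrow> (i, j) \<in> diagram \<mu>"
proof -
  have hd: "hd \<mu> = part \<mu> 1" using \<mu> by (simp add: part_def hd_conv_nth)
  have len: "length (conjugate \<mu>) = hd \<mu>" by (simp add: conjugate_def)
  have key: "i \<le> card {i \<in> {1..length \<mu>}. j \<le> part \<mu> i} \<longleftrightarrow> i \<le> length \<mu> \<and> j \<le> part \<mu> i"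
    if i: "1 \<le> i"
  proof
    assume "i \<le> length \<mu> \<and> j \<le> part \<mu> i"
    then have "{1..i} \<subseteq> {i \<in> {1..length \<mu>}. j \<le> part \<mu> i}"
      using part_antimono[OF \<mu>(1), of _ i] by (auto intro: order_trans)
    from card_mono[OF _ this] show "i \<le> card {i \<in> {1..length \<mu>}. j \<le> part \<mu> i}" by simp
  next
    assume c: "i \<le> card {i \<in> {1..length \<mu>}. j \<le> part \<mu> i}"
    show "i \<le> length \<mu> \<and> j \<le> part \<mu> i"
    proof (rule ccontr)
      assume neg: "\<not> ?thesis"
      have "{i \<in> {1..length \<mu>}. j \<le> part \<mu> i} \<subseteq> {1..<i}"
      proof
        fix k assume k: "k \<in> {i \<in> {1..length \<mu>}. j \<le> part \<mu> i}"
        have "k < i"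
        proof (rule ccontr)
          assume "\<not> k < i"
          then show False using neg k part_antimono[OF \<mu>(1) i, of k] by auto
        qed
        then show "k \<in> {1..<i}" using k by auto
      qed
      from card_mono[OF _ this] show False using c i by simp
    qed
  qed
  show ?thesis
  proof (cases "1 \<le> j \<and> j \<le> hd \<mu> \<and> 1 \<le> i")
    case True
    then show ?thesis using key by (auto simp: diagram_def len part_conjugate)
  next
    case False
    have "j \<le> hd \<mu>" if "(i, j) \<in> diagram \<mu>"
      using that part_antimono[OF \<mu>(1), of 1 i] by (auto simp: diagram_def hd)
    then show ?thesis using False by (auto simp: diagram_def len)
  qed
qed

lemma diagram_conjugate_eq:
  assumes "is_partition n \<mu>" "\<mu> \<noteq> []"
  shows "diagram (conjugate \<mu>) = prod.swap ` diagram \<mu>"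
  using diagram_conjugate[OF assms] by force

lemma sum_list_conjugate:
  assumes "is_partition n \<mu>" "\<mu> \<noteq> []"
  shows "sum_list (conjugate \<mu>) = sum_list \<mu>"
  unfolding card_diagram[symmetric] diagram_conjugate_eq[OF assms] by (simp add: card_image)

lemma row_tableau_conjugate:
  assumes "is_partition n \<mu>" "\<mu> \<noteq> []"
  shows "row_tableau (conjugate \<mu>) (prod.swap x) = col_tableau \<mu> x"
proof -
  have "{y \<in> diagram (conjugate \<mu>). row_le y (prod.swap x)} = prod.swap ` {y \<in> diagram \<mu>. col_le y x}"
    unfolding diagram_conjugate_eq[OF assms] by (auto simp: row_le_def col_le_def image_iff)
  then show ?thesis
    unfolding row_tableau_eq_rank col_tableau_eq_rank row.rank_def col.rank_def by (simp add: card_image)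
qed

text \<open>
  Transposition turns \<open>t\<^sub>\<mu>\<close> into the row tableau of \<open>\<mu>'\<close>. So the row word of
  \<open>\<mu>'\<close> serves as the column index for the entries of \<open>t\<^sub>\<mu>\<close>.
\<close>

lemma column_index_tableau:
  assumes "is_partition n \<mu>" "\<mu> \<noteq> []" "x \<in> diagram \<mu>"
  shows "row_word (conjugate \<mu>) (col_tableau \<mu> x) = snd x"
proof -
  have "prod.swap x \<in> diagram (conjugate \<mu>)"
    using assms(3) by (simp add: diagram_conjugate_eq[OF assms(1,2)])
  from row_word_tableau[OF this] show ?thesis by (simp add: row_tableau_conjugate[OF assms(1,2)])
qed

lemma hecke_y_eq:
  assumes "is_partition n \<mu>" "\<mu> \<noteq> []"
  shows "hecke_y q (conjugate \<mu>) = (\<lambda>v. \<Sum>u\<in>young_subgroup n (row_word (conjugate \<mu>)).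
    (- q) powi (- int (card (inversions n u))) * hecke_T u v)"
proof -
  have n: "sum_list (conjugate \<mu>) = n" using sum_list_conjugate[OF assms] assms by (simp add: is_partition_def)
  show ?thesis unfolding hecke_y_def row_stabilizer_eq n
    by (intro ext sum.cong refl) (simp add: young_subgroup_def perm_length_eq)
qed

section \<open>The column word\<close>

context
  fixes n \<mu>
  assumes \<mu>: "is_partition n \<mu>" "\<mu> \<noteq> []"
begin

lemma sum_\<mu>: "sum_list \<mu> = n" using \<mu> by (simp add: is_partition_def)

lemma col_cases: assumes "1 \<le> k" "k \<le> n" obtains x where "x \<in> diagram \<mu>" "k = col_tableau \<mu> x"
  using col_tableau_cases[of k \<mu>] assms sum_\<mu> by auto

lemma col_range: "x \<in> diagram \<mu> \<Longrightarrow> 1 \<le> col_tableau \<mu> x \<and> col_tableau \<mu> x \<le> n"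
  using col_tableau_in[of x \<mu>] sum_\<mu> by simp

lemma column_index_mono:
  "1 \<le> k \<Longrightarrow> k \<le> k' \<Longrightarrow> k' \<le> n \<Longrightarrow> row_word (conjugate \<mu>) k \<le> row_word (conjugate \<mu>) k'"
  using row_word_mono[of k k' "conjugate \<mu>"] sum_list_conjugate[OF \<mu>] sum_\<mu> by simp

lemma col_word_step:
  assumes x: "1 \<le> x" "x \<le> n" and r: "1 \<le> r" and a: "col_word \<mu> x = Suc r"
  shows "\<exists>y. x = Suc y \<and> 1 \<le> y \<and> col_word \<mu> y = r \<and>
    row_word (conjugate \<mu>) y = row_word (conjugate \<mu>) x"
proof -
  obtain b where b: "b \<in> diagram \<mu>" "x = col_tableau \<mu> b" using col_cases[OF x] .
  then have "fst b = Suc r" using a by (simp add: col_word_tableau)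
  then obtain j where bj: "b = (Suc r, j)" by (cases b) auto
  have b': "(r, j) \<in> diagram \<mu>"
    by (rule diagram_down_closed[OF \<mu>(1), of "Suc r" j]) (use b bj r in \<open>auto simp: diagram_def\<close>)
  have "{z \<in> diagram \<mu>. col_le z (Suc r, j)} = insert (Suc r, j) {z \<in> diagram \<mu>. col_le z (r, j)}"
    using b bj by (auto simp: col_le_def)
  then have "col_tableau \<mu> b = Suc (col_tableau \<mu> (r, j))"
    unfolding bj col_tableau_eq_rank col.rank_def by (simp add: col_le_def)
  then show ?thesis
    using b b' bj col_range[OF b'] column_index_tableau[OF \<mu> b'] column_index_tableau[OF \<mu> b(1)]
    by (intro exI[of _ "col_tableau \<mu> (r, j)"]) (simp add: col_word_tableau)
qed

lemma col_word_unique: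
  assumes "k \<in> {1..n}" "k' \<in> {1..n}" "row_word (conjugate \<mu>) k = row_word (conjugate \<mu>) k'"
    "col_word \<mu> k = col_word \<mu> k'"
  shows "k = k'"
proof -
  obtain x where x: "x \<in> diagram \<mu>" "k = col_tableau \<mu> x" using col_cases[of k] assms by auto
  obtain y where y: "y \<in> diagram \<mu>" "k' = col_tableau \<mu> y" using col_cases[of k'] assms by auto
  have "x = y"
    using assms(3,4) x y by (intro prod_eqI) (simp_all add: column_index_tableau[OF \<mu>] col_word_tableau)
  then show ?thesis using x y by simp
qed

text \<open>
  The permutation preserves the columns of \<open>t\<^sub>\<mu>\<close>, which are intervals, so an inversion lies
  within one column.
\<close>

lemma inversions_column_group:
  assumes u: "u \<in> young_subgroup n (row_word (conjugate \<mu>))" and inv: "(k, k') \<in> inversions n u"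
  shows "col_word \<mu> k < col_word \<mu> k'"
proof -
  have us: "u \<in> sym_grp n" using u by (simp add: young_subgroup_def)
  have k: "1 \<le> k" "k < k'" "k' \<le> n" "u k' < u k" using inv by (auto simp: inversions_def)
  obtain x where x: "x \<in> diagram \<mu>" "k = col_tableau \<mu> x" using col_cases[of k] k by auto
  obtain y where y: "y \<in> diagram \<mu>" "k' = col_tableau \<mu> y" using col_cases[of k'] k by auto
  have "row_word (conjugate \<mu>) (u k') \<le> row_word (conjugate \<mu>) (u k)"
    using column_index_mono[of "u k'" "u k"] sym_grp_range[OF us] k by simp
  then have "snd y \<le> snd x"
    using u k x y unfolding young_subgroup_def by (simp add: column_index_tableau[OF \<mu>])
  moreover have "\<not> col_le y x" using col_tableau_le_iff[OF y(1) x(1)] k x y by simp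
  ultimately show ?thesis using x y by (auto simp: col_word_tableau col_le_def)
qed

lemma cnt_col_word:
  assumes "m \<le> n"
  shows "cnt (col_word \<mu>) m r = card {j. (r, j) \<in> diagram \<mu> \<and> col_tableau \<mu> (r, j) \<le> m}"
proof -
  have "bij_betw (\<lambda>j. col_tableau \<mu> (r, j)) {j. (r, j) \<in> diagram \<mu> \<and> col_tableau \<mu> (r, j) \<le> m}
      {k \<in> {1..m}. col_word \<mu> k = r}"
  proof (rule bij_betw_imageI)
    show "inj_on (\<lambda>j. col_tableau \<mu> (r, j)) {j. (r, j) \<in> diagram \<mu> \<and> col_tableau \<mu> (r, j) \<le> m}"
      by (auto simp: inj_on_def col_tableau_inj)
    show "(\<lambda>j. col_tableau \<mu> (r, j)) ` {j. (r, j) \<in> diagram \<mu> \<and> col_tableau \<mu> (r, j) \<le> m}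
        = {k \<in> {1..m}. col_word \<mu> k = r}"
    proof (intro equalityI subsetI)
      fix k assume "k \<in> (\<lambda>j. col_tableau \<mu> (r, j)) ` {j. (r, j) \<in> diagram \<mu> \<and> col_tableau \<mu> (r, j) \<le> m}"
      then show "k \<in> {k \<in> {1..m}. col_word \<mu> k = r}" using col_range by (auto simp: col_word_tableau)
    next
      fix k assume k: "k \<in> {k \<in> {1..m}. col_word \<mu> k = r}"
      then obtain x where x: "x \<in> diagram \<mu>" "k = col_tableau \<mu> x" using col_cases[of k] assms by auto
      then have "fst x = r" using k by (simp add: col_word_tableau)
      then show "k \<in> (\<lambda>j. col_tableau \<mu> (r, j)) ` {j. (r, j) \<in> diagram \<mu> \<and> col_tableau \<mu> (r, j) \<le> m}"
        using x k by (cases x) auto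
    qed
  qed
  then show ?thesis by (simp add: cnt_def bij_betw_same_card)
qed

lemma finite_row [simp]: "finite {j. (r, j) \<in> diagram \<mu> \<and> P j}"
  by (rule finite_subset[of _ "{1..part \<mu> r}"]) (auto simp: diagram_def)

lemma cnt_col_word_n: "cnt (col_word \<mu>) n r = (if 1 \<le> r \<and> r \<le> length \<mu> then part \<mu> r else 0)"
proof -
  have "{j. (r, j) \<in> diagram \<mu> \<and> col_tableau \<mu> (r, j) \<le> n} = (if 1 \<le> r \<and> r \<le> length \<mu> then {1..part \<mu> r} else {})"
    using col_range by (auto simp: diagram_def)
  then show ?thesis by (simp add: cnt_col_word)
qed

lemma ballot_col_word: "ballot n (col_word \<mu>)"
  unfolding ballot_def
proof (intro allI impI)
  fix m r assume m: "m \<le> n" and r: "(1::nat) \<le> r"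
  have "{j. (Suc r, j) \<in> diagram \<mu> \<and> col_tableau \<mu> (Suc r, j) \<le> m} \<subseteq> {j. (r, j) \<in> diagram \<mu> \<and> col_tableau \<mu> (r, j) \<le> m}"
  proof
    fix j assume j: "j \<in> {j. (Suc r, j) \<in> diagram \<mu> \<and> col_tableau \<mu> (Suc r, j) \<le> m}"
    have d: "(r, j) \<in> diagram \<mu>"
      by (rule diagram_down_closed[OF \<mu>(1), of "Suc r" j]) (use j r in \<open>auto simp: diagram_def\<close>)
    have "col_tableau \<mu> (r, j) \<le> col_tableau \<mu> (Suc r, j)"
      using col_tableau_le_iff[OF d, of "(Suc r, j)"] j by (simp add: col_le_def)
    then show "j \<in> {j. (r, j) \<in> diagram \<mu> \<and> col_tableau \<mu> (r, j) \<le> m}" using d j by simp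
  qed
  then show "cnt (col_word \<mu>) m (Suc r) \<le> cnt (col_word \<mu>) m r"
    unfolding cnt_col_word[OF m] by (intro card_mono) auto
qed

text \<open>
  When the entry \<open>i\<close> is placed in column \<open>j\<close> of its row, each row \<open>y\<close> weakly
  below it has exactly its nodes in the columns before \<open>j\<close>: these are \<open>j - 1\<close> nodes, unless
  the row is shorter and already complete.
\<close>

lemma col_word_column_filling:
  assumes i: "1 \<le> i" "i \<le> n" and y: "col_word \<mu> i \<le> y"
  shows "cnt (col_word \<mu>) (i - 1) y = cnt (col_word \<mu>) (i - 1) (col_word \<mu> i) \<or>
    cnt (col_word \<mu>) (i - 1) y = cnt (col_word \<mu>) n y"
proof -
  obtain b where b: "b \<in> diagram \<mu>" "i = col_tableau \<mu> b" using col_cases[OF i] .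
  obtain x j where bj: "b = (x, j)" by (cases b)
  have x: "col_word \<mu> i = x" using b bj by (simp add: col_word_tableau)
  have j1: "1 \<le> j" "1 \<le> x" using b bj by (auto simp: diagram_def)
  have cnt: "cnt (col_word \<mu>) (i - 1) z = card {j'. (z, j') \<in> diagram \<mu> \<and> j' < j}" if "x \<le> z" for z
  proof -
    have "col_tableau \<mu> (z, j') \<le> i - 1 \<longleftrightarrow> j' < j" if d: "(z, j') \<in> diagram \<mu>" for j'
    proof -
      have "col_tableau \<mu> (z, j') \<le> i - 1 \<longleftrightarrow> \<not> col_tableau \<mu> b \<le> col_tableau \<mu> (z, j')"
        using i b by auto
      also have "\<dots> \<longleftrightarrow> j' < j"
        using col_tableau_le_iff[OF b(1) d] \<open>x \<le> z\<close> by (auto simp: bj col_le_def)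
      finally show ?thesis .
    qed
    then have "{j'. (z, j') \<in> diagram \<mu> \<and> col_tableau \<mu> (z, j') \<le> i - 1} = {j'. (z, j') \<in> diagram \<mu> \<and> j' < j}"
      by blast
    then show ?thesis using cnt_col_word[of "i - 1" z] i by simp
  qed
  have full: "{j'. (z, j') \<in> diagram \<mu> \<and> j' < j} = {1..<j}" if "(z, j - 1) \<in> diagram \<mu> \<or> j = 1" "1 \<le> z" for z
    using that diagram_down_closed[OF \<mu>(1), of z "j - 1" z] by (auto simp: diagram_def)
  show ?thesis
  proof (cases "(y, j - 1) \<in> diagram \<mu> \<or> j = 1")
    case True
    have "(x, j - 1) \<in> diagram \<mu> \<or> j = 1"
      using diagram_down_closed[OF \<mu>(1), of x j x "j - 1"] b bj j1 by (cases "j = 1") auto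
    then have "cnt (col_word \<mu>) (i - 1) x = card {1..<j}" using j1 full cnt[of x] by simp
    moreover have "cnt (col_word \<mu>) (i - 1) y = card {1..<j}"
      unfolding cnt[OF y[unfolded x]] using True y j1 full[of y] x by simp
    ultimately show ?thesis using x by simp
  next
    case False
    have "j' < j" if "(y, j') \<in> diagram \<mu>" for j'
    proof (rule ccontr)
      assume "\<not> j' < j"
      then have "1 \<le> y" "1 \<le> j - 1" "j - 1 \<le> j'" using False j1 y x by auto
      then have "(y, j - 1) \<in> diagram \<mu>"
        using diagram_down_closed[OF \<mu>(1) that, of y "j - 1"] by blast
      then show False using False by simp
    qed
    then have "{j'. (y, j') \<in> diagram \<mu> \<and> j' < j} = {j'. (y, j') \<in> diagram \<mu> \<and> col_tableau \<mu> (y, j') \<le> n}"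
      using col_range by auto
    then have "cnt (col_word \<mu>) (i - 1) y = cnt (col_word \<mu>) n y"
      unfolding cnt[OF y[unfolded x]] cnt_col_word[OF order_refl] by (rule arg_cong)
    then show ?thesis by blast
  qed
qed

end

section \<open>Words of a given content\<close>

definition words_of :: "nat \<Rightarrow> (nat \<Rightarrow> nat) \<Rightarrow> (nat \<Rightarrow> nat) set" where
  "words_of n a = (\<lambda>v. a \<circ> inv v) ` sym_grp n"

lemma finite_words_of [simp]: "finite (words_of n a)"
  by (simp add: words_of_def)

lemma self_in_words_of: "a \<in> words_of n a"
  unfolding words_of_def by (rule image_eqI[of _ _ id]) (simp_all only: inv_id comp_id id_sym_grp)

lemma cnt_comp_inv:
  assumes v: "v \<in> sym_grp n"
  shows "cnt (a \<circ> inv v) n r = cnt a n r"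
proof -
  have vv: "v (inv v x) = x" "inv v (v x) = x" for x using sym_grp_inv_eq_iff[OF v] by blast+
  have "bij_betw v {k \<in> {1..n}. a k = r} {k \<in> {1..n}. (a \<circ> inv v) k = r}"
  proof (rule bij_betw_byWitness[where f' = "inv v"])
    show "v ` {k \<in> {1..n}. a k = r} \<subseteq> {k \<in> {1..n}. (a \<circ> inv v) k = r}"
    proof (rule image_subsetI)
      fix k assume "k \<in> {k \<in> {1..n}. a k = r}"
      then show "v k \<in> {k \<in> {1..n}. (a \<circ> inv v) k = r}"
        using sym_grp_in_iff[OF v, of k] by (simp add: vv)
    qed
    show "inv v ` {k \<in> {1..n}. (a \<circ> inv v) k = r} \<subseteq> {k \<in> {1..n}. a k = r}"
    proof (rule image_subsetI)
      fix k assume "k \<in> {k \<in> {1..n}. (a \<circ> inv v) k = r}"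
      then show "inv v k \<in> {k \<in> {1..n}. a k = r}"
        using sym_grp_in_iff[OF inv_sym_grp[OF v], of k] by simp
    qed
  qed (simp_all add: vv)
  from bij_betw_same_card[OF this] show ?thesis by (simp only: cnt_def)
qed

lemma words_of_iff:
  assumes a: "\<And>k. k \<notin> {1..n} \<Longrightarrow> a k = 0"
  shows "b \<in> words_of n a \<longleftrightarrow> (\<forall>k. k \<notin> {1..n} \<longrightarrow> b k = 0) \<and> (\<forall>r. cnt b n r = cnt a n r)"
proof
  assume "b \<in> words_of n a"
  then obtain v where v: "v \<in> sym_grp n" "b = a \<circ> inv v" by (auto simp: words_of_def)
  have "b k = 0" if "k \<notin> {1..n}" for k
  proof -
    have "inv v k \<notin> {1..n}" using that sym_grp_in_iff[OF inv_sym_grp[OF v(1)]] by blast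
    then show ?thesis using a v(2) by simp
  qed
  then show "(\<forall>k. k \<notin> {1..n} \<longrightarrow> b k = 0) \<and> (\<forall>r. cnt b n r = cnt a n r)"
    using cnt_comp_inv[OF v(1)] v(2) by blast
next
  assume b: "(\<forall>k. k \<notin> {1..n} \<longrightarrow> b k = 0) \<and> (\<forall>r. cnt b n r = cnt a n r)"
  have "count (image_mset f (mset_set {1..n})) r = cnt f n r" for f :: "nat \<Rightarrow> nat" and r
  proof -
    have "count (image_mset f (mset_set {1..n})) r = card (f -` {r} \<inter> {1..n})"
      unfolding count_image_mset by simp
    also have "f -` {r} \<inter> {1..n} = {k \<in> {1..n}. f k = r}" by auto
    finally show ?thesis by (simp add: cnt_def)
  qed
  then have "image_mset b (mset_set {1..n}) = image_mset a (mset_set {1..n})"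
    using b by (intro multiset_eqI) simp
  then obtain p where p: "p permutes {1..n}" "\<forall>k\<in>{1..n}. b k = a (p k)"
    using image_mset_eq_implies_permutes[OF finite_atLeastAtMost] by blast
  have ps: "p \<in> sym_grp n" using p by (simp add: sym_grp_def)
  have "b = a \<circ> p"
  proof
    fix k show "b k = (a \<circ> p) k"
    proof (cases "k \<in> {1..n}")
      case False
      then have "p k \<notin> {1..n}" using sym_grp_in_iff[OF ps] by blast
      then show ?thesis using False a b by simp
    qed (use p in simp)
  qed
  then show "b \<in> words_of n a"
    unfolding words_of_def using inv_sym_grp[OF ps] inv_inv_sym_grp[OF ps]
    by (intro image_eqI[of _ _ "inv p"]) simp_all
qed

lemma words_of_swap:
  assumes "b \<in> words_of n a" "1 \<le> i" "i < n"
  shows "b \<circ> simple_refl i \<in> words_of n a"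
proof -
  obtain v where v: "v \<in> sym_grp n" "b = a \<circ> inv v" using assms by (auto simp: words_of_def)
  have "b \<circ> simple_refl i = a \<circ> inv (simple_refl i \<circ> v)"
    unfolding inv_simple_refl_comp[OF v(1)] v(2) by (simp only: comp_assoc)
  moreover have "simple_refl i \<circ> v \<in> sym_grp n"
    using v assms by (simp add: comp_sym_grp simple_refl_sym_grp)
  ultimately show ?thesis unfolding words_of_def by blast
qed

section \<open>The constant function\<close>

text \<open>
  Adding a new smallest element \<open>x\<close> to \<open>R\<close> is Pascal's rule: the subsets containing
  \<open>x\<close> get the additional factor \<open>q ^ card R\<close>.
\<close>

lemma subset_weight_sum:
  assumes "finite R"
  shows "(\<Sum>C | C \<subseteq> R \<and> card C = t. weight q R C) = coeff (q_linear_prod q (card R)) t"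
  using assms
proof (induction R arbitrary: t rule: finite_linorder_min_induct)
  case empty
  have "{C :: nat set. C \<subseteq> {} \<and> card C = t} = (if t = 0 then {{}} else {})" by auto
  then show ?case by (simp add: weight_def)
next
  case (insert x R)
  have x: "x \<notin> R" using insert.hyps by auto
  have fin: "finite C" if "C \<subseteq> R" for C using that insert.hyps finite_subset by blast
  show ?case
  proof (cases t)
    case 0
    have "{C. C \<subseteq> insert x R \<and> card C = 0} = {{}}"
      using finite_subset[of _ "insert x R"] insert.hyps by auto
    then show ?thesis using 0 by (simp add: weight_def)
  next
    case (Suc t')
    let ?S = "\<lambda>t. {C. C \<subseteq> R \<and> card C = t}"
    have split: "{C. C \<subseteq> insert x R \<and> card C = Suc t'} = ?S (Suc t') \<union> insert x ` ?S t'" (is "?L = ?M")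
    proof (intro equalityI subsetI)
      fix C assume C: "C \<in> ?L"
      show "C \<in> ?M"
      proof (cases "x \<in> C")
        case True
        then have "C = insert x (C - {x})" "C - {x} \<subseteq> R" using C by auto
        moreover have "card (C - {x}) = t'" using C True by simp
        ultimately show ?thesis by blast
      qed (use C in auto)
    next
      fix C assume "C \<in> ?M"
      then show "C \<in> ?L" using x fin by (auto simp: card_insert_if)
    qed
    have h: "{k' \<in> insert x R. k < k'} = {k' \<in> R. k < k'}" if "k \<in> R" for k
      using insert.hyps(2) that by force
    have hx: "{k' \<in> insert x R. x < k'} = R" using insert.hyps(2) by auto
    have w1: "weight q (insert x R) C = weight q R C" if "C \<subseteq> R" for C
      unfolding weight_def using that h by (intro prod.cong) auto
    have w2: "weight q (insert x R) (insert x C) = q ^ card R * weight q R C" if "C \<subseteq> R" for C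
    proof -
      have "x \<notin> C" using that x by auto
      then have "weight q (insert x R) (insert x C) = q ^ card R * weight q (insert x R) C"
        unfolding weight_def using fin[OF that] hx by simp
      then show ?thesis using w1[OF that] by simp
    qed
    have inj: "inj_on (insert x) (?S t')" using x by (auto simp: inj_on_def)
    have "(\<Sum>C\<in>?S (Suc t') \<union> insert x ` ?S t'. weight q (insert x R) C)
        = (\<Sum>C\<in>?S (Suc t'). weight q (insert x R) C) + (\<Sum>C\<in>insert x ` ?S t'. weight q (insert x R) C)"
      using insert.hyps(1) x by (intro sum.union_disjoint) auto
    also have "\<dots> = (\<Sum>C\<in>?S (Suc t'). weight q R C) + q ^ card R * (\<Sum>C\<in>?S t'. weight q R C)"
      unfolding sum.reindex[OF inj] sum_distrib_left
      by (intro arg_cong2[where f = "(+)"] sum.cong) (auto simp: w1 w2)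
    also have "\<dots> = coeff (q_linear_prod q (Suc (card R))) (Suc t')"
      by (simp only: insert.IH coeff_q_linear_prod_Suc)
    finally show ?thesis using Suc insert.hyps(1) x by (simp add: split)
  qed
qed

definition indicator_words :: "nat \<Rightarrow> (nat \<Rightarrow> nat) \<Rightarrow> ((nat \<Rightarrow> nat) \<Rightarrow> 'a::field)" where
  "indicator_words n a = (\<lambda>b. if b \<in> words_of n a then 1 else 0)"

lemma cnt_recolour:
  assumes C: "C \<subseteq> positions n c r"
  shows "cnt (recolour c C (Suc r)) n s =
    (if s = r then cnt c n r - card C else if s = Suc r then cnt c n (Suc r) + card C else cnt c n s)"
proof -
  have fin: "finite C" using C finite_subset finite_positions by blast
  have mem: "k \<in> {1..n}" "c k = r" if "k \<in> C" for k using that C by (auto simp: positions_def)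
  consider "s = r" | "s = Suc r" | "s \<noteq> r" "s \<noteq> Suc r" by blast
  then show ?thesis
  proof cases
    case 1
    have "{k \<in> {1..n}. recolour c C (Suc r) k = r} = positions n c r - C"
      by (auto simp: recolour_def positions_def)
    then show ?thesis using 1 card_Diff_subset[OF fin C] by (simp add: cnt_def positions_def)
  next
    case 2
    have "{k \<in> {1..n}. recolour c C (Suc r) k = Suc r} = {k \<in> {1..n}. c k = Suc r} \<union> C"
      using mem by (auto simp: recolour_def)
    moreover have "{k \<in> {1..n}. c k = Suc r} \<inter> C = {}" using mem by auto
    ultimately show ?thesis using 2 fin by (simp add: cnt_def card_Un_disjoint)
  next
    case 3
    have "{k \<in> {1..n}. recolour c C (Suc r) k = s} = {k \<in> {1..n}. c k = s}"
      using mem 3 by (auto simp: recolour_def)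
    then show ?thesis using 3 by (simp add: cnt_def)
  qed
qed

text \<open>
  The content of the recoloured word depends only on the number of recoloured positions.
\<close>

lemma recolour_words_of:
  assumes a: "\<And>k. k \<notin> {1..n} \<Longrightarrow> a k = 0"
    and C: "C \<subseteq> positions n c r" "recolour c C (Suc r) \<in> words_of n a"
    and C': "C' \<subseteq> positions n c r" "card C' = card C"
  shows "recolour c C' (Suc r) \<in> words_of n a"
proof -
  have out: "recolour c C' (Suc r) k = recolour c C (Suc r) k" if "k \<notin> {1..n}" for k
  proof -
    have "k \<notin> C" "k \<notin> C'" using that C(1) C'(1) by (auto simp: positions_def)
    then show ?thesis by (simp add: recolour_def)
  qed
  have W: "(\<forall>k. k \<notin> {1..n} \<longrightarrow> recolour c C (Suc r) k = 0) \<and> (\<forall>s. cnt (recolour c C (Suc r)) n s = cnt a n s)"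
    using words_of_iff[of n a "recolour c C (Suc r)"] a C(2) by blast
  have "cnt (recolour c C' (Suc r)) n s = cnt (recolour c C (Suc r)) n s" for s
    unfolding cnt_recolour[OF C(1)] cnt_recolour[OF C'(1)] C'(2) ..
  then have "(\<forall>k. k \<notin> {1..n} \<longrightarrow> recolour c C' (Suc r) k = 0) \<and> (\<forall>s. cnt (recolour c C' (Suc r)) n s = cnt a n s)"
    using W out by simp
  then show ?thesis using words_of_iff[of n a "recolour c C' (Suc r)"] a by blast
qed

text \<open>
  If some recolouring of \<open>c\<close> is a word of the given content, then so are all of the same size, and
  \<open>\<psi>\<close> takes the total weight of the \<open>t\<close>-subsets as its value at \<open>c\<close>.
  Otherwise the value is 0.
\<close>

lemma indicator_words_in_kernel_iff:
  fixes q :: "'a::field"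
  assumes a: "\<And>k. k \<notin> {1..n} \<Longrightarrow> a k = 0"
  shows "(indicator_words n a :: _ \<Rightarrow> 'a) \<in> psi_kernel q n \<longleftrightarrow>
    (\<forall>r\<ge>1. \<forall>t. 1 \<le> t \<and> t \<le> cnt a n (Suc r) \<longrightarrow> coeff (q_linear_prod q (cnt a n r + t)) t = 0)"
proof -
  have psi: "psi q n r (card P) (indicator_words n a) c = coeff (q_linear_prod q (card (positions n c r))) (card P)"
    if P: "P \<subseteq> positions n c r" "recolour c P (Suc r) \<in> words_of n a" for P c r
  proof -
    have "psi q n r (card P) (indicator_words n a) c = (\<Sum>C | C \<subseteq> positions n c r \<and> card C = card P. weight q (positions n c r) C)"
      unfolding psi_def indicator_words_def
      using recolour_words_of[OF a P] by (intro sum.cong) auto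
    then show ?thesis by (simp add: subset_weight_sum)
  qed
  show ?thesis
  proof
    assume K: "(indicator_words n a :: _ \<Rightarrow> 'a) \<in> psi_kernel q n"
    show "\<forall>r\<ge>1. \<forall>t. 1 \<le> t \<and> t \<le> cnt a n (Suc r) \<longrightarrow> coeff (q_linear_prod q (cnt a n r + t)) t = 0"
    proof (intro allI impI)
      fix r t assume r: "(1::nat) \<le> r" and t: "1 \<le> t \<and> t \<le> cnt a n (Suc r)"
      obtain P where P: "P \<subseteq> {k \<in> {1..n}. a k = Suc r}" "card P = t" "finite P"
        using obtain_subset_with_card_n[of t "{k \<in> {1..n}. a k = Suc r}"] t unfolding cnt_def by blast
      define c where "c = recolour a P r"
      have R: "positions n c r = {k \<in> {1..n}. a k = r} \<union> P"
        using P(1) by (auto simp: c_def recolour_def positions_def)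
      have restore: "recolour c P (Suc r) = a"
      proof
        fix k show "recolour c P (Suc r) k = a k" using P(1) by (auto simp: c_def recolour_def)
      qed
      have "card (positions n c r) = cnt a n r + t"
        unfolding R cnt_def P(2)[symmetric] by (rule card_Un_disjoint) (use P in auto)
      moreover have "P \<subseteq> positions n c r" using R by blast
      ultimately have "psi q n r t (indicator_words n a) c = coeff (q_linear_prod q (cnt a n r + t)) t"
        using psi[of P c r] self_in_words_of[of a n] restore P(2) by simp
      then show "coeff (q_linear_prod q (cnt a n r + t)) t = 0"
        using K r t unfolding psi_kernel_def by auto
    qed
  next
    assume *: "\<forall>r\<ge>1. \<forall>t. 1 \<le> t \<and> t \<le> cnt a n (Suc r) \<longrightarrow> coeff (q_linear_prod q (cnt a n r + t)) t = 0"
    have "psi q n r t (indicator_words n a) c = (0::'a)" if r: "1 \<le> r" and t: "1 \<le> t" for r t c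
    proof (cases "\<exists>P. P \<subseteq> positions n c r \<and> card P = t \<and> recolour c P (Suc r) \<in> words_of n a")
      case False
      then show ?thesis unfolding psi_def indicator_words_def by (intro sum.neutral) auto
    next
      case True
      then obtain P where P: "P \<subseteq> positions n c r" "card P = t" "recolour c P (Suc r) \<in> words_of n a" by blast
      have cnts: "cnt (recolour c P (Suc r)) n s = cnt a n s" for s
        using words_of_iff[of n a "recolour c P (Suc r)"] a P(3) by blast
      have "card P \<le> card (positions n c r)" using P(1) by (intro card_mono) auto
      moreover have "card (positions n c r) = cnt c n r" by (simp add: cnt_def positions_def)
      ultimately have "card (positions n c r) = cnt a n r + t" "t \<le> cnt a n (Suc r)"
        using cnts[of r] cnts[of "Suc r"] cnt_recolour[OF P(1)] P(2) by auto
      then show ?thesis using psi[OF P(1,3)] * r t P(2) by auto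
    qed
    then show "(indicator_words n a :: _ \<Rightarrow> 'a) \<in> psi_kernel q n" by (simp add: psi_kernel_def)
  qed
qed

section \<open>Right ideals generated by one element\<close>

definition right_ideal :: "nat \<Rightarrow> 'a::field \<Rightarrow> 'a hecke \<Rightarrow> 'a hecke set" where
  "right_ideal n q z = hecke_mult n q z ` hecke_carrier n"

lemma right_ideal_least:
  assumes z: "z \<in> X" and zero: "(\<lambda>_. 0) \<in> X"
    and lin: "\<And>f g x. f \<in> X \<Longrightarrow> g \<in> X \<Longrightarrow> (\<lambda>v. f v + x * g v) \<in> X"
    and R: "\<And>f i. f \<in> X \<Longrightarrow> 1 \<le> i \<Longrightarrow> i < n \<Longrightarrow> hecke_mult_simple n q f i \<in> X"
  shows "right_ideal n q z \<subseteq> X"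
proof
  fix f assume "f \<in> right_ideal n q z"
  then obtain h where f: "f = hecke_mult n q z h" by (auto simp: right_ideal_def)
  have word: "hecke_mult_word n q z js \<in> X" if "set js \<subseteq> {1..<n}" for js
    using that by (induction js rule: rev_induct) (auto simp: z R)
  have "(\<lambda>v. \<Sum>w\<in>U. h w * hecke_mult_word n q z (reduced_word n w) v) \<in> X" if "finite U" "U \<subseteq> sym_grp n" for U
    using that
  proof (induction U rule: finite_induct)
    case (insert w U)
    have "reduced n w (reduced_word n w)" using insert.prems by (intro reduced_reduced_word) auto
    then have "hecke_mult_word n q z (reduced_word n w) \<in> X"
      by (intro word) (simp add: reduced_def is_word_def)
    from lin[OF insert.IH this, of "h w"] show ?case using insert by (simp add: add.commute)
  qed (simp add: zero)
  then show "f \<in> X" by (simp add: f hecke_mult_eq)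
qed

lemma right_ideal_self: "z \<in> right_ideal n q z"
  unfolding right_ideal_def
  by (rule image_eqI[of _ _ "hecke_T id"]) (simp_all only: hecke_mult_T_id hecke_T_in_carrier id_sym_grp)

lemma right_ideal_lin:
  assumes "f \<in> right_ideal n q z" "g \<in> right_ideal n q z"
  shows "(\<lambda>v. x * f v + y * g v) \<in> right_ideal n q z"
proof -
  obtain h h' where h: "f = hecke_mult n q z h" "h \<in> hecke_carrier n"
      and h': "g = hecke_mult n q z h'" "h' \<in> hecke_carrier n" using assms by (auto simp: right_ideal_def)
  show ?thesis unfolding right_ideal_def
    by (rule image_eqI[of _ _ "\<lambda>v. x * h v + y * h' v"])
      (use h h' in \<open>auto simp: hecke_mult_lincomb hecke_carrier_def\<close>)
qed

lemma right_ideal_scale: "f \<in> right_ideal n q z \<Longrightarrow> (\<lambda>v. x * f v) \<in> right_ideal n q z"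
  using right_ideal_lin[of f n q z f x 0] by simp

lemma zero_in_right_ideal: "(\<lambda>_. 0) \<in> right_ideal n q z"
  using right_ideal_scale[OF right_ideal_self, of 0] by simp

lemma right_ideal_mult_simple:
  assumes z: "z \<in> hecke_carrier n" and f: "f \<in> right_ideal n q z" and i: "1 \<le> i" "i < n"
  shows "hecke_mult_simple n q f i \<in> right_ideal n q z"
  using f hecke_mult_assoc_simple[OF z _ i] hecke_mult_simple_carrier[OF i]
  unfolding right_ideal_def by fastforce

lemma right_ideal_carrier: "z \<in> hecke_carrier n \<Longrightarrow> right_ideal n q z \<subseteq> hecke_carrier n"
  by (auto simp: right_ideal_def hecke_mult_carrier)

section \<open>The trivial module\<close>

definition hecke_ones :: "nat \<Rightarrow> 'a::field hecke" where
  "hecke_ones n = (\<lambda>v. if v \<in> sym_grp n then 1 else 0)"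

lemma hecke_mult_eigenvector:
  assumes "\<And>i. 1 \<le> i \<Longrightarrow> i < n \<Longrightarrow> hecke_mult_simple n q f i = (\<lambda>v. q * f v)"
  shows "hecke_mult n q f h = (\<lambda>v. (\<Sum>w\<in>sym_grp n. h w * q ^ length (reduced_word n w)) * f v)"
proof -
  have scale: "hecke_mult_simple n q (\<lambda>v. x * f v) i = (\<lambda>v. x * hecke_mult_simple n q f i v)" for x i
    using hecke_mult_simple_lincomb[of n q x f 0 f i] by simp
  have word: "hecke_mult_word n q f js = (\<lambda>v. q ^ length js * f v)" if "set js \<subseteq> {1..<n}" for js
    using that
  proof (induction js rule: rev_induct)
    case (snoc i js)
    then have "hecke_mult_word n q f js = (\<lambda>v. q ^ length js * f v)" by simp
    then show ?case using assms[of i] snoc.prems unfolding hecke_mult_word_snoc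
      by (simp add: scale mult.assoc mult.left_commute)
  qed simp
  have "set (reduced_word n w) \<subseteq> {1..<n}" if "w \<in> sym_grp n" for w
    using reduced_reduced_word[OF that] by (simp add: reduced_def is_word_def)
  then show ?thesis
    unfolding hecke_mult_eq sum_distrib_right by (intro ext sum.cong refl) (simp add: word mult.assoc)
qed

lemma hecke_ones_eigenvector:
  "1 \<le> i \<Longrightarrow> i < n \<Longrightarrow> hecke_mult_simple n q (hecke_ones n) i = (\<lambda>v. q * hecke_ones n v)"
  by (auto simp: hecke_mult_simple_apply hecke_ones_def comp_sym_grp simple_refl_sym_grp fun_eq_iff)

text \<open>
  The eigenvalue equation at \<open>v\<close> says that the coefficients at \<open>v\<close> and
  \<open>s\<^sub>i \<circ> v\<close> agree.
\<close>

lemma eigenvector_eq_ones: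
  assumes q: "q \<noteq> 0" and f: "f \<in> hecke_carrier n"
    and eig: "\<And>i. 1 \<le> i \<Longrightarrow> i < n \<Longrightarrow> hecke_mult_simple n q f i = (\<lambda>v. q * f v)"
  shows "f = (\<lambda>v. f id * hecke_ones n v)"
proof -
  have step: "f (simple_refl i \<circ> v) = f v" if v: "v \<in> sym_grp n" and i: "1 \<le> i" "i < n" for v i
    using fun_cong[OF eig[OF i], of v] v q by (auto simp: hecke_mult_simple_apply[OF i] algebra_simps split: if_splits)
  have "f w = f id" if "is_word n w js" for w js
    using that
  proof (induction js arbitrary: w rule: rev_induct)
    case Nil
    then show ?case by (simp add: is_word_Nil)
  next
    case (snoc i js)
    then have i: "1 \<le> i" "i < n" and js: "is_word n (simple_refl i \<circ> w) js" by (auto simp: is_word_snoc)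
    have "w \<in> sym_grp n" using snoc.prems is_word_sym_grp by blast
    then show ?case using snoc.IH[OF js] step[of w i] i by metis
  qed
  then have const: "f w = f id" if "w \<in> sym_grp n" for w using ex_reduced_word[OF that] by blast
  show ?thesis
  proof
    fix v show "f v = f id * hecke_ones n v"
    proof (cases "v \<in> sym_grp n")
      case True
      then show ?thesis unfolding hecke_ones_def by (simp only: const[OF True] if_True mult_1_right)
    next
      case False
      then show ?thesis using f by (simp add: hecke_ones_def hecke_carrier_def)
    qed
  qed
qed

lemma right_ideal_ones: "right_ideal n q (hecke_ones n) = range (\<lambda>c v. c * hecke_ones n v)"
proof (intro equalityI subsetI)
  fix f assume "f \<in> right_ideal n q (hecke_ones n)"
  then show "f \<in> range (\<lambda>c v. c * hecke_ones n v)"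
    unfolding right_ideal_def using hecke_mult_eigenvector[OF hecke_ones_eigenvector, of n q] by auto
next
  fix f :: "'a hecke" assume "f \<in> range (\<lambda>c v. c * hecke_ones n v)"
  then obtain c where f: "f = (\<lambda>v. c * hecke_ones n v)" by blast
  show "f \<in> right_ideal n q (hecke_ones n)"
    unfolding f by (rule right_ideal_scale[OF right_ideal_self])
qed

text \<open>
  An isomorphism from the trivial module maps \<open>\<Sum>w. T\<^sub>w\<close> to a nonzero eigenvector with the same
  eigenvalues, which is a multiple of \<open>\<Sum>w. T\<^sub>w\<close>.
\<close>

lemma trivial_submodule_iff:
  fixes q :: "'a::field"
  assumes q: "q \<noteq> 0" and z: "z \<in> hecke_carrier n"
  shows "has_submodule_isomorphic_to n q (right_ideal n q z) (right_ideal n q (hecke_ones n))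
    \<longleftrightarrow> hecke_ones n \<in> right_ideal n q z"
proof
  let ?L = "right_ideal n q (hecke_ones n :: 'a hecke)"
  assume ones: "hecke_ones n \<in> right_ideal n q z"
  have "?L \<subseteq> right_ideal n q z"
    using right_ideal_scale[OF ones] by (auto simp: right_ideal_ones)
  moreover have "is_right_submodule n q ?L"
    unfolding is_right_submodule_def
  proof (intro conjI ballI allI)
    show "?L \<subseteq> hecke_carrier n"
      by (rule right_ideal_carrier) (simp add: hecke_ones_def hecke_carrier_def)
    show "(\<lambda>_. 0) \<in> ?L" by (rule zero_in_right_ideal)
    show "(\<lambda>w. f w + g w) \<in> ?L" if "f \<in> ?L" "g \<in> ?L" for f g
      using right_ideal_lin[OF that, of 1 1] by simp
    show "(\<lambda>w. c * f w) \<in> ?L" if "f \<in> ?L" for f c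
      using that by (rule right_ideal_scale)
    show "hecke_mult n q f h \<in> ?L" if f: "f \<in> ?L" for f h
    proof -
      obtain c where c: "f = (\<lambda>v. c * hecke_ones n v)" using f by (auto simp: right_ideal_ones)
      have "hecke_mult_simple n q f i = (\<lambda>v. q * f v)" if "1 \<le> i" "i < n" for i
        using hecke_mult_simple_lincomb[of n q c "hecke_ones n" 0 "hecke_ones n" i] hecke_ones_eigenvector[OF that, of q]
        by (simp add: c mult_ac)
      from hecke_mult_eigenvector[OF this] have "hecke_mult n q f h
          = (\<lambda>v. ((\<Sum>w\<in>sym_grp n. h w * q ^ length (reduced_word n w)) * c) * hecke_ones n v)"
        by (simp add: c mult.assoc)
      then show ?thesis by (simp add: right_ideal_ones)
    qed
  qed
  moreover have "is_right_module_iso n q ?L ?L (\<lambda>f. f)"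
    by (simp add: is_right_module_iso_def bij_betw_def)
  ultimately show "has_submodule_isomorphic_to n q (right_ideal n q z) ?L"
    unfolding has_submodule_isomorphic_to_def by blast
next
  let ?L = "right_ideal n q (hecke_ones n :: 'a hecke)"
  assume "has_submodule_isomorphic_to n q (right_ideal n q z) ?L"
  then obtain N \<phi> where N: "N \<subseteq> right_ideal n q z" and bij: "bij_betw \<phi> ?L N"
    and scale: "\<And>c f. f \<in> ?L \<Longrightarrow> \<phi> (\<lambda>w. c * f w) = (\<lambda>w. c * \<phi> f w)"
    and mult: "\<And>f h. f \<in> ?L \<Longrightarrow> h \<in> hecke_carrier n \<Longrightarrow> \<phi> (hecke_mult n q f h) = hecke_mult n q (\<phi> f) h"
    by (auto simp: has_submodule_isomorphic_to_def is_right_module_iso_def)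
  define f where "f = \<phi> (hecke_ones n)"
  have ones: "hecke_ones n \<in> ?L" by (rule right_ideal_self)
  have f: "f \<in> right_ideal n q z" using bij_betwE[OF bij] ones N unfolding f_def by blast
  have fc: "f \<in> hecke_carrier n" using f right_ideal_carrier[OF z] by blast
  have eig: "hecke_mult_simple n q f i = (\<lambda>v. q * f v)" if i: "1 \<le> i" "i < n" for i
  proof -
    have "hecke_T (simple_refl i) \<in> hecke_carrier n" using i by (intro hecke_T_in_carrier simple_refl_sym_grp)
    from mult[OF ones this] have "hecke_mult_simple n q f i = \<phi> (\<lambda>v. q * hecke_ones n v)"
      by (simp add: f_def hecke_mult_T_simple[OF i] hecke_ones_eigenvector[OF i])
    then show ?thesis by (simp add: scale[OF ones] f_def)
  qed
  have "f id \<noteq> 0"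
  proof
    assume "f id = 0"
    then have "f v = 0 * f v" for v
      using fun_cong[OF eigenvector_eq_ones[OF q fc eig], of v] by (simp only: mult_zero_left)
    then have "f = (\<lambda>v. 0 * f v)" by (rule ext)
    then have "\<phi> (hecke_ones n) = \<phi> (\<lambda>v. 0 * hecke_ones n v)" using scale[OF ones, of 0] by (simp add: f_def)
    moreover have "(\<lambda>v. 0 * hecke_ones n v) \<in> ?L" unfolding right_ideal_ones by blast
    ultimately have "hecke_ones n = (\<lambda>v. 0 * hecke_ones n v :: 'a)"
      using bij ones by (meson bij_betw_imp_inj_on inj_onD)
    then have "hecke_ones n id = (0::'a)" by (metis mult_zero_left)
    moreover have "hecke_ones n id = (1::'a)" unfolding hecke_ones_def by (simp only: id_sym_grp if_True)
    ultimately show False by simp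
  qed
  moreover have "hecke_ones n v = inverse (f id) * f v" for v
  proof -
    have "f v = f id * hecke_ones n v" using eigenvector_eq_ones[OF q fc eig] by (rule fun_cong)
    then have "inverse (f id) * f v = (inverse (f id) * f id) * hecke_ones n v" by (simp only: mult.assoc)
    then show ?thesis using \<open>f id \<noteq> 0\<close> by simp
  qed
  ultimately have "hecke_ones n = (\<lambda>v. inverse (f id) * f v)" by blast
  then show "hecke_ones n \<in> right_ideal n q z"
    using right_ideal_scale[OF f, of "inverse (f id)"] by simp
qed

section \<open>The Specht module as a common kernel\<close>

context
  fixes q :: "'a::field" and n \<mu>
  assumes q: "q \<noteq> 0" and \<mu>: "is_partition n \<mu>" "\<mu> \<noteq> []"
begin

definition specht_vector :: "(nat \<Rightarrow> nat) \<Rightarrow> 'a" where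
  "specht_vector = antisymmetrizer q n (row_word (conjugate \<mu>)) (col_word \<mu>)"

lemma n_eq: "sum_list \<mu> = n" by (rule sum_\<mu>[OF \<mu>])

lemma row_word_mono': "1 \<le> x \<Longrightarrow> x \<le> y \<Longrightarrow> y \<le> n \<Longrightarrow> row_word \<mu> x \<le> row_word \<mu> y"
  using row_word_mono[of x y \<mu>] n_eq by simp

lemma row_word_outside': "k \<notin> {1..n} \<Longrightarrow> row_word \<mu> k = 0"
  using row_word_outside[of k \<mu>] n_eq by simp

lemma reduced_word_set: "w \<in> sym_grp n \<Longrightarrow> set (reduced_word n w) \<subseteq> {1..<n}"
  using reduced_reduced_word[of w n] by (simp add: reduced_def is_word_def)

lemma lift_act:
  "1 \<le> i \<Longrightarrow> i < n \<Longrightarrow>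
   hecke_mult_simple n q (lift n (row_word \<mu>) F) i = lift n (row_word \<mu>) (act q F i)"
  by (rule hecke_mult_simple_lift) (use row_word_mono' in auto)

lemma lift_act_word:
  "w \<in> sym_grp n \<Longrightarrow> hecke_mult_word n q (lift n (row_word \<mu>) F) (reduced_word n w)
   = lift n (row_word \<mu>) (foldl (act q) F (reduced_word n w))"
  by (rule hecke_mult_word_lift[OF reduced_word_set]) (use row_word_mono' in auto)

text \<open>
  By \<open>act_word_single\<close>, both \<open>T\<close> for \<open>w\<^sub>\<mu>\<close> and the terms of
  \<open>y\<close> act on single words by mere permutation of letters.
\<close>

lemma specht_eq: "specht q \<mu> = right_ideal n q (lift n (row_word \<mu>) specht_vector)"
proof -
  let ?a = "row_word \<mu>"
  have w: "w_tab \<mu> \<in> sym_grp n" using w_tab_spec(1)[of \<mu>] by (simp only: n_eq)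
  have "hecke_mult n q (hecke_x \<mu>) (hecke_T (w_tab \<mu>))
      = lift n ?a (foldl (act q) (single ?a) (reduced_word n (w_tab \<mu>)))"
    unfolding hecke_x_eq_lift n_eq hecke_mult_T[OF w] by (rule lift_act_word[OF w])
  also have "foldl (act q) (single ?a) (reduced_word n (w_tab \<mu>)) = single (col_word \<mu>)"
    using act_word_single[OF reduced_reduced_word[OF w], of ?a q] inversions_w_tab[of _ _ \<mu>]
    unfolding n_eq row_word_w_tab by blast
  finally have x: "hecke_mult n q (hecke_x \<mu>) (hecke_T (w_tab \<mu>)) = lift n ?a (single (col_word \<mu>))" .
  let ?Y = "young_subgroup n (row_word (conjugate \<mu>))"
  have "hecke_mult n q (lift n ?a (single (col_word \<mu>))) (hecke_y q (conjugate \<mu>))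
      = (\<lambda>v. \<Sum>u\<in>?Y. (- q) powi (- int (card (inversions n u))) *
          hecke_mult n q (lift n ?a (single (col_word \<mu>))) (hecke_T u) v)"
    unfolding hecke_y_eq[OF \<mu>] by (rule hecke_mult_sum)
  also have "\<dots> = (\<lambda>v. \<Sum>u\<in>?Y. (- q) powi (- int (card (inversions n u))) *
          lift n ?a (single (col_word \<mu> \<circ> inv u)) v)"
  proof (intro ext sum.cong refl)
    fix v u assume u: "u \<in> ?Y"
    have us: "u \<in> sym_grp n" using u by (simp add: young_subgroup_def)
    have "foldl (act q) (single (col_word \<mu>)) (reduced_word n u) = single (col_word \<mu> \<circ> inv u)"
      using act_word_single[OF reduced_reduced_word[OF us], of "col_word \<mu>" q] inversions_column_group[OF \<mu> u] by blast
    then show "(- q) powi (- int (card (inversions n u))) * hecke_mult n q (lift n ?a (single (col_word \<mu>))) (hecke_T u) v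
        = (- q) powi (- int (card (inversions n u))) * lift n ?a (single (col_word \<mu> \<circ> inv u)) v"
      by (simp only: hecke_mult_T[OF us] lift_act_word[OF us])
  qed
  also have "\<dots> = lift n ?a specht_vector"
    by (auto simp: lift_def specht_vector_def antisymmetrizer_def)
  finally show ?thesis unfolding specht_def Let_def n_eq x right_ideal_def by simp
qed

lemma col_word_in_words: "col_word \<mu> \<in> words_of n (row_word \<mu>)"
  unfolding words_of_def row_word_w_tab[symmetric] using w_tab_spec(1)[of \<mu>] unfolding n_eq by (rule imageI)

lemma words_iff: "b \<in> words_of n (row_word \<mu>) \<longleftrightarrow>
    (\<forall>k. k \<notin> {1..n} \<longrightarrow> b k = 0) \<and> (\<forall>r. cnt b n r = cnt (row_word \<mu>) n r)"
  by (rule words_of_iff) (rule row_word_outside')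

lemma words_cnt: "b \<in> words_of n (row_word \<mu>) \<Longrightarrow> cnt b n r = cnt (col_word \<mu>) n r"
  using col_word_in_words unfolding words_iff by simp

lemma words_outside: "b \<in> words_of n (row_word \<mu>) \<Longrightarrow> k \<notin> {1..n} \<Longrightarrow> b k = 0"
  unfolding words_iff by blast

lemma words_ext:
  assumes "a \<in> words_of n (row_word \<mu>)" "b \<in> words_of n (row_word \<mu>)" "\<And>k. 1 \<le> k \<Longrightarrow> k \<le> n \<Longrightarrow> a k = b k"
  shows "a = b"
proof
  fix k show "a k = b k"
    using assms(3)[of k] words_outside[OF assms(1), of k] words_outside[OF assms(2), of k]
    by (cases "k \<in> {1..n}") auto
qed

lemma words_pos: 
  assumes b: "b \<in> words_of n (row_word \<mu>)" and k: "1 \<le> k" "k \<le> n"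
  shows "1 \<le> b k"
proof (rule ccontr)
  assume "\<not> 1 \<le> b k"
  then have "k \<in> {k \<in> {1..n}. b k = 0}" using k by simp
  moreover have "finite {k \<in> {1..n}. b k = 0}" by simp
  ultimately have "cnt b n 0 \<noteq> 0" unfolding cnt_def by (metis card_0_eq empty_iff)
  then show False using words_cnt[OF b, of 0] cnt_col_word_n[OF \<mu>, of 0] by simp
qed

lemma specht_vector_supp: "specht_vector b \<noteq> 0 \<Longrightarrow> b \<in> words_of n (row_word \<mu>) \<and> dominated n b (col_word \<mu>)"
proof -
  assume "specht_vector b \<noteq> 0"
  then obtain u where u: "u \<in> young_subgroup n (row_word (conjugate \<mu>))"
    and "single (col_word \<mu> \<circ> inv u) b \<noteq> (0::'a)"
    unfolding specht_vector_def antisymmetrizer_def by (metis (no_types, lifting) mult_zero_right sum.neutral)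
  then have b: "b = col_word \<mu> \<circ> inv u" by (auto simp: single_def split: if_splits)
  have us: "u \<in> sym_grp n" using u by (simp add: young_subgroup_def)
  have dom: "dominated n b (col_word \<mu>)"
    unfolding b using act_word_single[OF reduced_reduced_word[OF us]] inversions_column_group[OF \<mu> u] by blast
  have "cnt b n r = cnt (row_word \<mu>) n r" for r
    unfolding b cnt_comp_inv[OF us] using words_cnt[OF self_in_words_of] by simp
  moreover have "b k = 0" if "k \<notin> {1..n}" for k
  proof -
    have "inv u k \<notin> {1..n}" using that sym_grp_in_iff[OF inv_sym_grp[OF us]] by blast
    then show ?thesis using words_outside[OF col_word_in_words] b by simp
  qed
  ultimately show ?thesis using dom unfolding words_iff by blast
qed

text \<open>
  The entries of a column are distinct, so only the identity fixes the column word.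
\<close>

lemma specht_vector_top: "top_word n specht_vector (col_word \<mu>)"
proof -
  have uid: "u = id" if u: "u \<in> young_subgroup n (row_word (conjugate \<mu>))" "col_word \<mu> = col_word \<mu> \<circ> inv u" for u
  proof
    fix k
    have us: "u \<in> sym_grp n" using u by (simp add: young_subgroup_def)
    show "u k = id k"
    proof (cases "k \<in> {1..n}")
      case True
      have "u k \<in> {1..n}" using True sym_grp_in_iff[OF us] by blast
      moreover have "row_word (conjugate \<mu>) (u k) = row_word (conjugate \<mu>) k"
        using u True by (simp add: young_subgroup_def)
      moreover have "inv u (u k) = k" using sym_grp_inv_eq_iff[OF us] by blast
      then have "col_word \<mu> (u k) = col_word \<mu> k" using fun_cong[OF u(2), of "u k"] by simp
      ultimately show ?thesis using col_word_unique[OF \<mu> _ True] by simp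
    next
      case False
      then show ?thesis using us by (auto simp: sym_grp_def permutes_not_in)
    qed
  qed
  have idY: "id \<in> young_subgroup n (row_word (conjugate \<mu>))" unfolding young_subgroup_def by simp
  have "specht_vector (col_word \<mu>) = (\<Sum>u\<in>young_subgroup n (row_word (conjugate \<mu>)). 
      if u = id then (- q) powi (- int (card (inversions n u))) else 0)"
    unfolding specht_vector_def antisymmetrizer_def
  proof (intro sum.cong refl)
    fix u assume u: "u \<in> young_subgroup n (row_word (conjugate \<mu>))"
    have "col_word \<mu> = col_word \<mu> \<circ> inv u \<longleftrightarrow> u = id"
      using uid[OF u] by (metis comp_id inv_id)
    then show "(- q) powi (- int (card (inversions n u))) * single (col_word \<mu> \<circ> inv u) (col_word \<mu>)
       = (if u = id then (- q) powi (- int (card (inversions n u))) else 0)" by (simp add: single_def)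
  qed
  also have "\<dots> = (- q) powi (- int (card (inversions n id)))"
    by (subst sum.delta) (use idY in auto)
  finally have "specht_vector (col_word \<mu>) \<noteq> 0" using q by (simp add: power_int_eq_0_iff)
  then show ?thesis using specht_vector_supp by (simp add: top_word_def)
qed

lemma specht_vector_kernel: "specht_vector \<in> psi_kernel q n"
  unfolding specht_vector_def
  by (rule antisymmetrizer_in_kernel[OF q column_index_mono[OF \<mu>] col_word_step[OF \<mu>] col_word_unique[OF \<mu>]])

definition word_kernel :: "((nat \<Rightarrow> nat) \<Rightarrow> 'a) set" where
  "word_kernel = {F \<in> psi_kernel q n. \<forall>c. F c \<noteq> 0 \<longrightarrow> c \<in> words_of n (row_word \<mu>)}"

lemma word_kernel_lin: "F \<in> word_kernel \<Longrightarrow> G \<in> word_kernel \<Longrightarrow> (\<lambda>a. F a + x * G a) \<in> word_kernel"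
  using psi_kernel_lincomb[of F q n G 1 x] unfolding word_kernel_def
  by (auto, metis add_0 mult_zero_right)

lemma word_kernel_act:
  assumes F: "F \<in> word_kernel" and i: "1 \<le> i" "i < n"
  shows "act q F i \<in> word_kernel"
proof -
  have "c \<in> words_of n (row_word \<mu>)" if "act q F i c \<noteq> 0" for c
  proof -
    have "F c \<noteq> 0 \<or> F (c \<circ> simple_refl i) \<noteq> 0"
      using that by (auto simp: act_def split: if_splits)
    then show ?thesis
    proof
      assume "F (c \<circ> simple_refl i) \<noteq> 0"
      then have "c \<circ> simple_refl i \<in> words_of n (row_word \<mu>)" using F by (auto simp: word_kernel_def)
      from words_of_swap[OF this i] show ?thesis by simp
    qed (use F in \<open>auto simp: word_kernel_def\<close>)
  qed
  then show ?thesis using psi_kernel_act[OF _ i, of F q] F by (simp add: word_kernel_def)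
qed

lemma zero_in_word_kernel: "(\<lambda>_. 0) \<in> word_kernel"
  by (simp add: word_kernel_def psi_kernel_def psi_def)

text \<open>
  The inclusion of the Specht module in the kernel holds for its generator and is preserved by
  the action. The other inclusion is the elimination of leading words by the elements of the
  Specht module.
\<close>

lemma specht_eq_kernel: "specht q \<mu> = lift n (row_word \<mu>) ` word_kernel"
proof
  let ?a = "row_word \<mu>"
  show "specht q \<mu> \<subseteq> lift n ?a ` word_kernel"
    unfolding specht_eq
  proof (rule right_ideal_least)
    show "lift n ?a specht_vector \<in> lift n ?a ` word_kernel"
      using specht_vector_kernel specht_vector_supp by (intro imageI) (simp add: word_kernel_def)
    show "(\<lambda>_. 0) \<in> lift n ?a ` word_kernel"
      by (rule image_eqI[OF _ zero_in_word_kernel]) (simp add: lift_def)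
    show "(\<lambda>v. f v + x * g v) \<in> lift n ?a ` word_kernel"
      if fg: "f \<in> lift n ?a ` word_kernel" "g \<in> lift n ?a ` word_kernel" for f g x
    proof -
      obtain F G where "F \<in> word_kernel" "f = lift n ?a F" "G \<in> word_kernel" "g = lift n ?a G"
        using fg by blast
      then show ?thesis
        by (intro image_eqI[OF _ word_kernel_lin[of F G x]]) (auto simp: lift_def)
    qed
    show "hecke_mult_simple n q f i \<in> lift n ?a ` word_kernel"
      if f: "f \<in> lift n ?a ` word_kernel" and i: "1 \<le> i" "i < n" for f i
    proof -
      obtain F where "F \<in> word_kernel" "f = lift n ?a F" using f by blast
      then show ?thesis using lift_act[OF i, of F] word_kernel_act[OF _ i, of F] by blast
    qed
  qed
  define S where "S = {F \<in> word_kernel. lift n ?a F \<in> specht q \<mu>}"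
  have carrier: "lift n ?a specht_vector \<in> hecke_carrier n" by (rule lift_carrier)
  have lin: "(\<lambda>a. F a + x * G a) \<in> S" if "F \<in> S" "G \<in> S" for F G x
  proof -
    have "(\<lambda>v. 1 * lift n ?a F v + x * lift n ?a G v) \<in> specht q \<mu>"
      using that unfolding S_def specht_eq by (intro right_ideal_lin) auto
    also have "(\<lambda>v. 1 * lift n ?a F v + x * lift n ?a G v) = lift n ?a (\<lambda>a. F a + x * G a)"
      by (auto simp: lift_def)
    finally show ?thesis using word_kernel_lin that by (simp add: S_def)
  qed
  have act: "act q F i \<in> S" if F: "F \<in> S" and i: "1 \<le> i" "i < n" for F i
  proof -
    have "hecke_mult_simple n q (lift n ?a F) i \<in> specht q \<mu>"
      using F unfolding S_def specht_eq by (intro right_ideal_mult_simple[OF carrier _ i]) auto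
    then show ?thesis
      using word_kernel_act[OF _ i, of F] F unfolding S_def lift_act[OF i] by simp
  qed
  have Z: "specht_vector \<in> S"
    using specht_vector_kernel specht_vector_supp right_ideal_self[of "lift n ?a specht_vector" n q]
    by (auto simp: S_def word_kernel_def specht_eq)
  have zero: "(\<lambda>_. 0) \<in> S"
  proof -
    have "(\<lambda>a. specht_vector a + (- 1) * specht_vector a) \<in> S" by (rule lin[OF Z Z])
    then show ?thesis by simp
  qed
  have tops: "\<exists>F\<in>S. top_word n F b" if "b \<in> words_of n ?a" "ballot n b" for b
    by (rule top_words_exist[OF q Z specht_vector_top col_word_in_words _ _ _ _ _
          ballot_col_word[OF \<mu>] _ that])
      (erule (2) act, erule (2) words_of_swap, erule (1) words_ext, blast,
        erule (2) words_pos, erule words_cnt, erule (2) col_word_column_filling[OF \<mu>])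
  show "lift n ?a ` word_kernel \<subseteq> specht q \<mu>"
  proof
    fix f assume "f \<in> lift n ?a ` word_kernel"
    then obtain F where F: "F \<in> word_kernel" "f = lift n ?a F" by blast
    have "F \<in> S"
      by (rule psi_kernel_subset_of_top_words[OF q finite_words_of words_ext zero lin _ _ tops])
        (use F in \<open>auto simp: S_def word_kernel_def\<close>)
    then show "f \<in> specht q \<mu>" using F by (simp add: S_def)
  qed
qed

lemma ones_in_specht_iff:
  "hecke_ones n \<in> specht q \<mu> \<longleftrightarrow> (indicator_words n (row_word \<mu>) :: _ \<Rightarrow> 'a) \<in> psi_kernel q n"
proof -
  let ?a = "row_word \<mu>"
  have lift: "lift n ?a (indicator_words n ?a) = (hecke_ones n :: 'a hecke)"
    by (auto simp: lift_def indicator_words_def hecke_ones_def words_of_def)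
  have "F = indicator_words n ?a" if F: "F \<in> word_kernel" "hecke_ones n = lift n ?a F" for F
  proof
    fix b show "F b = indicator_words n ?a b"
    proof (cases "b \<in> words_of n ?a")
      case True
      then obtain v where v: "v \<in> sym_grp n" "b = ?a \<circ> inv v" by (auto simp: words_of_def)
      have "F b = 1" using fun_cong[OF F(2), of v] v by (simp add: hecke_ones_def lift_def)
      then show ?thesis using True by (simp add: indicator_words_def)
    next
      case False
      then show ?thesis using F(1) by (auto simp: indicator_words_def word_kernel_def)
    qed
  qed
  then have "hecke_ones n \<in> lift n ?a ` word_kernel \<longleftrightarrow> (indicator_words n ?a :: _ \<Rightarrow> 'a) \<in> word_kernel"
    using imageI[of "indicator_words n ?a" word_kernel "lift n ?a"] unfolding lift by auto
  also have "\<dots> \<longleftrightarrow> (indicator_words n ?a :: _ \<Rightarrow> 'a) \<in> psi_kernel q n"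
    by (auto simp: word_kernel_def indicator_words_def)
  finally show ?thesis unfolding specht_eq_kernel .
qed

end

text \<open>
  There is only one word of content \<open>[n]\<close>, so the generator is a nonzero multiple of
  \<open>\<Sum>w. T\<^sub>w\<close>.
\<close>

lemma specht_trivial:
  assumes q: "q \<noteq> 0" and n: "n \<ge> 1"
  shows "specht q [n] = right_ideal n q (hecke_ones n)"
proof -
  have \<mu>: "is_partition n [n]" "[n] \<noteq> []" using n by (auto simp: is_partition_def)
  have row: "row_word [n] k = (if k \<in> {1..n} then 1 else 0)" for k
  proof (cases "k \<in> {1..n}")
    case True
    then obtain x where "x \<in> diagram [n]" "k = row_tableau [n] x" using row_tableau_cases[of k "[n]"] by auto
    then show ?thesis using True by (auto simp: row_word_tableau diagram_def)
  qed (use row_word_outside[of k "[n]"] in auto)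
  have words: "words_of n (row_word [n]) = {row_word [n]}"
  proof -
    have "row_word [n] \<circ> inv v = row_word [n]" if v: "v \<in> sym_grp n" for v
      using sym_grp_in_iff[OF inv_sym_grp[OF v]] by (auto simp: row fun_eq_iff)
    then show ?thesis using self_in_words_of[of "row_word [n]" n] by (auto simp: words_of_def)
  qed
  define k where "k = specht_vector q n [n] (row_word [n])"
  have "col_word [n] = row_word [n]" using col_word_in_words[OF q \<mu>] words by blast
  then have k: "k \<noteq> 0" using specht_vector_top[OF q \<mu>] by (simp add: k_def top_word_def)
  define z where "z = lift n (row_word [n]) (specht_vector q n [n])"
  have z: "z = (\<lambda>v. k * hecke_ones n v)"
  proof
    fix v
    have "row_word [n] \<circ> inv v = row_word [n]" if "v \<in> sym_grp n"
      using words that by (auto simp: words_of_def)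
    then show "z v = k * hecke_ones n v" by (simp add: z_def lift_def hecke_ones_def k_def)
  qed
  have "hecke_mult_simple n q z i = (\<lambda>v. q * z v)" if "1 \<le> i" "i < n" for i
    using hecke_mult_simple_lincomb[of n q k "hecke_ones n" 0 "hecke_ones n" i] hecke_ones_eigenvector[OF that, of q]
    by (simp add: z mult_ac)
  from hecke_mult_eigenvector[OF this] have "right_ideal n q z \<subseteq> range (\<lambda>c v. c * hecke_ones n v)"
    unfolding right_ideal_def by (auto simp: z mult.assoc[symmetric])
  moreover have "range (\<lambda>c v. c * hecke_ones n v) \<subseteq> right_ideal n q z"
  proof
    fix f :: "'a hecke" assume "f \<in> range (\<lambda>c v. c * hecke_ones n v)"
    then obtain c where c: "f = (\<lambda>v. c * hecke_ones n v)" by blast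
    have "f = (\<lambda>v. (c / k) * z v)" using k by (simp add: z c)
    then show "f \<in> right_ideal n q z" by (simp only: right_ideal_scale[OF right_ideal_self])
  qed
  ultimately show ?thesis
    unfolding right_ideal_ones specht_eq[OF q \<mu>] z_def by blast
qed

section \<open>Trivial submodules of Specht modules\<close>

lemma trivial_submodule_specht_iff:
  fixes q :: "'a::field"
  assumes q: "q \<noteq> 0" and n: "n \<ge> 1" and \<mu>: "is_partition n \<mu>"
  shows "has_submodule_isomorphic_to n q (specht q \<mu>) (specht q [n]) \<longleftrightarrow>
    (\<forall>i. 1 \<le> i \<and> i < length \<mu> \<longrightarrow> (\<forall>t. 1 \<le> t \<and> t \<le> part \<mu> (i + 1) \<longrightarrow>
       coeff (q_linear_prod q (part \<mu> i + t)) t = 0))"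
proof -
  have ne: "\<mu> \<noteq> []" using \<mu> n by (auto simp: is_partition_def)
  have cnt: "cnt (row_word \<mu>) n r = (if 1 \<le> r \<and> r \<le> length \<mu> then part \<mu> r else 0)" for r
    using words_cnt[OF q \<mu> ne self_in_words_of] cnt_col_word_n[OF \<mu> ne] by simp
  have "has_submodule_isomorphic_to n q (specht q \<mu>) (specht q [n]) \<longleftrightarrow> hecke_ones n \<in> specht q \<mu>"
    unfolding specht_trivial[OF q n] specht_eq[OF q \<mu> ne]
    by (rule trivial_submodule_iff[OF q lift_carrier])
  also have "\<dots> \<longleftrightarrow> (\<forall>r\<ge>1. \<forall>t. 1 \<le> t \<and> t \<le> cnt (row_word \<mu>) n (Suc r) \<longrightarrow>
      coeff (q_linear_prod q (cnt (row_word \<mu>) n r + t)) t = 0)"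
    unfolding ones_in_specht_iff[OF q \<mu> ne]
    by (rule indicator_words_in_kernel_iff[OF row_word_outside'[OF q \<mu> ne]])
  also have "\<dots> \<longleftrightarrow> (\<forall>i. 1 \<le> i \<and> i < length \<mu> \<longrightarrow> (\<forall>t. 1 \<le> t \<and> t \<le> part \<mu> (i + 1) \<longrightarrow>
       coeff (q_linear_prod q (part \<mu> i + t)) t = 0))"
    unfolding cnt by (auto simp: Suc_le_eq)
  finally show ?thesis .
qed

text \<open>
  For an inner part, \<open>\<mu>\<^sub>i < e\<close> and \<open>e dvd \<mu>\<^sub>i + 1\<close> force
  \<open>\<mu>\<^sub>i = e - 1\<close>.
\<close>

lemma char_zero_condition:
  assumes e: "e > 1" and \<mu>: "is_partition n \<mu>" and n: "n \<ge> 1"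
  shows "(\<forall>i. 1 \<le> i \<and> i < length \<mu> \<longrightarrow> e dvd part \<mu> i + 1 \<and> part \<mu> (i + 1) < e) \<longleftrightarrow>
    \<mu> = [n] \<or> char_zero_shape e \<mu>"
proof
  let ?l = "length \<mu>"
  assume C: "\<forall>i. 1 \<le> i \<and> i < ?l \<longrightarrow> e dvd part \<mu> i + 1 \<and> part \<mu> (i + 1) < e"
  show "\<mu> = [n] \<or> char_zero_shape e \<mu>"
  proof (cases "?l \<ge> 2")
    case False
    have "\<mu> \<noteq> []" using \<mu> n by (auto simp: is_partition_def)
    then have "?l \<noteq> 0" by simp
    then have "?l = 1" using False by linarith
    then obtain m where "\<mu> = [m]" by (auto simp: length_Suc_conv)
    then show ?thesis using \<mu> by (simp add: is_partition_def)
  next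
    case True
    then obtain d where d: "?l = Suc (Suc d)" by (metis add_2_eq_Suc le_Suc_ex)
    have mid: "part \<mu> i = e - 1" if i: "2 \<le> i" "i < ?l" for i
    proof -
      obtain j where j: "i = Suc j" using i by (cases i) auto
      have "e dvd part \<mu> i + 1" using C i by simp
      moreover have "part \<mu> i < e" using C[rule_format, of j] i j by simp
      ultimately show ?thesis using dvd_imp_le[of e "part \<mu> i + 1"] by simp
    qed
    have "\<mu> = [part \<mu> 1] @ replicate (?l - 2) (e - 1) @ [part \<mu> ?l]"
    proof (rule nth_equalityI)
      fix k assume k: "k < ?l"
      consider "k = 0" | "1 \<le> k" "k < ?l - 1" | "k = ?l - 1" using k by linarith
      then show "\<mu> ! k = ([part \<mu> 1] @ replicate (?l - 2) (e - 1) @ [part \<mu> ?l]) ! k"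
      proof cases
        case 1
        then show ?thesis by (simp add: part_def)
      next
        case 2
        then have "\<mu> ! k = e - 1" using mid[of "Suc k"] by (simp add: part_def)
        then show ?thesis using 2 by (simp add: nth_append nth_Cons')
      next
        case 3
        then show ?thesis by (simp add: d nth_append part_def)
      qed
    qed (use True in simp)
    moreover have "e dvd part \<mu> 1 + 1" using C True by simp
    moreover have "part \<mu> (Suc (Suc d)) < e" using C[rule_format, of "Suc d"] by (simp add: d)
    then have "part \<mu> ?l \<le> e - 1" unfolding d by linarith
    ultimately show ?thesis using True by (simp add: char_zero_shape_def Let_def)
  qed
next
  let ?l = "length \<mu>"
  assume "\<mu> = [n] \<or> char_zero_shape e \<mu>"
  then show "\<forall>i. 1 \<le> i \<and> i < ?l \<longrightarrow> e dvd part \<mu> i + 1 \<and> part \<mu> (i + 1) < e"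
  proof
    assume "char_zero_shape e \<mu>"
    then have l: "2 \<le> ?l" and eq: "\<mu> = [part \<mu> 1] @ replicate (?l - 2) (e - 1) @ [part \<mu> ?l]"
      and last: "part \<mu> ?l \<le> e - 1" and first: "e dvd part \<mu> 1 + 1"
      unfolding char_zero_shape_def Let_def by blast+
    have mid: "part \<mu> i = e - 1" if i: "2 \<le> i" "i < ?l" for i
    proof -
      have "\<mu> ! (i - 1) = ([part \<mu> 1] @ replicate (?l - 2) (e - 1) @ [part \<mu> ?l]) ! (i - 1)"
        by (rule arg_cong[where f = "\<lambda>xs. xs ! (i - 1)", OF eq])
      also have "\<dots> = e - 1" using i by (simp add: nth_append nth_Cons')
      finally show ?thesis by (simp add: part_def)
    qed
    show ?thesis
    proof (intro allI impI)
      fix i assume i: "1 \<le> i \<and> i < ?l"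
      have "part \<mu> i = part \<mu> 1 \<or> part \<mu> i = e - 1" using mid[of i] i by (cases "i = 1") auto
      then have "e dvd part \<mu> i + 1" using first e by auto
      moreover have "part \<mu> (i + 1) \<le> e - 1" using mid[of "i + 1"] last i by (cases "i + 1 = ?l") auto
      ultimately show "e dvd part \<mu> i + 1 \<and> part \<mu> (i + 1) < e" using e by linarith
    qed
  qed auto
qed

theorem theorem3p3:
  fixes q :: "'a::field" and n e l p :: nat and \<mu> :: "nat list"
  assumes "p = CHAR('a)"
    and "q \<noteq> 0"
    and "n \<ge> 1"
    and "is_quantum_char q e"
    and "is_partition n \<mu>"
    and "length \<mu> = l"
  shows "(p = 0 \<longrightarrow>
            (has_submodule_isomorphic_to n q (specht q \<mu>) (specht q [n]) \<longleftrightarrow>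
               \<mu> = [n] \<or> char_zero_shape e \<mu>)) \<and>
         (p > 0 \<longrightarrow>
            (has_submodule_isomorphic_to n q (specht q \<mu>) (specht q [n]) \<longleftrightarrow>
               (\<forall>i. 1 \<le> i \<and> i < l \<longrightarrow>
                  [int (part \<mu> i) = - 1]
                    (mod int (e * p ^ ell p (part \<mu> (i + 1) div e))))))"
proof -
  have e: "e > 1" using assms(4) by (simp add: is_quantum_char_def)
  have pos: "1 \<le> part \<mu> (i + 1)" if "i < l" for i
  proof -
    have "\<mu> ! i \<in> set \<mu>" using that assms(6) by simp
    then have "\<mu> ! i \<noteq> 0" using assms(5) by (metis is_partition_def)
    then show ?thesis by (simp add: part_def)
  qed
  note iff = trivial_submodule_specht_iff[OF assms(2,3,5)]
  have cong: "[int a = - 1] (mod int k) \<longleftrightarrow> k dvd a + 1" for a k :: nat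
  proof -
    have "[int a = - 1] (mod int k) \<longleftrightarrow> int k dvd int (a + 1)" by (simp add: cong_iff_dvd_diff add.commute)
    then show ?thesis by (simp only: int_dvd_int_iff)
  qed
  show ?thesis
  proof (intro conjI impI)
    assume "p = 0"
    then have "has_submodule_isomorphic_to n q (specht q \<mu>) (specht q [n]) \<longleftrightarrow>
        (\<forall>i. 1 \<le> i \<and> i < length \<mu> \<longrightarrow> e dvd part \<mu> i + 1 \<and> part \<mu> (i + 1) < e)"
      unfolding iff using q_binomials_vanish_iff_char_0[OF assms(4,2)] pos assms(1,6) by metis
    then show "has_submodule_isomorphic_to n q (specht q \<mu>) (specht q [n]) \<longleftrightarrow>
        \<mu> = [n] \<or> char_zero_shape e \<mu>"
      using char_zero_condition[OF e assms(5,3)] by simp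
  next
    assume "p > 0"
    then show "has_submodule_isomorphic_to n q (specht q \<mu>) (specht q [n]) \<longleftrightarrow>
        (\<forall>i. 1 \<le> i \<and> i < l \<longrightarrow> [int (part \<mu> i) = - 1] (mod int (e * p ^ ell p (part \<mu> (i + 1) div e))))"
      unfolding iff cong using q_binomials_vanish_iff_char_pos[OF assms(4,2)] pos assms(1,6) by metis
  qed
qed

end
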